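(* Let $\mathbf p\in\mathbb Z^2\setminus\{0\}$ be such that there exists $\mathbf q\in\mathbb Z^2$ with $\|\mathbf q\|<\|\mathbf p\|$ and $\|\mathbf q+n\mathbf p\|>\|\mathbf p\|$ for all $n\in\mathbb Z\setminus\{0\}$; fix such a $\mathbf q$, and let $\alpha\in\mathbb R\setminus\{0\}$. Let $L$ and $L_{\mathbf q}$ be the operators defined in the context. (i) Suppose the normalization $\tfrac12\alpha(\mathbf q\wedge\mathbf p)\|\mathbf p\|^{-2}=1$ holds. Then the eigenvalues of $L_{\mathbf q}$ with positive real part are in one-to-one correspondence with the zeros, in $\{\operatorname{Re}\lambda>0\}$, of each of the five functions $\det(I-K_\lambda)$, $\det(I-T_\lambda)$, $\mathcal E(\lambda)$, $\mathcal F(\lambda)$, $\mathcal G(\lambda)$ defined in the context with $\rho_n=1-\|\mathbf p\|^2\|\mathbf q+n\mathbf p\|^{-2}$, $n\in\mathbb Z$; that is, $\lambda$ with $\operatorname{Re}\lambda>0$ is an eigenvalue of $L_{\mathbf q}$ if and only if it is a zero of each of these functions. (ii) The operator $L_{\mathbf q}$, and hence $L$, has a positive eigenvalue; consequently the steady state $\Omega^0(\mathbf x)=\alpha\cos(\mathbf p\cdot\mathbf x)$ of the Euler equations on $\mathbb T^2$ is linearly unstable.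
   Context: $\|\cdot\|$ is the Euclidean norm and $\mathbf p\wedge\mathbf q=p_1q_2-p_2q_1$. For $\mathbf p,\mathbf q\in\mathbb Z^2$ set $\beta(\mathbf p,\mathbf q)=\frac12(\|\mathbf q\|^{-2}-\|\mathbf p\|^{-2})(\mathbf p\wedge\mathbf q)$ if $\mathbf p\ne0$, $\mathbf q\neq0$, and $\beta(\mathbf p,\mathbf q)=0$ otherwise. The 2D Euler equation on $\mathbb T^2$ in vorticity form, in Fourier coefficients, is $\frac{d\omega_{\mathbf k}}{dt}=\sum_{\mathbf q\in\mathbb Z^2\setminus\{0\}}\beta(\mathbf k-\mathbf q,\mathbf q)\omega_{\mathbf k-\mathbf q}\omega_{\mathbf q}$, $\mathbf k\in\mathbb Z^2\setminus\{0\}$. The unidirectional (generalized Kolmogorov) flow is the steady state $\Omega^0(\mathbf x)=\alpha\cos(\mathbf p\cdot\mathbf x)$. Its linearization is the operator on $\ell^2(\mathbb Z^2;\mathbb C)$ $$L:(\omega_{\mathbf k})\mapsto\big(\alpha\beta(\mathbf p,\mathbf k-\mathbf p)\omega_{\mathbf k-\mathbf p}-\alpha\beta(\mathbf p,\mathbf k+\mathbf p)\omega_{\mathbf k+\mathbf p}\big)_{\mathbf k\in\mathbb Z^2}.$$ The flow is called linearly unstable if $L$ has non-imaginary spectrum. For $\mathbf q\in\mathbb Z^2$, the restriction of $L$ to sequences supported on $\{\mathbf q+n\mathbf p:n\in\mathbb Z\}$, with $w_n=\omega_{\mathbf q+n\mathbf p}$, is the operator on $\ell^2(\mathbb Z;\mathbb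 C)$ $$L_{\mathbf q}:(w_n)\mapsto\big(\alpha\beta(\mathbf p,\mathbf q+(n-1)\mathbf p)w_{n-1}-\alpha\beta(\mathbf p,\mathbf q+(n+1)\mathbf p)w_{n+1}\big)_{n\in\mathbb Z}.$$ Definition of the five functions. Let $\rho_n=1-\|\mathbf p\|^2\|\mathbf q+n\mathbf p\|^{-2}$; under the assumption on $\mathbf p,\mathbf q$ one has $\rho_0<0$, $\rho_n\in(0,1)$ for $n\ne0$, and $\rho_n=1+O(1/n^2)$. Let $\lambda\in\mathbb C\setminus[-2\mathrm i,2\mathrm i]$. Consider ( * ) $z_{n-1}-z_{n+1}=\frac{\lambda}{\rho_n}z_n$, $n\in\mathbb Z$. Put $b_n=-\lambda\sqrt{1-\rho_n}/\rho_n$, $c_n=\sqrt{1-\rho_n}$; $S:(w_n)\mapsto(w_{n-1})$ and $S^*:(w_n)\mapsto(w_{n+1})$ are the shifts on $\ell^2(\mathbb Z;\mathbb C)$ or $\ell^2(\mathbb Z;\mathbb C^2)$. Put $$A=\begin{bmatrix}-\lambda&1\\1&0\end{bmatrix},\quad A_n^\times=\begin{bmatrix}-\lambda/\rho_n&1\\1&0\end{bmatrix},\quad Q_+=\begin{bmatrix}1&0\\0&0\end{bmatrix},\quad B_n=b_nQ_+,\quad C_n=c_nQ_+.$$ The eigenvalues $\mu_\pm$ of $A$ are labelled so that $|\mu_+|<1<|\mu_-|$; $P_\pm$ are the corresponding Riesz projections. 1. $K_\lambda=-\operatorname{diag}\{c_n\}(S-S^*-\lambda)^{-1}\operatorname{diag}\{b_n\}$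 (trace class on $\ell^2(\mathbb Z;\mathbb C)$). 2. $T_\lambda=\operatorname{diag}\{C_n\}(S^*-\operatorname{diag}\{A\})^{-1}\operatorname{diag}\{B_n\}$ (trace class on $\ell^2(\mathbb Z;\mathbb C^2)$). The determinants of $I-K_\lambda$ and $I-T_\lambda$ are Fredholm determinants. 3. $\mathcal E(\lambda)=\det(Y_0^++Y_0^-)$, where $(Y_n^\pm)_{n\in\mathbb Z}$ are the unique $2\times2$-matrix solutions of $Y_{n+1}=A_n^\times Y_n$ with $\|\mu_\pm^{-n}(Y_n^\pm-A^nP_\pm)\|\to0$ as $n\to\pm\infty$ and $Y_0^\pm=Y_0^\pm P_\pm$. 4. $\mathcal F(\lambda)=(\mu_--\mu_+)^{-1}\mathcal W(\mathbf z^+,\mathbf z^-)_0$, where $\mathbf z^\pm=(z_n^\pm)$ are the unique solutions of ( * ) with $\mu_\pm^{-n}z_n^\pm\to1$ as $n\to\pm\infty$ (Jost solutions), and $\mathcal W(\mathbf u,\mathbf v)_n=(-1)^{n-1}(u_{n-1}v_n-u_nv_{n-1})$. 5. For $\operatorname{Re}\lambda>0$, $\mathcal G(\lambda)=z_0^+z_0^-(\mu_+-\mu_-)^{-1}\big(\frac{\lambda}{\rho_0}+g_+(\lambda)+g_-(\lambda)\big)$, with the convergent continued fractions $$g_+(\lambda)=\cfrac{1}{\frac{\lambda}{\rho_1}+\cfrac{1}{\frac{\lambda}{\rho_2}+\cdots}},\qquad g_-(\lambda)=\cfrac{1}{\frac{\lambda}{\rho_{-1}}+\cfrac{1}{\frac{\lambda}{\rho_{-2}}+\cdots}}.$$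 *)

theory Defs
  imports "HOL-Complex_Analysis.Complex_Analysis"
begin

definition l2 :: "('i \<Rightarrow> 'a::real_normed_vector) set" where
  "l2 = {w. (\<lambda>i. (norm (w i))\<^sup>2) summable_on UNIV}"

definition l2_norm :: "('i \<Rightarrow> 'a::real_normed_vector) \<Rightarrow> real" where
  "l2_norm w = sqrt (\<Sum>\<^sub>\<infinity>i. (norm (w i))\<^sup>2)"

text \<open>
  An operator in \<open>\<ell>\<^sup>2\<close> is represented by its formal action on all sequences and carries its
  maximal domain. This matters for the linearized Euler operator on \<open>\<int>\<^sup>2\<close>, which is unbounded;
  all the other operators below are bounded, with domain the whole of \<open>l2\<close>.
\<close>

definition l2_dom :: "(('i \<Rightarrow> complex) \<Rightarrow> 'i \<Rightarrow> complex) \<Rightarrow> ('i \<Rightarrow> complex) set" where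
  "l2_dom T = {w \<in> l2. T w \<in> l2}"

definition l2_eigenvalue :: "(('i \<Rightarrow> complex) \<Rightarrow> 'i \<Rightarrow> complex) \<Rightarrow> complex \<Rightarrow> bool" where
  "l2_eigenvalue T lam \<longleftrightarrow> (\<exists>w \<in> l2_dom T. w \<noteq> (\<lambda>i. 0) \<and> T w = (\<lambda>i. lam * w i))"

definition l2_resolvent_set :: "(('i \<Rightarrow> complex) \<Rightarrow> 'i \<Rightarrow> complex) \<Rightarrow> complex set" where
  "l2_resolvent_set T = {lam. bij_betw (\<lambda>w i. T w i - lam * w i) (l2_dom T) l2 \<and>
     (\<exists>C. \<forall>w \<in> l2_dom T. l2_norm w \<le> C * l2_norm (\<lambda>i. T w i - lam * w i))}"

definition l2_spectrum :: "(('i \<Rightarrow> complex) \<Rightarrow> 'i \<Rightarrow> complex) \<Rightarrow> complex set" where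
  "l2_spectrum T = - l2_resolvent_set T"

definition vec2 :: "int \<times> int \<Rightarrow> real \<times> real" where
  "vec2 k = (real_of_int (fst k), real_of_int (snd k))"

definition iscale :: "int \<Rightarrow> int \<times> int \<Rightarrow> int \<times> int" where
  "iscale n k = (n * fst k, n * snd k)"

definition wedge :: "int \<times> int \<Rightarrow> int \<times> int \<Rightarrow> int" where
  "wedge p q = fst p * snd q - snd p * fst q"

definition \<beta> :: "int \<times> int \<Rightarrow> int \<times> int \<Rightarrow> real" where
  "\<beta> p q = (if p \<noteq> 0 \<and> q \<noteq> 0
     then 1 / 2 * (1 / (norm (vec2 q))\<^sup>2 - 1 / (norm (vec2 p))\<^sup>2) * of_int (wedge p q) else 0)"

text \<open>A function on the torus is a function on the plane, \<open>2\<pi>\<close>-periodic in both variables, and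
  \<open>fourier_coeff \<Omega> k\<close> is the coefficient of \<open>exp (\<i> k \<bullet> x)\<close>.\<close>

definition fourier_coeff :: "(real \<times> real \<Rightarrow> real) \<Rightarrow> int \<times> int \<Rightarrow> complex" where
  "fourier_coeff \<Omega> k = integral (cbox (0, 0) (2 * pi, 2 * pi))
     (\<lambda>x. complex_of_real (\<Omega> x) * exp (- (\<i> * complex_of_real (vec2 k \<bullet> x)))) / (2 * pi)\<^sup>2"

definition euler_rhs :: "(int \<times> int \<Rightarrow> complex) \<Rightarrow> int \<times> int \<Rightarrow> complex" where
  "euler_rhs \<omega> k = (\<Sum>\<^sub>\<infinity>q\<in>-{0}. of_real (\<beta> (k - q) q) * \<omega> (k - q) * \<omega> q)"

definition euler_steady_state :: "(real \<times> real \<Rightarrow> real) \<Rightarrow> bool" where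
  "euler_steady_state \<Omega> \<longleftrightarrow> (\<forall>k. k \<noteq> 0 \<longrightarrow> euler_rhs (fourier_coeff \<Omega>) k = 0)"

text \<open>The derivative of the quadratic map \<open>euler_rhs\<close> at the coefficient sequence \<open>\<Omega>'\<close>.\<close>

definition euler_linearization ::
    "(int \<times> int \<Rightarrow> complex) \<Rightarrow> (int \<times> int \<Rightarrow> complex) \<Rightarrow> int \<times> int \<Rightarrow> complex" where
  "euler_linearization \<Omega>' \<omega> k =
     (\<Sum>\<^sub>\<infinity>q\<in>-{0}. of_real (\<beta> (k - q) q) * (\<Omega>' (k - q) * \<omega> q + \<omega> (k - q) * \<Omega>' q))"

definition linearly_unstable :: "(real \<times> real \<Rightarrow> real) \<Rightarrow> bool" where
  "linearly_unstable \<Omega> \<longleftrightarrow>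
     (\<exists>lam \<in> l2_spectrum (euler_linearization (fourier_coeff \<Omega>)). Re lam \<noteq> 0)"

definition kolmogorov_flow :: "real \<Rightarrow> int \<times> int \<Rightarrow> real \<times> real \<Rightarrow> real" where
  "kolmogorov_flow \<alpha> p x = \<alpha> * cos (vec2 p \<bullet> x)"

text \<open>By lemma \<open>euler_linearization_kolmogorov\<close> below, \<open>L_op \<alpha> p\<close> is \<open>euler_linearization\<close> at the
  coefficients of \<open>kolmogorov_flow \<alpha> p\<close>, so that \<open>linearly_unstable\<close> refers to its spectrum.\<close>

definition L_op ::
    "real \<Rightarrow> int \<times> int \<Rightarrow> (int \<times> int \<Rightarrow> complex) \<Rightarrow> int \<times> int \<Rightarrow> complex" where
  "L_op \<alpha> p \<omega> k = of_real (\<alpha> * \<beta> p (k - p)) * \<omega> (k - p) - of_real (\<alpha> * \<beta> p (k + p)) * \<omega> (k + p)"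

definition Lq_op ::
    "real \<Rightarrow> int \<times> int \<Rightarrow> int \<times> int \<Rightarrow> (int \<Rightarrow> complex) \<Rightarrow> int \<Rightarrow> complex" where
  "Lq_op \<alpha> p q w n =
     of_real (\<alpha> * \<beta> p (q + iscale (n - 1) p)) * w (n - 1)
     - of_real (\<alpha> * \<beta> p (q + iscale (n + 1) p)) * w (n + 1)"

definition rho :: "int \<times> int \<Rightarrow> int \<times> int \<Rightarrow> int \<Rightarrow> real" where
  "rho p q n = 1 - (norm (vec2 p))\<^sup>2 / (norm (vec2 (q + iscale n p)))\<^sup>2"

text \<open>
  For a trace class operator \<open>T\<close>, \<open>det (I - T) = \<Sum>k. (-1)^k Tr (\<Lambda>\<^sup>k T)\<close>. If \<open>M\<close> is the matrix of
  \<open>T\<close> in an orthonormal basis \<open>(e\<^sub>j)\<close>, then evaluating the trace of the exterior power \<open>\<Lambda>\<^sup>k T\<close> in the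
  orthonormal basis \<open>e\<^sub>j\<^sub>1 \<and> \<dots> \<and> e\<^sub>j\<^sub>k\<close> gives the sum of the principal minors of \<open>M\<close> of
  size \<open>k\<close>. For trace class \<open>T\<close> all the sums converge absolutely.
\<close>

definition principal_minor :: "('j \<Rightarrow> 'j \<Rightarrow> complex) \<Rightarrow> 'j set \<Rightarrow> complex" where
  "principal_minor M F = (\<Sum>\<pi> | \<pi> permutes F. of_int (sign \<pi>) * (\<Prod>i\<in>F. M i (\<pi> i)))"

definition trace_ext_power :: "nat \<Rightarrow> ('j \<Rightarrow> 'j \<Rightarrow> complex) \<Rightarrow> complex" where
  "trace_ext_power k M = (\<Sum>\<^sub>\<infinity>F\<in>{F. finite F \<and> card F = k}. principal_minor M F)"

definition fredholm_det_I_minus :: "('j \<Rightarrow> 'j \<Rightarrow> complex) \<Rightarrow> complex" where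
  "fredholm_det_I_minus M = (\<Sum>k. (- 1) ^ k * trace_ext_power k M)"

definition entries :: "((int \<Rightarrow> complex) \<Rightarrow> int \<Rightarrow> complex) \<Rightarrow> int \<Rightarrow> int \<Rightarrow> complex" where
  "entries T i j = T (\<lambda>n. if n = j then 1 else 0) i"

definition entries2 ::
    "((int \<Rightarrow> complex^2) \<Rightarrow> int \<Rightarrow> complex^2) \<Rightarrow> int \<times> 2 \<Rightarrow> int \<times> 2 \<Rightarrow> complex" where
  "entries2 T i j = T (\<lambda>n. if n = fst j then axis (snd j) 1 else 0) (fst i) $ snd i"

definition b_seq :: "(int \<Rightarrow> real) \<Rightarrow> complex \<Rightarrow> int \<Rightarrow> complex" where
  "b_seq \<rho> lam n = - lam * of_real (sqrt (1 - \<rho> n)) / of_real (\<rho> n)"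

definition c_seq :: "(int \<Rightarrow> real) \<Rightarrow> int \<Rightarrow> complex" where
  "c_seq \<rho> n = of_real (sqrt (1 - \<rho> n))"

definition shift :: "(int \<Rightarrow> 'a) \<Rightarrow> int \<Rightarrow> 'a" where
  "shift w n = w (n - 1)"

definition shift_adj :: "(int \<Rightarrow> 'a) \<Rightarrow> int \<Rightarrow> 'a" where
  "shift_adj w n = w (n + 1)"

definition K_op :: "(int \<Rightarrow> real) \<Rightarrow> complex \<Rightarrow> (int \<Rightarrow> complex) \<Rightarrow> int \<Rightarrow> complex" where
  "K_op \<rho> lam w = (\<lambda>n. - (c_seq \<rho> n *
     the_inv_into l2 (\<lambda>v m. shift v m - shift_adj v m - lam * v m) (\<lambda>m. b_seq \<rho> lam m * w m) n))"

definition A_mat :: "complex \<Rightarrow> complex^2^2" where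
  "A_mat lam = vector [vector [- lam, 1], vector [1, 0]]"

definition Ax_mat :: "(int \<Rightarrow> real) \<Rightarrow> complex \<Rightarrow> int \<Rightarrow> complex^2^2" where
  "Ax_mat \<rho> lam n = vector [vector [- lam / of_real (\<rho> n), 1], vector [1, 0]]"

definition Q_plus :: "complex^2^2" where
  "Q_plus = vector [vector [1, 0], vector [0, 0]]"

definition B_mat :: "(int \<Rightarrow> real) \<Rightarrow> complex \<Rightarrow> int \<Rightarrow> complex^2^2" where
  "B_mat \<rho> lam n = mat (b_seq \<rho> lam n) ** Q_plus"

definition C_mat :: "(int \<Rightarrow> real) \<Rightarrow> int \<Rightarrow> complex^2^2" where
  "C_mat \<rho> n = mat (c_seq \<rho> n) ** Q_plus"

definition T_op :: "(int \<Rightarrow> real) \<Rightarrow> complex \<Rightarrow> (int \<Rightarrow> complex^2) \<Rightarrow> int \<Rightarrow> complex^2" where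
  "T_op \<rho> lam w = (\<lambda>n. C_mat \<rho> n *v
     the_inv_into l2 (\<lambda>v m. shift_adj v m - A_mat lam *v v m) (\<lambda>m. B_mat \<rho> lam m *v w m) n)"

definition det_I_minus_K :: "(int \<Rightarrow> real) \<Rightarrow> complex \<Rightarrow> complex" where
  "det_I_minus_K \<rho> lam = fredholm_det_I_minus (entries (K_op \<rho> lam))"

definition det_I_minus_T :: "(int \<Rightarrow> real) \<Rightarrow> complex \<Rightarrow> complex" where
  "det_I_minus_T \<rho> lam = fredholm_det_I_minus (entries2 (T_op \<rho> lam))"

definition mat_eigenvalue :: "complex^2^2 \<Rightarrow> complex \<Rightarrow> bool" where
  "mat_eigenvalue M \<mu> \<longleftrightarrow> (\<exists>v. v \<noteq> 0 \<and> M *v v = \<mu> *s v)"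

definition mu_plus :: "complex \<Rightarrow> complex" where
  "mu_plus lam = (THE \<mu>. mat_eigenvalue (A_mat lam) \<mu> \<and> norm \<mu> < 1)"

definition mu_minus :: "complex \<Rightarrow> complex" where
  "mu_minus lam = (THE \<mu>. mat_eigenvalue (A_mat lam) \<mu> \<and> 1 < norm \<mu>)"

definition riesz_proj :: "complex^2^2 \<Rightarrow> complex \<Rightarrow> real \<Rightarrow> complex^2^2" where
  "riesz_proj M z r = (\<chi> i j. 1 / (2 * pi * \<i>) *
     contour_integral (circlepath z r) (\<lambda>\<zeta>. matrix_inv (mat \<zeta> - M) $ i $ j))"

text \<open>The radius makes each circle enclose exactly one of the two eigenvalues.\<close>

definition P_plus :: "complex \<Rightarrow> complex^2^2" where
  "P_plus lam = riesz_proj (A_mat lam) (mu_plus lam) (dist (mu_plus lam) (mu_minus lam) / 2)"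

definition P_minus :: "complex \<Rightarrow> complex^2^2" where
  "P_minus lam = riesz_proj (A_mat lam) (mu_minus lam) (dist (mu_plus lam) (mu_minus lam) / 2)"

text \<open>Defined separately because \<open>^\<close> and \<open>*\<close> act componentwise on the type \<open>complex^2^2\<close>.\<close>

definition mat_powi :: "complex^2^2 \<Rightarrow> int \<Rightarrow> complex^2^2" where
  "mat_powi M n = (if 0 \<le> n then (((**) M) ^^ nat n) (mat 1)
                   else (((**) (matrix_inv M)) ^^ nat (- n)) (mat 1))"

definition Y_plus :: "(int \<Rightarrow> real) \<Rightarrow> complex \<Rightarrow> int \<Rightarrow> complex^2^2" where
  "Y_plus \<rho> lam = (THE Y. (\<forall>n. Y (n + 1) = Ax_mat \<rho> lam n ** Y n) \<and>
     ((\<lambda>n. norm (mat (mu_plus lam powi (- n)) ** (Y n - mat_powi (A_mat lam) n ** P_plus lam)))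
        \<longlongrightarrow> 0) at_top \<and>
     Y 0 = Y 0 ** P_plus lam)"

definition Y_minus :: "(int \<Rightarrow> real) \<Rightarrow> complex \<Rightarrow> int \<Rightarrow> complex^2^2" where
  "Y_minus \<rho> lam = (THE Y. (\<forall>n. Y (n + 1) = Ax_mat \<rho> lam n ** Y n) \<and>
     ((\<lambda>n. norm (mat (mu_minus lam powi (- n)) ** (Y n - mat_powi (A_mat lam) n ** P_minus lam)))
        \<longlongrightarrow> 0) at_bot \<and>
     Y 0 = Y 0 ** P_minus lam)"

definition E_fun :: "(int \<Rightarrow> real) \<Rightarrow> complex \<Rightarrow> complex" where
  "E_fun \<rho> lam = det (Y_plus \<rho> lam 0 + Y_minus \<rho> lam 0)"

definition solves_diff_eq :: "(int \<Rightarrow> real) \<Rightarrow> complex \<Rightarrow> (int \<Rightarrow> complex) \<Rightarrow> bool" where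
  "solves_diff_eq \<rho> lam z \<longleftrightarrow> (\<forall>n. z (n - 1) - z (n + 1) = lam / of_real (\<rho> n) * z n)"

definition z_plus :: "(int \<Rightarrow> real) \<Rightarrow> complex \<Rightarrow> int \<Rightarrow> complex" where
  "z_plus \<rho> lam = (THE z. solves_diff_eq \<rho> lam z \<and>
     ((\<lambda>n. mu_plus lam powi (- n) * z n) \<longlongrightarrow> 1) at_top)"

definition z_minus :: "(int \<Rightarrow> real) \<Rightarrow> complex \<Rightarrow> int \<Rightarrow> complex" where
  "z_minus \<rho> lam = (THE z. solves_diff_eq \<rho> lam z \<and>
     ((\<lambda>n. mu_minus lam powi (- n) * z n) \<longlongrightarrow> 1) at_bot)"

definition wronskian :: "(int \<Rightarrow> complex) \<Rightarrow> (int \<Rightarrow> complex) \<Rightarrow> int \<Rightarrow> complex" where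
  "wronskian u v n = (- 1) powi (n - 1) * (u (n - 1) * v n - u n * v (n - 1))"

definition F_fun :: "(int \<Rightarrow> real) \<Rightarrow> complex \<Rightarrow> complex" where
  "F_fun \<rho> lam = inverse (mu_minus lam - mu_plus lam) * wronskian (z_plus \<rho> lam) (z_minus \<rho> lam) 0"

text \<open>\<open>cf_approx a N\<close> is the \<open>N\<close>-th approximant of \<open>1 / (a 0 + 1 / (a 1 + \<dots>))\<close>.\<close>

primrec cf_approx :: "(nat \<Rightarrow> complex) \<Rightarrow> nat \<Rightarrow> complex" where
  "cf_approx a 0 = 0"
| "cf_approx a (Suc N) = 1 / (a 0 + cf_approx (\<lambda>k. a (Suc k)) N)"

definition cont_frac :: "(nat \<Rightarrow> complex) \<Rightarrow> complex" where
  "cont_frac a = lim (cf_approx a)"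

definition g_plus :: "(int \<Rightarrow> real) \<Rightarrow> complex \<Rightarrow> complex" where
  "g_plus \<rho> lam = cont_frac (\<lambda>k. lam / of_real (\<rho> (int k + 1)))"

definition g_minus :: "(int \<Rightarrow> real) \<Rightarrow> complex \<Rightarrow> complex" where
  "g_minus \<rho> lam = cont_frac (\<lambda>k. lam / of_real (\<rho> (- (int k + 1))))"

definition G_fun :: "(int \<Rightarrow> real) \<Rightarrow> complex \<Rightarrow> complex" where
  "G_fun \<rho> lam = z_plus \<rho> lam 0 * z_minus \<rho> lam 0 * inverse (mu_plus lam - mu_minus lam) *
     (lam / of_real (\<rho> 0) + g_plus \<rho> lam + g_minus \<rho> lam)"

lemma integral_circle_character:
  "integral {0..2 * pi} (\<lambda>t. exp (\<i> * complex_of_real (of_int m * t))) =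
     (if m = 0 then complex_of_real (2 * pi) else 0)"
proof (cases "m = 0")
  case True
  then show ?thesis by (simp add: scaleR_conv_of_real)
next
  case False
  define F where "F = (\<lambda>t::real. exp (\<i> * complex_of_real (of_int m * t)) / (\<i> * of_int m))"
  have "((\<lambda>t. exp (\<i> * complex_of_real (of_int m * t))) has_integral (F (2 * pi) - F 0)) {0..2 * pi}"
  proof (rule fundamental_theorem_of_calculus)
    fix t :: real
    have "((\<lambda>z. exp (\<i> * of_int m * z) / (\<i> * of_int m)) has_field_derivative
             exp (\<i> * of_int m * of_real t)) (at (of_real t))"
      using False by (auto intro!: derivative_eq_intros)
    from has_vector_derivative_real_field[OF this]
    have "((\<lambda>t. exp (\<i> * of_int m * of_real t) / (\<i> * of_int m)) has_vector_derivative
             exp (\<i> * of_int m * of_real t)) (at t within {0..2 * pi})"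
      by (simp add: has_vector_derivative_at_within)
    then show "(F has_vector_derivative exp (\<i> * complex_of_real (of_int m * t)))
                 (at t within {0..2 * pi})"
      by (simp add: F_def mult.assoc)
  qed simp
  moreover have "exp (\<i> * complex_of_real (of_int m * (2 * pi))) = 1"
    using exp_integer_2pi[of "of_int m"] by (simp add: mult_ac)
  ultimately show ?thesis
    using False by (simp add: F_def integral_unique)
qed

lemma continuous_character:
  "continuous_on S (\<lambda>x. exp (\<i> * complex_of_real (vec2 m \<bullet> x)))"
  by (intro continuous_intros)

lemma integral_torus_character:
  "integral (cbox (0, 0) (2 * pi, 2 * pi)) (\<lambda>x. exp (\<i> * complex_of_real (vec2 m \<bullet> x))) =
     (if m = 0 then complex_of_real ((2 * pi)\<^sup>2) else 0)"
proof -
  have split: "exp (\<i> * complex_of_real (vec2 m \<bullet> (s, t))) =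
      exp (\<i> * complex_of_real (of_int (fst m) * s)) * exp (\<i> * complex_of_real (of_int (snd m) * t))"
    for s t
    by (simp add: vec2_def exp_add[symmetric] distrib_left)
  have "integral (cbox (0, 0) (2 * pi, 2 * pi)) (\<lambda>x. exp (\<i> * complex_of_real (vec2 m \<bullet> x))) =
     integral (cbox 0 (2 * pi)) (\<lambda>s. integral (cbox 0 (2 * pi))
       (\<lambda>t. exp (\<i> * complex_of_real (vec2 m \<bullet> (s, t)))))"
    by (rule integral_prod_continuous[OF continuous_character])
  also have "\<dots> = (if fst m = 0 then complex_of_real (2 * pi) else 0) *
                  (if snd m = 0 then complex_of_real (2 * pi) else 0)"
    unfolding split by (simp only: integral_mult_right integral_mult_left cbox_interval
        integral_circle_character)
  also have "\<dots> = (if m = 0 then complex_of_real ((2 * pi)\<^sup>2) else 0)"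
    by (cases m) (auto simp: zero_prod_def power2_eq_square)
  finally show ?thesis .
qed

lemma fourier_coeff_kolmogorov:
  "fourier_coeff (kolmogorov_flow \<alpha> p) k =
     (if k = p then of_real (\<alpha> / 2) else 0) + (if k = - p then of_real (\<alpha> / 2) else 0)"
proof -
  let ?B = "cbox (0::real, 0::real) (2 * pi, 2 * pi)"
  let ?c = "\<lambda>m x. exp (\<i> * complex_of_real (vec2 m \<bullet> x))"
  have vdiff: "vec2 (m - n) = vec2 m - vec2 n" for m n
    by (simp add: vec2_def)
  have "complex_of_real (kolmogorov_flow \<alpha> p x) * exp (- (\<i> * complex_of_real (vec2 k \<bullet> x))) =
      of_real (\<alpha> / 2) * (?c (p - k) x + ?c (- p - k) x)" for x
  proof -
    have m: "vec2 (- p) = - vec2 p" by (simp add: vec2_def)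
    define a b where "a = \<i> * complex_of_real (vec2 p \<bullet> x)" and
      "b = \<i> * complex_of_real (vec2 k \<bullet> x)"
    have "complex_of_real (kolmogorov_flow \<alpha> p x) = of_real (\<alpha> / 2) * (exp a + exp (- a))"
      by (simp add: kolmogorov_flow_def cos_of_real[symmetric] cos_exp_eq a_def)
    moreover have "?c (p - k) x = exp a * exp (- b)" "?c (- p - k) x = exp (- a) * exp (- b)"
      unfolding vdiff m exp_add[symmetric]
      by (simp_all add: a_def b_def inner_diff_left right_diff_distrib)
    ultimately show ?thesis
      by (simp only: b_def[symmetric] distrib_right mult.assoc)
  qed
  then have "fourier_coeff (kolmogorov_flow \<alpha> p) k =
      integral ?B (\<lambda>x. of_real (\<alpha> / 2) * (?c (p - k) x + ?c (- p - k) x)) / (2 * pi)\<^sup>2"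
    unfolding fourier_coeff_def by (simp only:)
  also have "integral ?B (\<lambda>x. of_real (\<alpha> / 2) * (?c (p - k) x + ?c (- p - k) x)) =
      of_real (\<alpha> / 2) * (integral ?B (?c (p - k)) + integral ?B (?c (- p - k)))"
    by (subst integral_mult_right, subst integral_add)
       (auto intro!: integrable_continuous continuous_character)
  also have "\<dots> / (2 * pi)\<^sup>2 = of_real (\<alpha> / 2) *
      ((if k = p then 1 else 0) + (if k = - p then 1 else 0))"
  proof -
    have "p - k = 0 \<longleftrightarrow> k = p" "- p - k = 0 \<longleftrightarrow> k = - p" by auto
    then show ?thesis
      unfolding integral_torus_character by (simp add: field_simps)
  qed
  finally show ?thesis by (simp add: distrib_left)
qed

lemma \<beta>_symmetric: "\<beta> p q = \<beta> q p"
  by (simp add: \<beta>_def wedge_def algebra_simps)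

lemma \<beta>_minus_left: "\<beta> (- p) q = - \<beta> p q"
proof -
  have "wedge (- p) q = - wedge p q" "norm (vec2 (- p)) = norm (vec2 p)"
    by (simp_all add: wedge_def vec2_def norm_Pair)
  then show ?thesis by (simp add: \<beta>_def)
qed

lemma \<beta>_zero_right [simp]: "\<beta> p 0 = 0"
  by (simp add: \<beta>_def)

lemma has_sum_at_point:
  fixes g :: "'a::zero \<Rightarrow> complex"
  assumes "g 0 = 0"
  shows "((\<lambda>q. if q = a then g q else 0) has_sum g a) (- {0})"
proof (cases "a = 0")
  case True
  then show ?thesis
    using assms by (auto intro!: has_sum_0 split: if_splits)
next
  case False
  then show ?thesis
    by (intro has_sum_finite_neutralI[of "{a}"]) auto
qed

lemma euler_linearization_kolmogorov:
  "euler_linearization (fourier_coeff (kolmogorov_flow \<alpha> p)) = L_op \<alpha> p"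
proof (intro ext)
  fix \<omega> k
  have factor: "(if P then c * b * x else 0) + (if Q then c * b * x else 0)
        + ((if R then c * b * y else 0) + (if S then c * b * y else 0)) =
      b * (((if P then c else 0) + (if Q then c else 0)) * x
        + y * ((if R then c else 0) + (if S then c else 0)))" for P Q R S and b c x y :: complex
    by (simp add: algebra_simps)
  define c where "c = complex_of_real (\<alpha> / 2)"
  define g where "g = (\<lambda>q. c * of_real (\<beta> (k - q) q) * \<omega> q)"
  define h where "h = (\<lambda>q. c * of_real (\<beta> (k - q) q) * \<omega> (k - q))"
  have "((\<lambda>q. (if q = k - p then g q else 0) + (if q = k + p then g q else 0)
            + ((if q = p then h q else 0) + (if q = - p then h q else 0)))
          has_sum (g (k - p) + g (k + p) + (h p + h (- p)))) (- {0})"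
    by (intro has_sum_add has_sum_at_point) (simp_all add: g_def h_def)
  moreover have "(if q = k - p then g q else 0) + (if q = k + p then g q else 0)
            + ((if q = p then h q else 0) + (if q = - p then h q else 0)) =
      of_real (\<beta> (k - q) q) * (fourier_coeff (kolmogorov_flow \<alpha> p) (k - q) * \<omega> q
        + \<omega> (k - q) * fourier_coeff (kolmogorov_flow \<alpha> p) q)" for q
  proof -
    have 1: "q = k - p \<longleftrightarrow> k - q = p" and 2: "q = k + p \<longleftrightarrow> k - q = - p"
      by (auto simp: algebra_simps)
    show ?thesis
      unfolding 1 2 fourier_coeff_kolmogorov g_def h_def c_def[symmetric] by (rule factor)
  qed
  ultimately have "euler_linearization (fourier_coeff (kolmogorov_flow \<alpha> p)) \<omega> k =
      g (k - p) + g (k + p) + (h p + h (- p))"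
    unfolding euler_linearization_def by (simp add: infsumI)
  moreover have "g (k - p) = c * of_real (\<beta> p (k - p)) * \<omega> (k - p)"
    and "g (k + p) = - c * of_real (\<beta> p (k + p)) * \<omega> (k + p)"
    and "h p = c * of_real (\<beta> p (k - p)) * \<omega> (k - p)"
    and "h (- p) = - c * of_real (\<beta> p (k + p)) * \<omega> (k + p)"
    by (simp_all add: g_def h_def \<beta>_minus_left \<beta>_symmetric[of "k - p" p]
        \<beta>_symmetric[of "k + p" "- p"])
  ultimately show "euler_linearization (fourier_coeff (kolmogorov_flow \<alpha> p)) \<omega> k = L_op \<alpha> p \<omega> k"
    by (simp add: L_op_def c_def algebra_simps)
qed

lemma kolmogorov_steady_state: "euler_steady_state (kolmogorov_flow \<alpha> p)"
  unfolding euler_steady_state_def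
proof (intro allI impI)
  fix k
  let ?\<Omega> = "fourier_coeff (kolmogorov_flow \<alpha> p)"
  have "euler_linearization ?\<Omega> ?\<Omega> k = (\<Sum>\<^sub>\<infinity>q\<in>-{0}. 2 * (of_real (\<beta> (k - q) q) * ?\<Omega> (k - q) * ?\<Omega> q))"
    unfolding euler_linearization_def by (intro infsum_cong) (simp add: algebra_simps)
  also have "\<dots> = 2 * euler_rhs ?\<Omega> k"
    unfolding euler_rhs_def by (rule infsum_cmult_right')
  finally have "2 * euler_rhs ?\<Omega> k = L_op \<alpha> p ?\<Omega> k"
    by (simp add: euler_linearization_kolmogorov)
  also have "\<dots> = 0"
  proof -
    have "\<beta> p p = 0" "\<beta> p (- p) = 0"
      by (simp_all add: \<beta>_def wedge_def)
    then have "of_real (\<beta> p m) * ?\<Omega> m = 0" for m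
      unfolding fourier_coeff_kolmogorov by auto
    then show ?thesis
      unfolding L_op_def of_real_mult mult.assoc by (simp only:) simp
  qed
  finally show "euler_rhs ?\<Omega> k = 0" by simp
qed

end

theory Submission
  imports Defs
begin

text \<open>
  Substituting \<open>z n = \<rho> n * w n\<close> turns the eigenvalue equation into the three-term recurrence
  \<open>z (n - 1) - z (n + 1) = (lam / \<rho> n) * z n\<close>, a summable perturbation of a recurrence with constant
  coefficients. A square summable solution is a multiple of both Jost solutions, so eigenvalues are
  the zeros of their Wronskian, that is of \<open>F_fun\<close>.

  All five functions coincide. The kernel of \<open>K_op\<close> is semi-separable: its principal minors factor
  over the gaps of the index set, and summing over index sets by their least element reproduces the
  backward recurrence of the Jost solution. The kernel of \<open>T_op\<close> is that of \<open>K_op\<close> padded with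
  zeros. The columns of \<open>Y_plus\<close> and \<open>Y_minus\<close> are Jost solutions times a row of the Riesz
  projection. For \<open>Re lam > 0\<close> the quantity \<open>Re (cnj (z n) * z (n - 1))\<close> decreases in \<open>n\<close>, so that
  decaying solutions do not vanish and their ratios are the continued fractions.

  For real \<open>lam > 0\<close>, \<open>lam / \<rho> 0 + g_plus + g_minus\<close> is real and continuous; it is positive for small
  \<open>lam\<close>, because the continued fractions stay away from \<open>0\<close>, and negative for large \<open>lam\<close>, because
  they are at most \<open>1 / lam\<close>. Hence it has a zero.
\<close>

text \<open>The main obstacle is to match an infinite determinant with a solution that is defined by
  its asymptotics. Both are reached through the same truncation. \<open>cutoff_sol m\<close> is the
  rescaled solution equal to 1 at \<open>m\<close> and \<open>m + 1\<close>, that is, to the left of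
  \<open>m\<close> the Jost solution of the potential switched off beyond \<open>m\<close>; the
  minors over subsets of \<open>{k..m}\<close> add up to a combination of its values at
  \<open>k\<close> and \<open>k - 1\<close>. The truncation error is uniform in the left end, so
  \<open>m = N\<close> and \<open>k = - N\<close> may run to infinity together. Trace class enters
  only as absolute convergence of one sum over all finite index sets. Asymptotic analysis is done on
  the right half-line alone: \<open>reflect\<close> carries the left half-line over to it. The
  condition \<open>Re lam > 0\<close> acts twice, separating the characteristic roots by the unit
  circle and making the flux monotone. Part (ii) has no normalization at its disposal. The geometry
  of the lattice line yields \<open>wedge q p \<noteq> 0\<close>, and alternating signs absorb a
  negative prefactor.\<close>

no_notation fps_nth (infixl "$" 75)

section \<open>Three-term recurrences on the integers\<close>

lemma filterlim_int_at_top_iff: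
  "filterlim f F (at_top :: int filter) \<longleftrightarrow> filterlim (\<lambda>n. f (int n)) F sequentially"
proof -
  have eq: "(at_top :: int filter) = filtermap int sequentially"
  proof (rule filter_eqI)
    fix P :: "int \<Rightarrow> bool"
    have "\<exists>M. \<forall>n\<ge>M. P n" if "\<forall>n\<ge>N. P (int n)" for N
    proof (intro exI allI impI)
      fix n assume "n \<ge> int N"
      then show "P n" using that[rule_format, of "nat n"] by simp
    qed
    moreover have "\<exists>N. \<forall>n\<ge>N. P (int n)" if "\<forall>n\<ge>M. P n" for M
      using that by (intro exI[of _ "nat M"]) auto
    ultimately show "eventually P at_top \<longleftrightarrow> eventually P (filtermap int sequentially)"
      unfolding eventually_filtermap eventually_at_top_linorder by blast
  qed
  show ?thesis
    by (subst eq) (simp only: filterlim_def filtermap_filtermap)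
qed

lemma filterlim_int_at_bot_iff:
  "filterlim f F (at_bot :: int filter) \<longleftrightarrow> filterlim (\<lambda>n. f (- n)) F (at_top :: int filter)"
proof -
  have eq: "(at_bot :: int filter) = filtermap uminus at_top"
    by (rule filter_eqI)
      (auto simp: eventually_filtermap eventually_at_top_linorder eventually_at_bot_linorder,
        metis minus_le_iff, metis minus_le_iff minus_minus)
  show ?thesis
    by (subst eq) (simp only: filterlim_def filtermap_filtermap)
qed

lemma filterlim_pred_at_top: "filterlim (\<lambda>n::int. n - 1) at_top at_top"
  unfolding filterlim_at_top eventually_at_top_linorder by (metis le_diff_eq)

lemma filterlim_pred_at_bot: "filterlim (\<lambda>n::int. n - 1) at_bot at_bot"
  unfolding filterlim_at_bot eventually_at_bot_linorder by (metis diff_le_eq)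

text \<open>The coefficient is arbitrary because three recurrences occur: the one with
  \<open>lam / \<rho> n\<close>, its reflection, and the free one with constant coefficient
  \<open>lam\<close>.\<close>

definition rec_sol :: "(int \<Rightarrow> complex) \<Rightarrow> (int \<Rightarrow> complex) \<Rightarrow> bool" where
  "rec_sol a z \<longleftrightarrow> (\<forall>n. z (n - 1) - z (n + 1) = a n * z n)"

lemma solves_diff_eq_iff: "solves_diff_eq \<rho> lam z \<longleftrightarrow> rec_sol (\<lambda>n. lam / of_real (\<rho> n)) z"
  by (simp add: solves_diff_eq_def rec_sol_def)

lemma rec_sol_backward: "rec_sol a z \<Longrightarrow> z (n - 1) = a n * z n + z (n + 1)"
  by (simp add: rec_sol_def) (metis diff_eq_eq)

lemma rec_sol_forward: "rec_sol a z \<Longrightarrow> z (n + 1) = z (n - 1) - a n * z n"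
  by (simp add: rec_sol_backward)

lemma rec_sol_lincomb:
  assumes "rec_sol a u" "rec_sol a v"
  shows "rec_sol a (\<lambda>n. c * u n + d * v n)"
  using assms by (simp add: rec_sol_def) (simp add: algebra_simps flip: right_diff_distrib)

lemma rec_sol_zeroI:
  assumes "rec_sol a u" "u m = 0" "u (m + 1) = 0"
  shows "u n = 0"
proof -
  have "u n = 0 \<and> u (n + 1) = 0"
  proof (induction n rule: int_induct[of _ m])
    case base
    then show ?case using assms by simp
  next
    case (step1 i)
    then show ?case using rec_sol_forward[OF assms(1), of "i + 1"] by simp
  next
    case (step2 i)
    then show ?case using rec_sol_backward[OF assms(1), of i] by simp
  qed
  then show ?thesis ..
qed

lemma rec_sol_unique:
  assumes "rec_sol a u" "rec_sol a v" "u m = v m" "u (m + 1) = v (m + 1)"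
  shows "u = v"
proof
  fix n
  have "rec_sol a (\<lambda>n. u n - v n)"
    using rec_sol_lincomb[OF assms(1,2), of 1 "-1"] by simp
  then show "u n = v n"
    using rec_sol_zeroI[of a "\<lambda>n. u n - v n" m n] assms(3,4) by simp
qed

fun two_term :: "(nat \<Rightarrow> complex) \<Rightarrow> complex \<Rightarrow> complex \<Rightarrow> nat \<Rightarrow> complex" where
  "two_term c x y 0 = x"
| "two_term c x y (Suc 0) = y"
| "two_term c x y (Suc (Suc k)) = two_term c x y k + c k * two_term c x y (Suc k)"

lemma rec_sol_exists:
  "\<exists>z. rec_sol a z \<and> z m = x \<and> z (m + 1) = y"
proof -
  \<comment> \<open>\<open>F\<close> runs to the right from \<open>m\<close>, \<open>B\<close> to
    the left from \<open>m + 1\<close>. The halves overlap at \<open>m\<close> and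
    \<open>m + 1\<close>, so each instance of the recurrence lies entirely in one of them.\<close>
  define F where "F = two_term (\<lambda>k. - a (m + 1 + int k)) x y"
  define B where "B = two_term (\<lambda>k. a (m - int k)) y x"
  define z where "z n = (if n \<ge> m then F (nat (n - m)) else B (nat (m + 1 - n)))" for n
  have zF: "z n = F k" if "n = m + int k" for n k
    using that by (simp add: z_def)
  have zB: "z n = B k" if "n = m + 1 - int k" for n k
  proof -
    consider "k = 0" | "k = 1" | "k \<ge> 2" by linarith
    then show ?thesis
      using that by cases (simp_all add: z_def F_def B_def)
  qed
  have "z (n - 1) - z (n + 1) = a n * z n" for n
  proof (cases "n \<ge> m + 1")
    case True
    then obtain k where n: "n = m + 1 + int k"
      by (metis zle_iff_zadd)
    show ?thesis
      using zF[of "n - 1" k] zF[of n "Suc k"] zF[of "n + 1" "Suc (Suc k)"] n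
      by (simp add: F_def)
  next
    case False
    define k where "k = nat (m - n)"
    have n: "n = m - int k" using False by (simp add: k_def)
    show ?thesis
      using zB[of "n - 1" "Suc (Suc k)"] zB[of n "Suc k"] zB[of "n + 1" k] n
      by (simp add: B_def)
  qed
  then show ?thesis
    using zF[of m 0] zF[of "m + 1" 1]
    by (intro exI[of _ z]) (simp add: rec_sol_def F_def)
qed

lemma powi_minus_one_step: "(- 1 :: complex) powi (n + 1) = - ((- 1) powi n)"
  by (simp add: power_int_add)

lemma powi_minus_one_square: "(- 1 :: complex) powi n * (- 1) powi n = 1"
  by (simp flip: power_int_mult_distrib)

lemma norm_powi_minus_one [simp]: "norm ((- 1 :: complex) powi n) = 1"
  by (simp add: norm_power_int)

text \<open>A transfer step has determinant -1, which the sign in \<open>wronskian\<close> cancels.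
  For different coefficients the remainder is a discrete Green identity, used later to compare
  continued fractions at two spectral parameters.\<close>

lemma wronskian_step:
  assumes "rec_sol a u" "rec_sol b v"
  shows "wronskian u v (n + 1) = wronskian u v n + (- 1) powi n * (a n - b n) * u n * v n"
proof -
  have "(- 1 :: complex) powi (n - 1) = - ((- 1) powi n)"
    using powi_minus_one_step[of "n - 1"] by simp
  moreover have "u (n + 1) = u (n - 1) - a n * u n" "v (n + 1) = v (n - 1) - b n * v n"
    using assms by (simp_all add: rec_sol_forward)
  ultimately show ?thesis
    unfolding wronskian_def add_diff_cancel_right' by (simp only:) (simp add: algebra_simps)
qed

lemma wronskian_constant:
  assumes "rec_sol a u" "rec_sol a v"
  shows "wronskian u v n = wronskian u v m"
proof (induction n rule: int_induct[of _ m])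
  case (step2 i)
  then show ?case using wronskian_step[OF assms, of "i - 1"] by simp
qed (use wronskian_step[OF assms] in simp_all)

lemma wronskian_eq_0_imp_multiple:
  assumes "rec_sol a u" "rec_sol a v" "wronskian u v n = 0" "u \<noteq> (\<lambda>_. 0)"
  shows "\<exists>c. v = (\<lambda>n. c * u n)"
proof -
  have eq: "u (n - 1) * v n = u n * v (n - 1)"
    using assms(3) by (simp add: wronskian_def)
  have "u (n - 1) \<noteq> 0 \<or> u n \<noteq> 0"
    using rec_sol_zeroI[OF assms(1), of "n - 1"] assms(4) by auto
  then obtain c where c: "v (n - 1) = c * u (n - 1)" "v n = c * u n"
  proof
    assume "u (n - 1) \<noteq> 0"
    then show thesis using eq by (intro that[of "v (n - 1) / u (n - 1)"]) (auto simp: field_simps)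
  next
    assume "u n \<noteq> 0"
    then show thesis using eq by (intro that[of "v n / u n"]) (auto simp: field_simps)
  qed
  have "rec_sol a (\<lambda>n. c * u n)"
    using rec_sol_lincomb[OF assms(1) assms(1), of c 0] by simp
  from rec_sol_unique[OF assms(2) this, of "n - 1"] c show ?thesis by auto
qed

text \<open>The Wronskian has constant modulus and tends to 0. Hence the decaying solutions form a
  space of dimension at most one.\<close>

lemma wronskian_decaying:
  assumes "rec_sol a u" "rec_sol a v" and "(u \<longlongrightarrow> 0) at_top" "(v \<longlongrightarrow> 0) at_top"
  shows "wronskian u v n = 0"
proof -
  have shifted: "((\<lambda>n. u (n - 1)) \<longlongrightarrow> 0) at_top" "((\<lambda>n. v (n - 1)) \<longlongrightarrow> 0) at_top"
    using assms(3,4) by (auto intro: filterlim_compose filterlim_pred_at_top)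
  have "((\<lambda>n. u (n - 1) * v n - u n * v (n - 1)) \<longlongrightarrow> 0 * 0 - 0 * 0) at_top"
    by (intro tendsto_intros shifted assms)
  then have "((\<lambda>n. norm (u (n - 1) * v n - u n * v (n - 1))) \<longlongrightarrow> 0) at_top"
    using tendsto_norm_zero by force
  moreover have "norm (u (m - 1) * v m - u m * v (m - 1)) = norm (wronskian u v n)" for m
    by (simp add: wronskian_constant[OF assms(1,2), of n m]) (simp add: wronskian_def norm_mult)
  ultimately have "((\<lambda>m::int. norm (wronskian u v n)) \<longlongrightarrow> 0) at_top" by simp
  then show ?thesis by (simp add: tendsto_const_iff)
qed

text \<open>Reversing \<open>n\<close> exchanges the two neighbours and so flips the sign of their
  difference; the alternating factor restores it.\<close>

definition reflect :: "(int \<Rightarrow> complex) \<Rightarrow> int \<Rightarrow> complex" where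
  "reflect z n = (- 1) powi n * z (- n)"

lemma reflect_reflect [simp]: "reflect (reflect z) = z"
  by (rule ext) (simp add: reflect_def power_int_minus flip: power_int_mult_distrib mult.assoc)

lemma reflect_cmult: "reflect (\<lambda>n. c * f n) = (\<lambda>n. c * reflect f n)"
  by (simp add: reflect_def fun_eq_iff)

lemma rec_sol_reflect: "rec_sol a z \<Longrightarrow> rec_sol (\<lambda>n. a (- n)) (reflect z)"
proof -
  assume "rec_sol a z"
  then have "z (- n - 1) = a (- n) * z (- n) + z (- n + 1)" for n
    by (rule rec_sol_backward)
  moreover have "(- 1 :: complex) powi (n - 1) = - ((- 1) powi n)" for n
    using powi_minus_one_step[of "n - 1"] by simp
  ultimately show ?thesis
    unfolding rec_sol_def reflect_def powi_minus_one_step by (simp add: algebra_simps)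
qed

section \<open>Square summable sequences on the integers\<close>

lemma l2_tendsto_at_top:
  fixes w :: "int \<Rightarrow> complex"
  assumes "w \<in> l2" shows "(w \<longlongrightarrow> 0) at_top"
proof -
  have "(\<lambda>i. (norm (w i))\<^sup>2) summable_on range int"
    using assms summable_on_subset_banach[of "\<lambda>i. (norm (w i))\<^sup>2" UNIV "range int"] by (simp add: l2_def)
  then have "(\<lambda>n. (norm (w (int n)))\<^sup>2) summable_on UNIV"
    by (subst (asm) summable_on_reindex) (auto simp: o_def)
  then have "(\<lambda>n. (norm (w (int n)))\<^sup>2) \<longlonglongrightarrow> 0"
    by (intro summable_LIMSEQ_zero summable_on_imp_summable)
  then have "(\<lambda>n. sqrt ((norm (w (int n)))\<^sup>2)) \<longlonglongrightarrow> sqrt 0"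
    by (rule tendsto_real_sqrt)
  then show ?thesis
    by (simp add: filterlim_int_at_top_iff tendsto_norm_zero_iff)
qed

lemma l2_uminus_arg: "(w :: int \<Rightarrow> 'a::real_normed_vector) \<in> l2 \<Longrightarrow> (\<lambda>n. w (- n)) \<in> l2"
  unfolding l2_def mem_Collect_eq
  by (subst summable_on_reindex_bij_betw[of uminus UNIV UNIV "\<lambda>i. (norm (w i))\<^sup>2"]) (auto intro: bij_uminus)

lemma l2_reflect_iff: "reflect w \<in> l2 \<longleftrightarrow> w \<in> l2"
proof -
  have "reflect w \<in> l2" if "w \<in> l2" for w
    using l2_uminus_arg[OF that] by (simp add: l2_def reflect_def norm_mult)
  from this[of w] this[of "reflect w"] show ?thesis by auto
qed

lemma l2_comparison:
  assumes "w \<in> l2" "\<And>i. norm (v i) \<le> C * norm (w i)"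
  shows "v \<in> l2"
proof -
  have "(norm (v i))\<^sup>2 \<le> C\<^sup>2 * (norm (w i))\<^sup>2" for i
    using power_mono[OF assms(2), of i 2] by (simp add: power_mult_distrib)
  moreover have "(\<lambda>i. C\<^sup>2 * (norm (w i))\<^sup>2) summable_on UNIV"
    using assms(1) by (intro summable_on_cmult_right) (simp add: l2_def)
  ultimately show ?thesis
    unfolding l2_def mem_Collect_eq
    by (simp add: summable_on_comparison_test[of "\<lambda>i. C\<^sup>2 * (norm (w i))\<^sup>2"])
qed

lemma summable_on_intI:
  fixes f :: "int \<Rightarrow> real"
  assumes "summable (\<lambda>n. f (int n))" "summable (\<lambda>n. f (- int n))" "\<And>n. f n \<ge> 0"
  shows "f summable_on UNIV"
proof -
  have "f summable_on range int" "f summable_on range (\<lambda>n. - int n)"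
    using assms by (auto intro!: summable_nonneg_imp_summable_on simp: summable_on_reindex inj_on_def o_def)
  moreover have "range int \<union> range (\<lambda>n. - int n) = UNIV"
  proof -
    have "x \<in> range int \<union> range (\<lambda>n. - int n)" for x
      by (cases x rule: int_cases4) auto
    then show ?thesis by auto
  qed
  ultimately show ?thesis by (metis summable_on_union)
qed

lemma l2_exponential_decay:
  fixes w :: "int \<Rightarrow> complex"
  assumes "0 \<le> r" "r < 1" "\<And>n::nat. norm (w (int n)) \<le> C * r ^ n"
    "\<And>n::nat. norm (w (- int n)) \<le> C * r ^ n"
  shows "w \<in> l2"
proof -
  have 1: "(norm x)\<^sup>2 \<le> C\<^sup>2 * (r\<^sup>2) ^ n" if "norm x \<le> C * r ^ n" for x :: complex and n
    using power_mono[OF that, of 2] by (simp add: power_mult_distrib flip: power_mult) (simp add: mult.commute)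
  have "summable (\<lambda>n. C\<^sup>2 * (r\<^sup>2) ^ n)"
    using assms(1,2) by (intro summable_mult summable_geometric) (simp add: abs_square_less_1)
  then have "summable (\<lambda>n. (norm (w (int n)))\<^sup>2)" "summable (\<lambda>n. (norm (w (- int n)))\<^sup>2)"
    using 1[OF assms(3)] 1[OF assms(4)]
    by (simp_all add: summable_comparison_test'[of "\<lambda>n. C\<^sup>2 * (r\<^sup>2) ^ n" 0])
  then show ?thesis
    unfolding l2_def mem_Collect_eq by (rule summable_on_intI) simp
qed

section \<open>Jost solutions\<close>

text \<open>By \<open>lam_eq\<close> the powers of \<open>\<mu>\<close> solve the free recurrence,
  whose characteristic roots are \<open>\<mu>\<close> and \<open>- inverse \<mu>\<close>;
  \<open>mu_less_1\<close> selects the decaying one. Summability of the perturbation is the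
  short-range condition of scattering theory.\<close>

locale jost =
  fixes a :: "int \<Rightarrow> complex" and lam \<mu> :: complex
  assumes mu_nonzero: "\<mu> \<noteq> 0" and mu_less_1: "norm \<mu> < 1"
    and lam_eq: "lam = inverse \<mu> - \<mu>"
    and perturbation_summable: "(\<lambda>n. norm (a n - lam)) summable_on UNIV"
begin

lemma powi_cancel [simp]:
  "\<mu> powi n * (\<mu> powi (- n) * w) = w" "\<mu> powi (- n) * (\<mu> powi n * w) = w"
  using mu_nonzero by (simp_all add: power_int_minus)

text \<open>The recurrence satisfied by \<open>h n = \<mu>\<^sup>-\<^sup>n z n\<close> when \<open>z\<close> solves \<open>z (n - 1) - z (n + 1) = a n z n\<close>.\<close>

definition scaled_sol :: "(int \<Rightarrow> complex) \<Rightarrow> bool" where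
  "scaled_sol h \<longleftrightarrow> (\<forall>n. h (n - 1) - h n = - \<mu>\<^sup>2 * (h n - h (n + 1)) + \<mu> * (a n - lam) * h n)"

lemma scaled_sol_iff: "scaled_sol h \<longleftrightarrow> rec_sol a (\<lambda>n. \<mu> powi n * h n)"
proof -
  have "h (n - 1) - h n = - \<mu>\<^sup>2 * (h n - h (n + 1)) + \<mu> * (a n - lam) * h n \<longleftrightarrow>
      \<mu> powi (n - 1) * h (n - 1) - \<mu> powi (n + 1) * h (n + 1) = a n * (\<mu> powi n * h n)" for n
  proof -
    have "\<mu> powi (n + 1) = \<mu> powi (n - 1) * \<mu>\<^sup>2" "\<mu> powi n = \<mu> powi (n - 1) * \<mu>"
      using power_int_add[of \<mu> "n - 1" 2] power_int_add[of \<mu> "n - 1" 1] mu_nonzero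
      by (simp_all add: add.commute)
    then have "\<mu> powi (n - 1) * h (n - 1) - \<mu> powi (n + 1) * h (n + 1) = a n * (\<mu> powi n * h n) \<longleftrightarrow>
        \<mu> powi (n - 1) * (h (n - 1) - \<mu>\<^sup>2 * h (n + 1)) = \<mu> powi (n - 1) * (a n * \<mu> * h n)"
      by (simp add: algebra_simps)
    also have "\<dots> \<longleftrightarrow> h (n - 1) - \<mu>\<^sup>2 * h (n + 1) = a n * \<mu> * h n"
      using mu_nonzero by simp
    also have "a n * \<mu> * h n = \<mu> * (a n - lam) * h n + h n - \<mu>\<^sup>2 * h n"
      using mu_nonzero by (simp add: lam_eq algebra_simps power2_eq_square)
    finally show ?thesis by (auto simp: algebra_simps)
  qed
  then show ?thesis by (simp add: scaled_sol_def rec_sol_def)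
qed

lemma scaled_sol_exists: "\<exists>h. scaled_sol h \<and> h m = x \<and> h (m + 1) = y"
proof -
  obtain z where z: "rec_sol a z" "z m = \<mu> powi m * x" "z (m + 1) = \<mu> powi (m + 1) * y"
    using rec_sol_exists by blast
  show ?thesis
    using z(1) by (intro exI[of _ "\<lambda>n. \<mu> powi (- n) * z n"])
      (simp add: scaled_sol_iff z(2,3) del: minus_add_distrib)
qed

lemma scaled_sol_step: "scaled_sol h \<Longrightarrow>
    h (n - 1) - h n = - \<mu>\<^sup>2 * (h n - h (n + 1)) + \<mu> * (a n - lam) * h n"
  by (simp add: scaled_sol_def)

lemma scaled_sol_diff: "scaled_sol h \<Longrightarrow> scaled_sol k \<Longrightarrow> scaled_sol (\<lambda>n. h n - k n)"
  unfolding scaled_sol_iff right_diff_distrib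
  using rec_sol_lincomb[of a "\<lambda>n. \<mu> powi n * h n" "\<lambda>n. \<mu> powi n * k n" 1 "-1"] by simp

text \<open>A free backward step multiplies an increment of \<open>h\<close> by
  \<open>- \<mu>\<^sup>2\<close>. Summing the geometric series of later increments gives the weight
  in \<open>energy\<close>, and \<open>growth\<close> is \<open>norm \<mu>\<close> times one plus
  that weight: the gain from a unit perturbation.\<close>

definition growth :: real where "growth = norm \<mu> / (1 - (norm \<mu>)\<^sup>2)"

definition growth_bound :: real where
  "growth_bound = exp (growth * (\<Sum>\<^sub>\<infinity>n. norm (a n - lam)))"

definition energy :: "(int \<Rightarrow> complex) \<Rightarrow> int \<Rightarrow> real" where
  "energy h n = norm (h n) + (norm \<mu>)\<^sup>2 / (1 - (norm \<mu>)\<^sup>2) * norm (h n - h (n + 1))"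

lemma mu_square_less_1: "(norm \<mu>)\<^sup>2 < 1"
  using mu_less_1 by (simp add: abs_square_less_1)

lemma growth_nonneg: "growth \<ge> 0"
  using mu_square_less_1 by (simp add: growth_def)

text \<open>Backward propagation is stable: the weight in \<open>energy\<close> is chosen such that
  the unperturbed recurrence does not increase it.\<close>

lemma energy_step:
  assumes "scaled_sol h"
  shows "energy h (n - 1) \<le> (1 + growth * norm (a n - lam)) * energy h n"
proof -
  define m where "m = norm \<mu>"
  define K where "K = m\<^sup>2 / (1 - m\<^sup>2)"
  define H D e where "H = norm (h n)" and "D = norm (h n - h (n + 1))" and "e = norm (a n - lam)"
  have pos: "1 - m\<^sup>2 > 0" using mu_square_less_1 by (simp add: m_def)
  have K: "1 + K = 1 / (1 - m\<^sup>2)" "K \<ge> 0" "(1 + K) * m\<^sup>2 = K" "(1 + K) * m = growth"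
    using pos by (simp_all add: K_def growth_def m_def field_simps)
  have nn: "H \<ge> 0" "D \<ge> 0" "e \<ge> 0" by (simp_all add: H_def D_def e_def)
  have d: "norm (h (n - 1) - h n) \<le> m\<^sup>2 * D + m * e * H"
    unfolding scaled_sol_step[OF assms, of n] m_def D_def e_def H_def
    by (rule norm_triangle_le) (simp add: norm_mult norm_power)
  have "norm (h (n - 1)) \<le> H + norm (h (n - 1) - h n)"
    unfolding H_def by (metis norm_triangle_sub)
  then have "energy h (n - 1) \<le> H + (1 + K) * norm (h (n - 1) - h n)"
    by (simp add: energy_def K_def m_def algebra_simps)
  also have "\<dots> \<le> H + (1 + K) * (m\<^sup>2 * D + m * e * H)"
    using d K(2) by (intro add_left_mono mult_left_mono) auto
  also have "\<dots> = H + ((1 + K) * m\<^sup>2) * D + ((1 + K) * m) * e * H"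
    by (simp add: algebra_simps)
  also have "\<dots> = H + K * D + growth * e * H"
    unfolding K(3) K(4) ..
  also have "\<dots> \<le> H + K * D + growth * e * (H + K * D)"
    using growth_nonneg K(2) nn by (intro add_left_mono mult_left_mono) auto
  also have "\<dots> = (1 + growth * e) * energy h n"
    unfolding energy_def m_def[symmetric] K_def[symmetric] H_def[symmetric] D_def[symmetric]
    by (simp add: algebra_simps)
  finally show ?thesis by (simp add: e_def)
qed

text \<open>Discrete Gronwall estimate towards the left, from \<open>1 + x \<le> exp x\<close> at
  each step. The constant does not depend on the endpoints, which makes every later truncation
  estimate uniform.\<close>

lemma energy_bound:
  assumes "scaled_sol h" "n \<le> m"
  shows "energy h n \<le> growth_bound * energy h m"
proof -
  have energy_nonneg: "energy h k \<ge> 0" for k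
    using mu_square_less_1 by (simp add: energy_def)
  have "energy h n \<le> exp (growth * (\<Sum>k\<in>{n<..m}. norm (a k - lam))) * energy h m"
    using assms(2)
  proof (induction n rule: int_le_induct)
    case base
    then show ?case by simp
  next
    case (step i)
    have "{i - 1<..m} = insert i {i<..m}" using step by auto
    then have s: "(\<Sum>k\<in>{i - 1<..m}. norm (a k - lam)) = norm (a i - lam) + (\<Sum>k\<in>{i<..m}. norm (a k - lam))"
      by simp
    have "energy h (i - 1) \<le> (1 + growth * norm (a i - lam)) * energy h i"
      by (rule energy_step) fact
    also have "\<dots> \<le> exp (growth * norm (a i - lam)) *
        (exp (growth * (\<Sum>k\<in>{i<..m}. norm (a k - lam))) * energy h m)"
      using step growth_nonneg energy_nonneg by (intro mult_mono) (auto intro: exp_ge_add_one_self)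
    also have "\<dots> = exp (growth * (\<Sum>k\<in>{i - 1<..m}. norm (a k - lam))) * energy h m"
      unfolding s by (simp add: exp_add distrib_left)
    finally show ?case .
  qed
  also have "\<dots> \<le> growth_bound * energy h m"
    unfolding growth_bound_def using perturbation_summable growth_nonneg energy_nonneg
    by (intro mult_right_mono) (auto intro!: mult_left_mono finite_sum_le_infsum)
  finally show ?thesis .
qed

lemma norm_le_energy: "norm (h n) \<le> energy h n"
  using mu_square_less_1 by (simp add: energy_def)

text \<open>If the coefficient were \<open>lam\<close> beyond \<open>m\<close>, the constant 1 would
  solve the scaled recurrence there. The two initial values therefore give, at indices up to
  \<open>m + 1\<close>, the scaled Jost solution of the truncated potential.\<close>

definition cutoff_sol :: "int \<Rightarrow> int \<Rightarrow> complex" where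
  "cutoff_sol m = (SOME h. scaled_sol h \<and> h m = 1 \<and> h (m + 1) = 1)"

lemma cutoff_sol:
  "scaled_sol (cutoff_sol m)" "cutoff_sol m m = 1" "cutoff_sol m (m + 1) = 1"
  using someI_ex[OF scaled_sol_exists[of m 1 1]] by (auto simp: cutoff_sol_def)

lemma cutoff_sol_bounded: "n \<le> m \<Longrightarrow> norm (cutoff_sol m n) \<le> growth_bound"
  using order.trans[OF norm_le_energy energy_bound[OF cutoff_sol(1)], of n m m]
  by (simp add: energy_def cutoff_sol)

text \<open>Moving the cutoff by one switches on a single coefficient. The difference vanishes at
  \<open>m + 1\<close>, is proportional to that perturbation at \<open>m\<close>, and
  \<open>energy_bound\<close> carries it to the left.\<close>

lemma cutoff_sol_Suc:
  assumes "n \<le> m"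
  shows "norm (cutoff_sol (m + 1) n - cutoff_sol m n)
           \<le> growth_bound * growth * norm (a (m + 1) - lam)"
proof -
  define D where "D n = cutoff_sol (m + 1) n - cutoff_sol m n" for n
  have "D (m + 1) = 0"
    by (simp add: D_def cutoff_sol)
  moreover have "D m = \<mu> * (a (m + 1) - lam)"
    using scaled_sol_step[OF cutoff_sol(1), of "m + 1" "m + 1"] cutoff_sol(2,3)[of "m + 1"]
    by (simp only: D_def cutoff_sol add_diff_cancel_right') simp
  ultimately have "energy D m = (1 + (norm \<mu>)\<^sup>2 / (1 - (norm \<mu>)\<^sup>2)) * norm \<mu> * norm (a (m + 1) - lam)"
    unfolding energy_def by (simp add: norm_mult distrib_right)
  also have "(1 + (norm \<mu>)\<^sup>2 / (1 - (norm \<mu>)\<^sup>2)) * norm \<mu> = growth"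
    using mu_square_less_1 by (simp add: growth_def field_simps)
  finally have E: "energy D m = growth * norm (a (m + 1) - lam)" .
  have "scaled_sol D"
    unfolding D_def by (intro scaled_sol_diff cutoff_sol)
  from order.trans[OF norm_le_energy energy_bound[OF this assms]] show ?thesis
    unfolding E by (simp add: D_def)
qed

text \<open>Majorant for the total effect of all cutoffs beyond \<open>M\<close>. It is free of the
  evaluation point, so the point may vary together with \<open>M\<close>.\<close>

definition tail :: "nat \<Rightarrow> real" where
  "tail M = growth_bound * growth * (\<Sum>k. norm (a (int (k + M) + 1) - lam))"

lemma perturbation_summable_nat:
  "summable (\<lambda>k. norm (a (int k + 1) - lam))"
proof -
  have "(\<lambda>n. norm (a n - lam)) summable_on range (\<lambda>k. int k + 1)"
    using perturbation_summable by (rule summable_on_subset_banach) simp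
  then have "(\<lambda>k. norm (a (int k + 1) - lam)) summable_on UNIV"
    by (subst (asm) summable_on_reindex) (auto simp: o_def inj_def)
  then show ?thesis by (rule summable_on_imp_summable)
qed

lemma tail_tendsto_0: "tail \<longlonglongrightarrow> 0"
proof -
  let ?f = "\<lambda>k. norm (a (int k + 1) - lam)"
  have "(\<Sum>k. ?f (k + M)) = suminf ?f - (\<Sum>k<M. ?f k)" for M
    by (rule suminf_minus_initial_segment) (rule perturbation_summable_nat)
  moreover have "(\<lambda>M. suminf ?f - (\<Sum>k<M. ?f k)) \<longlonglongrightarrow> suminf ?f - suminf ?f"
    by (intro tendsto_intros summable_LIMSEQ perturbation_summable_nat)
  ultimately have "(\<lambda>M. \<Sum>k. ?f (k + M)) \<longlonglongrightarrow> 0" by simp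
  then have "(\<lambda>M. growth_bound * growth * (\<Sum>k. ?f (k + M))) \<longlonglongrightarrow> growth_bound * growth * 0"
    by (rule tendsto_mult_left)
  then show ?thesis by (simp add: tail_def[abs_def])
qed

lemma cutoff_sol_diff_le_tail:
  assumes "n \<le> int M"
  shows "norm (cutoff_sol (int (M + j)) n - cutoff_sol (int M) n) \<le> tail M"
proof -
  have c: "growth_bound * growth \<ge> 0"
    using growth_nonneg by (simp add: growth_bound_def)
  have "norm (cutoff_sol (int (M + j)) n - cutoff_sol (int M) n)
      \<le> (\<Sum>k<j. growth_bound * growth * norm (a (int (k + M) + 1) - lam))"
  proof (induction j)
    case (Suc j)
    have "norm (cutoff_sol (int (M + j) + 1) n - cutoff_sol (int (M + j)) n)
        \<le> growth_bound * growth * norm (a (int (j + M) + 1) - lam)"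
      using cutoff_sol_Suc[of n "int (M + j)"] assms by (simp add: add_ac)
    with Suc show ?case
      using norm_triangle_ineq[of "cutoff_sol (int (M + j) + 1) n - cutoff_sol (int (M + j)) n"
          "cutoff_sol (int (M + j)) n - cutoff_sol (int M) n"]
      by (simp add: add_ac)
  qed simp
  also have "\<dots> \<le> tail M"
    unfolding tail_def sum_distrib_left[symmetric] of_nat_add using c
    by (intro mult_left_mono sum_le_suminf)
      (use summable_ignore_initial_segment[OF perturbation_summable_nat, of M] in simp_all)
  finally show ?thesis .
qed

definition jost_scaled :: "int \<Rightarrow> complex" where
  "jost_scaled n = lim (\<lambda>j. cutoff_sol (int j) n)"

lemma cutoff_sol_tendsto: "(\<lambda>j. cutoff_sol (int j) n) \<longlonglongrightarrow> jost_scaled n"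
proof -
  let ?f = "\<lambda>j. cutoff_sol (int j) n"
  have "norm (?f (Suc j) - ?f j) \<le> growth_bound * growth * norm (a (int j + 1) - lam)"
    if "j \<ge> nat n" for j
    using cutoff_sol_Suc[of n "int j"] that by (simp add: add_ac)
  then have "summable (\<lambda>j. ?f (Suc j) - ?f j)"
    by (rule summable_comparison_test'[OF summable_mult[OF perturbation_summable_nat]])
  then have "convergent (\<lambda>N. \<Sum>j<N. ?f (Suc j) - ?f j)"
    by (simp add: summable_iff_convergent)
  then have "convergent (\<lambda>N. (?f N - ?f 0) + ?f 0)"
    unfolding sum_lessThan_telescope[of ?f] by (rule convergent_add[OF _ convergent_const])
  then show ?thesis
    unfolding jost_scaled_def by (simp add: convergent_LIMSEQ_iff)
qed

lemma jost_scaled_sol: "scaled_sol jost_scaled"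
  unfolding scaled_sol_def
proof
  fix n
  have "(\<lambda>j. cutoff_sol (int j) (n - 1) - cutoff_sol (int j) n) \<longlonglongrightarrow> jost_scaled (n - 1) - jost_scaled n"
    by (intro tendsto_intros cutoff_sol_tendsto)
  moreover have "(\<lambda>j. cutoff_sol (int j) (n - 1) - cutoff_sol (int j) n) \<longlonglongrightarrow>
      - \<mu>\<^sup>2 * (jost_scaled n - jost_scaled (n + 1)) + \<mu> * (a n - lam) * jost_scaled n"
    unfolding scaled_sol_step[OF cutoff_sol(1)]
    by (intro tendsto_intros cutoff_sol_tendsto)
  ultimately show "jost_scaled (n - 1) - jost_scaled n =
      - \<mu>\<^sup>2 * (jost_scaled n - jost_scaled (n + 1)) + \<mu> * (a n - lam) * jost_scaled n"
    by (rule LIMSEQ_unique)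
qed

lemma jost_scaled_approx:
  assumes "n \<le> int M"
  shows "norm (jost_scaled n - cutoff_sol (int M) n) \<le> tail M"
proof -
  have "(\<lambda>j. norm (cutoff_sol (int j) n - cutoff_sol (int M) n))
          \<longlonglongrightarrow> norm (jost_scaled n - cutoff_sol (int M) n)"
    by (intro tendsto_intros cutoff_sol_tendsto)
  moreover have "norm (cutoff_sol (int j) n - cutoff_sol (int M) n) \<le> tail M" if "j \<ge> M" for j
    using cutoff_sol_diff_le_tail[OF assms, of "j - M"] that by simp
  ultimately show ?thesis
    by (intro LIMSEQ_le_const2) auto
qed

lemma jost_scaled_tendsto_1: "(jost_scaled \<longlongrightarrow> 1) at_top"
proof -
  \<comment> \<open>On the diagonal \<open>cutoff_sol n n = 1\<close>, so the truncation estimate is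
    itself the asymptotics.\<close>
  have "(\<lambda>n. jost_scaled (int n) - 1) \<longlonglongrightarrow> 0"
    using jost_scaled_approx[of "int n" n for n]
    by (intro Lim_null_comparison[OF _ tail_tendsto_0] always_eventually) (simp add: cutoff_sol)
  then show ?thesis
    by (simp add: filterlim_int_at_top_iff LIM_zero_iff)
qed

text \<open>Controls the side opposite to the normalization; it multiplies a null sequence when the
  Wronskian is evaluated far to the left.\<close>

lemma jost_scaled_bounded: "n \<le> 0 \<Longrightarrow> norm (jost_scaled n) \<le> growth_bound + tail 0"
  using jost_scaled_approx[of n 0] cutoff_sol_bounded[of n 0]
    norm_triangle_sub[of "jost_scaled n" "cutoff_sol 0 n"] by simp

text \<open>Two decaying solutions have Wronskian 0. Convergence to 0 without a rate is exactly what
  square summability supplies.\<close>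

lemma decaying_multiple_of_jost:
  assumes "rec_sol a z" "(z \<longlongrightarrow> 0) at_top"
  shows "\<exists>c. z = (\<lambda>n. c * (\<mu> powi n * jost_scaled n))"
proof -
  let ?j = "\<lambda>n. \<mu> powi n * jost_scaled n"
  have "(\<lambda>n. \<mu> ^ n) \<longlonglongrightarrow> 0" using mu_less_1 by (rule LIMSEQ_power_zero)
  then have "((\<lambda>n. \<mu> powi n) \<longlongrightarrow> 0) at_top"
    by (simp add: filterlim_int_at_top_iff)
  from tendsto_mult[OF this jost_scaled_tendsto_1] have dec: "(?j \<longlongrightarrow> 0) at_top" by simp
  have j: "rec_sol a ?j" using jost_scaled_sol by (simp add: scaled_sol_iff)
  have "?j \<noteq> (\<lambda>_. 0)"
  proof
    assume "?j = (\<lambda>_. 0)"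
    then have "\<mu> powi n * jost_scaled n = 0" for n by meson
    then have "jost_scaled = (\<lambda>_. 0)" using mu_nonzero by auto
    then show False using jost_scaled_tendsto_1 by (simp add: tendsto_const_iff)
  qed
  from wronskian_eq_0_imp_multiple[OF j assms(1) wronskian_decaying[OF j assms(1) dec assms(2), of 0] this]
  show ?thesis .
qed

lemma tendsto_rescaled_imp_tendsto_0:
  assumes "((\<lambda>n. \<mu> powi (- n) * z n) \<longlongrightarrow> l) at_top"
  shows "(z \<longlongrightarrow> 0) at_top"
proof -
  have "(\<lambda>n. \<mu> ^ n) \<longlonglongrightarrow> 0" using mu_less_1 by (rule LIMSEQ_power_zero)
  then have "((\<lambda>n. \<mu> powi n) \<longlongrightarrow> 0) at_top"
    by (simp add: filterlim_int_at_top_iff)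
  from tendsto_mult[OF this assms] show ?thesis by simp
qed

text \<open>For \<open>l = 1\<close> this is the uniqueness behind the definite descriptions of the
  Jost solutions. General \<open>l\<close> serves the entries of the matrix solutions, whose limits
  are entries of a projection.\<close>

lemma jost_multiple:
  assumes "rec_sol a z" "((\<lambda>n. \<mu> powi (- n) * z n) \<longlongrightarrow> l) at_top"
  shows "z = (\<lambda>n. l * (\<mu> powi n * jost_scaled n))"
proof -
  obtain c where c: "z = (\<lambda>n. c * (\<mu> powi n * jost_scaled n))"
    using decaying_multiple_of_jost[OF assms(1) tendsto_rescaled_imp_tendsto_0[OF assms(2)]] by blast
  have "((\<lambda>n. c * jost_scaled n) \<longlongrightarrow> c * 1) at_top"
    by (intro tendsto_intros jost_scaled_tendsto_1)
  then have "((\<lambda>n. \<mu> powi (- n) * z n) \<longlongrightarrow> c) at_top"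
    by (simp add: c mult.left_commute[of _ c])
  then have "c = l" using assms(2) by (intro tendsto_unique) auto
  with c show ?thesis by simp
qed

lemma jost_solution:
  "rec_sol a (\<lambda>n. \<mu> powi n * jost_scaled n)"
  "((\<lambda>n. \<mu> powi (- n) * (\<mu> powi n * jost_scaled n)) \<longlongrightarrow> 1) at_top"
proof -
  show "rec_sol a (\<lambda>n. \<mu> powi n * jost_scaled n)"
    using jost_scaled_sol by (simp add: scaled_sol_iff)
  show "((\<lambda>n. \<mu> powi (- n) * (\<mu> powi n * jost_scaled n)) \<longlongrightarrow> 1) at_top"
    using jost_scaled_tendsto_1 by simp
qed

end

section \<open>Fredholm determinants of semi-separable kernels\<close>

lemma principal_minor_empty [simp]: "principal_minor M {} = 1"
  by (simp add: principal_minor_def)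

lemma principal_minor_cong:
  assumes "\<And>i j. i \<in> F \<Longrightarrow> j \<in> F \<Longrightarrow> M i j = M' i j"
  shows "principal_minor M F = principal_minor M' F"
  unfolding principal_minor_def using assms
  by (intro sum.cong arg_cong2[where f = "(*)"] prod.cong) (auto simp: permutes_in_image)

lemma principal_minor_scale:
  "principal_minor (\<lambda>i j. x i * M i j * y j) F = (\<Prod>i\<in>F. x i * y i) * principal_minor M F"
proof -
  have "(\<Prod>i\<in>F. x i * M i (\<pi> i) * y (\<pi> i)) = (\<Prod>i\<in>F. x i * y i) * (\<Prod>i\<in>F. M i (\<pi> i))"
    if "\<pi> permutes F" for \<pi>
    using prod.permute[OF that, of y] by (simp add: prod.distrib o_def mult_ac)
  then show ?thesis
    unfolding principal_minor_def sum_distrib_left by (intro sum.cong) (auto simp: mult_ac)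
qed

text \<open>Laplace expansion along a row reduced to its diagonal entry: a permutation moving
  \<open>i\<close> picks up a factor 0.\<close>

lemma principal_minor_row_zero:
  assumes "finite F" "i \<in> F" "\<And>j. j \<in> F - {i} \<Longrightarrow> M i j = 0"
  shows "principal_minor M F = M i i * principal_minor M (F - {i})"
proof -
  let ?t = "\<lambda>F \<pi>. of_int (sign \<pi>) * (\<Prod>k\<in>F. M k (\<pi> k))"
  have remove: "(\<Prod>k\<in>F. M k (\<pi> k)) = M i (\<pi> i) * (\<Prod>k\<in>F - {i}. M k (\<pi> k))" for \<pi>
    using assms by (simp add: prod.remove)
  have "principal_minor M F = (\<Sum>\<pi> | \<pi> permutes (F - {i}). ?t F \<pi>)"
    unfolding principal_minor_def
  proof (rule sum.mono_neutral_right)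
    show "\<forall>\<pi>\<in>{\<pi>. \<pi> permutes F} - {\<pi>. \<pi> permutes (F - {i})}. ?t F \<pi> = 0"
    proof
      fix \<pi> assume \<pi>: "\<pi> \<in> {\<pi>. \<pi> permutes F} - {\<pi>. \<pi> permutes (F - {i})}"
      then have "\<pi> i \<noteq> i"
        using permutes_superset[of \<pi> F "F - {i}"] by auto
      then have "M i (\<pi> i) = 0"
        using assms \<pi> by (auto simp: permutes_in_image)
      then show "?t F \<pi> = 0" by (simp add: remove)
    qed
  qed (use assms in \<open>auto simp: finite_permutations intro: permutes_subset\<close>)
  also have "\<dots> = (\<Sum>\<pi> | \<pi> permutes (F - {i}). M i i * ?t (F - {i}) \<pi>)"
  proof (rule sum.cong)
    fix \<pi> assume "\<pi> \<in> {\<pi>. \<pi> permutes (F - {i})}"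
    then have "\<pi> i = i" by (auto simp: permutes_def)
    then show "?t F \<pi> = M i i * ?t (F - {i}) \<pi>" by (simp add: remove)
  qed simp
  finally show ?thesis
    by (simp add: principal_minor_def sum_distrib_left)
qed

text \<open>Composition with the transposition flips each sign and preserves each product, so the
  minor is its own negative.\<close>

lemma principal_minor_identical_rows:
  assumes "finite F" "i \<in> F" "j \<in> F" "i \<noteq> j" "M i = M j"
  shows "principal_minor M F = 0"
proof -
  let ?\<tau> = "Transposition.transpose i j"
  have \<tau>: "?\<tau> permutes F" using assms by (simp add: permutes_swap_id)
  have M: "M (?\<tau> k) = M k" for k
    using assms(5) by (auto simp: Transposition.transpose_def)
  have "principal_minor M F = (\<Sum>\<pi> | \<pi> permutes F. of_int (sign (\<pi> \<circ> ?\<tau>)) * (\<Prod>k\<in>F. M k ((\<pi> \<circ> ?\<tau>) k)))"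
    unfolding principal_minor_def by (rule sum_permutations_compose_right) (rule \<tau>)
  also have "\<dots> = (\<Sum>\<pi> | \<pi> permutes F. - (of_int (sign \<pi>) * (\<Prod>k\<in>F. M k (\<pi> k))))"
  proof (rule sum.cong)
    fix \<pi> assume "\<pi> \<in> {\<pi>. \<pi> permutes F}"
    then have "sign (\<pi> \<circ> ?\<tau>) = - sign \<pi>"
      using assms \<tau> by (simp add: sign_compose permutes_imp_permutation sign_swap_id)
    moreover have "(\<Prod>k\<in>F. M k ((\<pi> \<circ> ?\<tau>) k)) = (\<Prod>k\<in>F. M k (\<pi> k))"
      using prod.permute[OF \<tau>, of "\<lambda>k. M k (\<pi> k)"] by (simp add: o_def M)
    ultimately show "of_int (sign (\<pi> \<circ> ?\<tau>)) * (\<Prod>k\<in>F. M k ((\<pi> \<circ> ?\<tau>) k)) =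
        - (of_int (sign \<pi>) * (\<Prod>k\<in>F. M k (\<pi> k)))" by simp
  qed simp
  also have "\<dots> = - principal_minor M F"
    by (simp add: principal_minor_def sum_negf)
  finally show ?thesis by simp
qed

text \<open>Linearity in row \<open>i\<close>; the correction term is a minor with two equal
  rows.\<close>

lemma principal_minor_row_operation:
  assumes "finite F" "i \<in> F" "j \<in> F" "i \<noteq> j"
  shows "principal_minor M F = principal_minor (M(i := (\<lambda>k. M i k - c * M j k))) F"
proof -
  have remove: "(\<Prod>k\<in>F. (M(i := r)) k (\<pi> k)) = r (\<pi> i) * (\<Prod>k\<in>F - {i}. M k (\<pi> k))" for r \<pi>
    using assms(1,2) by (simp add: prod.remove[of F i])
  have "principal_minor (M(i := (\<lambda>k. M i k - c * M j k))) F =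
      principal_minor (M(i := M i)) F - c * principal_minor (M(i := M j)) F"
    unfolding principal_minor_def remove sum_distrib_left sum_subtractf[symmetric]
    by (intro sum.cong) (auto simp: algebra_simps)
  then show ?thesis
    using assms principal_minor_identical_rows[of F i j "M(i := M j)"] by simp
qed

text \<open>Expanding a product of factors \<open>1 + u i\<close> yields the products over all
  subsets, and it is at most the exponential of the sum. This provides the absolute convergence of
  the determinant series.\<close>

lemma summable_on_finite_subset_products:
  fixes u :: "'i \<Rightarrow> real"
  assumes "\<And>i. u i \<ge> 0" "u summable_on UNIV"
  shows "(\<lambda>F. \<Prod>i\<in>F. u i) summable_on {F. finite F}"
proof (rule nonneg_bdd_above_summable_on)
  show "bdd_above (sum (\<lambda>F. \<Prod>i\<in>F. u i) ` {X. X \<subseteq> {F. finite F} \<and> finite X})"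
  proof (rule bdd_aboveI2)
    fix X :: "'i set set" assume X: "X \<in> {X. X \<subseteq> {F. finite F} \<and> finite X}"
    have fin: "finite (\<Union>X)" using X by auto
    have "(\<Sum>F\<in>X. \<Prod>i\<in>F. u i) \<le> (\<Sum>F\<in>Pow (\<Union>X). \<Prod>i\<in>F. u i)"
      using assms(1) fin by (intro sum_mono2) (auto intro: prod_nonneg)
    also have "\<dots> = (\<Prod>i\<in>\<Union>X. u i + 1)"
      using prod_add[OF fin, of u "\<lambda>_. 1"] by simp
    also have "\<dots> \<le> (\<Prod>i\<in>\<Union>X. exp (u i))"
    proof (rule prod_mono)
      fix i
      show "0 \<le> u i + 1 \<and> u i + 1 \<le> exp (u i)"
        using assms(1)[of i] exp_ge_add_one_self[of "u i"] by linarith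
    qed
    also have "\<dots> = exp (\<Sum>i\<in>\<Union>X. u i)"
      by (rule exp_sum[symmetric]) (rule fin)
    also have "\<dots> \<le> exp (infsum u UNIV)"
      unfolding exp_le_cancel_iff using assms fin by (intro finite_sum_le_infsum) auto
    finally show "(\<Sum>F\<in>X. \<Prod>i\<in>F. u i) \<le> exp (infsum u UNIV)" .
  qed
qed (use assms in \<open>auto intro: prod_nonneg\<close>)

text \<open>An unconditional sum over finite sets may be regrouped by cardinality, which recovers
  the series of traces of exterior powers.\<close>

lemma fredholm_det_I_minus_has_sum:
  assumes "((\<lambda>F. (- 1) ^ card F * principal_minor M F) has_sum s) {F. finite F}"
  shows "fredholm_det_I_minus M = s"
proof -
  let ?f = "\<lambda>F. (- 1) ^ card F * principal_minor M F"
  let ?B = "\<lambda>k. {F. finite F \<and> card F = k}"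
  have "((\<lambda>(k, F). ?f F) has_sum s) (Sigma UNIV ?B)"
  proof (rule has_sum_reindex_bij_witness[THEN iffD1, OF _ _ _ _ _ _ assms])
    show "\<And>F. F \<in> {F. finite F} \<Longrightarrow> snd (card F, F) = F" by simp
  qed auto
  moreover have "(?f has_sum ((- 1) ^ k * trace_ext_power k M)) (?B k)" for k
  proof -
    have "?f summable_on {F. finite F}"
      using assms by (rule has_sum_imp_summable)
    then have "?f summable_on ?B k"
      by (rule summable_on_subset_banach) blast
    then have "(?f has_sum infsum ?f (?B k)) (?B k)"
      by (rule has_sum_infsum)
    also have "infsum ?f (?B k) = infsum (\<lambda>F. (- 1) ^ k * principal_minor M F) (?B k)"
      by (rule infsum_cong) simp
    also have "\<dots> = (- 1) ^ k * trace_ext_power k M"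
      unfolding trace_ext_power_def by (rule infsum_cmult_right')
    finally show ?thesis .
  qed
  ultimately have "((\<lambda>k. (- 1) ^ k * trace_ext_power k M) has_sum s) UNIV"
    by (rule has_sum_Sigma'[where f = "\<lambda>(k, F). ?f F", unfolded prod.case])
  then show ?thesis
    unfolding fredholm_det_I_minus_def by (metis has_sum_imp_sums sums_unique)
qed

text \<open>Every finite family of finite sets lies in the power set of some symmetric interval, so
  these power sets suffice to compute the sum.\<close>

lemma has_sum_finite_sets_tendsto:
  fixes f :: "int set \<Rightarrow> complex"
  assumes "(f has_sum s) {F. finite F}"
  shows "(\<lambda>N. sum f (Pow {- int N..int N})) \<longlonglongrightarrow> s"
proof -
  have "filterlim (\<lambda>N. Pow {- int N..int N}) (finite_subsets_at_top {F. finite F}) sequentially"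
    unfolding filterlim_iff eventually_finite_subsets_at_top
  proof (intro allI impI, elim exE conjE)
    fix P and X :: "int set set"
    assume X: "finite X" "X \<subseteq> {F. finite F}"
      and P: "\<forall>Y. finite Y \<and> X \<subseteq> Y \<and> Y \<subseteq> {F. finite F} \<longrightarrow> P Y"
    have "bdd_above (abs ` \<Union>X)" using X by (intro bdd_above_finite) auto
    then obtain b where b: "\<And>x. x \<in> \<Union>X \<Longrightarrow> \<bar>x\<bar> \<le> b"
      unfolding bdd_above_def by blast
    show "\<forall>\<^sub>F N in sequentially. P (Pow {- int N..int N})"
    proof (rule eventually_sequentiallyI)
      fix N assume "nat b \<le> N"
      then have "\<And>x. x \<in> \<Union>X \<Longrightarrow> \<bar>x\<bar> \<le> int N" using b by fastforce
      then have "X \<subseteq> Pow {- int N..int N}" by (fastforce simp: abs_le_iff)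
      moreover have "Pow {- int N..int N} \<subseteq> {F. finite F}"
        using finite_subset[OF _ finite_atLeastAtMost_int] by blast
      ultimately show "P (Pow {- int N..int N})"
        using P[rule_format, of "Pow {- int N..int N}"] by simp
    qed
  qed
  then show ?thesis
    using assms unfolding has_sum_def by (rule filterlim_compose[rotated])
qed

section \<open>Minors of the Green kernel and the backward recurrence\<close>

text \<open>The Green function of \<open>v (n - 1) - v (n + 1) - lam v n\<close>, where \<open>lam = \<mu>\<^sup>-\<^sup>1 - \<mu>\<close>.\<close>

definition green :: "complex \<Rightarrow> int \<Rightarrow> complex" where
  "green \<mu> m = - (\<mu> / (1 + \<mu>\<^sup>2)) * (if m \<ge> 0 then \<mu> ^ nat m else (- \<mu>) ^ nat (- m))"

text \<open>In the columns of \<open>G\<close> the rows of \<open>a\<close> and of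
  \<open>Min G\<close> are proportional with ratio \<open>(- \<mu>) ^ nat (Min G - a)\<close>: this
  is semi-separability. One row operation clears row \<open>a\<close> off the diagonal and leaves
  the factor depending on the gap.\<close>

lemma principal_minor_green_insert:
  assumes "finite G" "G \<noteq> {}" "\<And>b. b \<in> G \<Longrightarrow> a < b"
  shows "principal_minor (\<lambda>i j. green \<mu> (i - j)) (insert a G) =
    - (\<mu> / (1 + \<mu>\<^sup>2)) * (1 - (- \<mu>\<^sup>2) ^ nat (Min G - a)) * principal_minor (\<lambda>i j. green \<mu> (i - j)) G"
proof -
  define j where "j = Min G"
  have j: "j \<in> G" "a < j" "\<And>b. b \<in> G \<Longrightarrow> j \<le> b"
    using assms by (auto simp: j_def)
  define M where "M = (\<lambda>i j. green \<mu> (i - j))"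
  define M' where "M' = M(a := (\<lambda>k. M a k - (- \<mu>) ^ nat (j - a) * M j k))"
  have zero: "M' a b = 0" if "b \<in> G" for b
  proof -
    have b: "a < b" "j \<le> b" using that assms(3) j by auto
    then have e: "nat (b - a) = nat (j - a) + nat (b - j)" using j by simp
    have "M a b = - (\<mu> / (1 + \<mu>\<^sup>2)) * (- \<mu>) ^ nat (b - a)"
      using b by (simp add: M_def green_def)
    \<comment> \<open>For \<open>b = j\<close> the argument is 0 and the other branch of
      \<open>green\<close> applies; the branches agree there.\<close>
    moreover have "M j b = - (\<mu> / (1 + \<mu>\<^sup>2)) * (- \<mu>) ^ nat (b - j)"
      using b by (cases "b = j") (auto simp: M_def green_def)
    ultimately show ?thesis by (simp add: M'_def e power_add)
  qed
  have "M' a a = - (\<mu> / (1 + \<mu>\<^sup>2)) * (1 - (- \<mu>) ^ nat (j - a) * \<mu> ^ nat (j - a))"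
    using j(2) by (simp add: M'_def M_def green_def algebra_simps)
  also have "(- \<mu>) ^ nat (j - a) * \<mu> ^ nat (j - a) = (- \<mu>\<^sup>2) ^ nat (j - a)"
    by (simp add: power2_eq_square flip: power_mult_distrib)
  finally have diag: "M' a a = - (\<mu> / (1 + \<mu>\<^sup>2)) * (1 - (- \<mu>\<^sup>2) ^ nat (j - a))" .
  have aG: "a \<notin> G" using assms(3) by blast
  have "principal_minor M (insert a G) = principal_minor M' (insert a G)"
    unfolding M'_def using assms(1) j by (intro principal_minor_row_operation) auto
  also have "\<dots> = M' a a * principal_minor M' (insert a G - {a})"
    using assms(1) zero aG by (intro principal_minor_row_zero) auto
  also have "insert a G - {a} = G" using aG by simp
  also have "principal_minor M' G = principal_minor M G"
    using aG by (intro principal_minor_cong) (auto simp: M'_def)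
  finally show ?thesis by (simp add: diag M_def j_def)
qed

lemma principal_minor_green_singleton:
  "principal_minor (\<lambda>i j. green \<mu> (i - j)) {a} = - (\<mu> / (1 + \<mu>\<^sup>2))"
  by (subst principal_minor_row_zero[of _ a]) (auto simp: green_def)

context jost
begin

text \<open>The signed principal minor of the kernel of \<open>K_op\<close>: the diagonal factors
  \<open>c_seq\<close> and \<open>b_seq\<close> multiply to minus the perturbation, as
  \<open>minor_entries_K\<close> shows.\<close>

definition minor_weight :: "int set \<Rightarrow> complex" where
  "minor_weight F = (\<Prod>i\<in>F. - (a i - lam)) * principal_minor (\<lambda>i j. green \<mu> (i - j)) F"

text \<open>Splits the gap factor into a part from the new element and a part from the old minimum,
  so that sums over sets close up. The value 0 at the empty set makes singletons obey the same
  insertion formula.\<close>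

definition min_power :: "int set \<Rightarrow> complex" where
  "min_power F = (if F = {} then 0 else (- \<mu>\<^sup>2) powi Min F)"

lemma one_plus_mu_square: "1 + \<mu>\<^sup>2 \<noteq> 0"
proof
  assume "1 + \<mu>\<^sup>2 = 0"
  then have "\<mu>\<^sup>2 = - 1" by (simp add: eq_neg_iff_add_eq_0 add.commute)
  then have "norm (\<mu>\<^sup>2) = 1" by simp
  then show False using mu_square_less_1 by (simp add: norm_power)
qed

lemma minor_weight_insert:
  assumes "finite G" "\<And>b. b \<in> G \<Longrightarrow> k < b"
  shows "minor_weight (insert k G) =
    \<mu> / (1 + \<mu>\<^sup>2) * (a k - lam) * (1 - (- \<mu>\<^sup>2) powi (- k) * min_power G) * minor_weight G"
proof -
  have k: "k \<notin> G" using assms(2) by blast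
  show ?thesis
  proof (cases "G = {}")
    case True
    then show ?thesis
      by (simp add: minor_weight_def principal_minor_green_singleton min_power_def
          left_diff_distrib right_diff_distrib diff_divide_distrib mult.commute)
  next
    case False
    then have "k < Min G" using assms by simp
    then have "(- \<mu>\<^sup>2) ^ nat (Min G - k) = (- \<mu>\<^sup>2) powi (- k) * (- \<mu>\<^sup>2) powi Min G"
      using mu_nonzero power_int_add[of "- \<mu>\<^sup>2" "- k" "Min G"]
      by (simp add: power_int_def)
    then show ?thesis
      using principal_minor_green_insert[OF assms(1) False assms(2), of \<mu>] k assms(1) False
      by (simp add: minor_weight_def min_power_def mult_ac del: minus_diff_eq)
  qed
qed

text \<open>Each insertion contributes a factor \<open>1 - x\<close> with
  \<open>norm x \<le> 1\<close>, whence the constant 2. The bound has the product form required for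
  summation over all finite sets.\<close>

lemma norm_minor_weight_le:
  assumes "finite F"
  shows "norm (minor_weight F) \<le> (\<Prod>i\<in>F. 2 * norm (\<mu> / (1 + \<mu>\<^sup>2)) * norm (a i - lam))"
  using assms
proof (induction F rule: finite_linorder_min_induct)
  case empty
  then show ?case by (simp add: minor_weight_def)
next
  case (insert k G)
  have "norm ((- \<mu>\<^sup>2) powi (- k) * min_power G) \<le> 1"
  proof (cases "G = {}")
    case False
    then have "k < Min G" using insert by simp
    then have "(- \<mu>\<^sup>2) powi (- k) * min_power G = (- \<mu>\<^sup>2) ^ nat (Min G - k)"
      using mu_nonzero power_int_add[of "- \<mu>\<^sup>2" "- k" "Min G"] False
      by (simp add: power_int_def min_power_def)
    then show ?thesis
      using mu_square_less_1 by (simp add: norm_power power_le_one)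
  qed (simp add: min_power_def)
  then have "norm (1 - (- \<mu>\<^sup>2) powi (- k) * min_power G) \<le> 2"
    using norm_triangle_ineq4[of 1 "(- \<mu>\<^sup>2) powi (- k) * min_power G"] by simp
  moreover have "minor_weight (Set.insert k G) =
      \<mu> / (1 + \<mu>\<^sup>2) * (a k - lam) * (1 - (- \<mu>\<^sup>2) powi (- k) * min_power G) * minor_weight G"
    using insert.hyps by (intro minor_weight_insert) auto
  ultimately have "norm (minor_weight (Set.insert k G)) \<le>
      norm (\<mu> / (1 + \<mu>\<^sup>2)) * norm (a k - lam) * 2 * (\<Prod>i\<in>G. 2 * norm (\<mu> / (1 + \<mu>\<^sup>2)) * norm (a i - lam))"
    using insert.IH by (simp only: norm_mult) (intro mult_mono mult_nonneg_nonneg; simp)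
  then show ?case using insert.hyps by (subst prod.insert) (auto simp: mult_ac)
qed

lemma minor_weight_summable: "minor_weight summable_on {F. finite F}"
proof -
  have "(\<lambda>F. \<Prod>i\<in>F. 2 * norm (\<mu> / (1 + \<mu>\<^sup>2)) * norm (a i - lam)) summable_on {F. finite F}"
    using perturbation_summable
    by (intro summable_on_finite_subset_products summable_on_cmult_right) auto
  then have "(\<lambda>F. norm (minor_weight F)) summable_on {F. finite F}"
    by (rule Infinite_Sum.abs_summable_on_comparison_test') (use norm_minor_weight_le in auto)
  then show ?thesis by (rule abs_summable_summable)
qed

text \<open>Removing the least element of a set turns the sum of all weights into the backward
  recurrence for \<open>cutoff_sol\<close>.\<close>

lemma sum_minor_weight:
  assumes "k \<le> m + 1"
  shows "(1 + \<mu>\<^sup>2) * sum minor_weight (Pow {k..m}) = \<mu>\<^sup>2 * cutoff_sol m k + cutoff_sol m (k - 1) \<and>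
    (1 + \<mu>\<^sup>2) * (\<Sum>F\<in>Pow {k..m}. minor_weight F * min_power F) =
      (- \<mu>\<^sup>2) powi k * (cutoff_sol m (k - 1) - cutoff_sol m k)"
  using assms
proof (induction k rule: int_le_induct)
  case base
  then show ?case by (simp add: cutoff_sol minor_weight_def min_power_def)
next
  case (step i)
  \<comment> \<open>The sums \<open>D\<close> and \<open>E\<close> encode two consecutive values of
    \<open>h\<close>, so both must be carried through the induction.\<close>
  define h where "h = cutoff_sol m"
  define D where "D = sum minor_weight (Pow {i..m})"
  define E where "E = (\<Sum>F\<in>Pow {i..m}. minor_weight F * min_power F)"
  define c where "c = \<mu> / (1 + \<mu>\<^sup>2) * (a (i - 1) - lam)"
  have \<theta>: "(- \<mu>\<^sup>2) powi (1 - i) * (- \<mu>\<^sup>2) powi i = - \<mu>\<^sup>2" "(- \<mu>\<^sup>2) powi (i - 1) * (- \<mu>\<^sup>2) powi (1 - i) = 1"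
    using mu_nonzero by (simp_all flip: power_int_add)
  have interval: "{i - 1..m} = insert (i - 1) {i..m}" using step by auto
  have split: "sum f (Pow {i - 1..m}) = sum f (Pow {i..m}) + (\<Sum>F\<in>Pow {i..m}. f (insert (i - 1) F))"
    for f :: "int set \<Rightarrow> complex"
  proof -
    have inj: "inj_on (insert (i - 1)) (Pow {i..m})"
    proof (rule inj_onI)
      fix A B assume "A \<in> Pow {i..m}" "B \<in> Pow {i..m}" "insert (i - 1) A = insert (i - 1) B"
      moreover from this have "i - 1 \<notin> A" "i - 1 \<notin> B" by auto
      ultimately show "A = B" by (simp add: insert_ident)
    qed
    have "sum f (Pow {i - 1..m}) = sum f (Pow {i..m}) + sum f (insert (i - 1) ` Pow {i..m})"
      unfolding interval Pow_insert by (rule sum.union_disjoint) auto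
    then show ?thesis by (simp add: sum.reindex[OF inj])
  qed
  have w: "minor_weight (insert (i - 1) F) = c * (minor_weight F - (- \<mu>\<^sup>2) powi (1 - i) * (minor_weight F * min_power F))"
    "min_power (insert (i - 1) F) = (- \<mu>\<^sup>2) powi (i - 1)"
    if "F \<in> Pow {i..m}" for F
  proof -
    have "finite F" using that by (auto intro: finite_subset)
    moreover have "i - 1 < b" if "b \<in> F" for b using that \<open>F \<in> Pow {i..m}\<close> by auto
    ultimately show "minor_weight (insert (i - 1) F) = c * (minor_weight F - (- \<mu>\<^sup>2) powi (1 - i) * (minor_weight F * min_power F))"
      "min_power (insert (i - 1) F) = (- \<mu>\<^sup>2) powi (i - 1)"
      using minor_weight_insert[of F "i - 1"]
      by (simp_all add: c_def algebra_simps min_power_def Min_insert2 less_imp_le)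
  qed
  have IH: "(1 + \<mu>\<^sup>2) * D = \<mu>\<^sup>2 * h i + h (i - 1)" "(1 + \<mu>\<^sup>2) * E = (- \<mu>\<^sup>2) powi i * (h (i - 1) - h i)"
    using step by (simp_all add: D_def E_def h_def)
  \<comment> \<open>Up to the factor \<open>c\<close>, this combination is the total weight of the
    sets with least element \<open>i - 1\<close>; eliminating \<open>h i\<close> leaves
    \<open>h (i - 1)\<close> alone.\<close>
  have "(1 + \<mu>\<^sup>2) * (D - (- \<mu>\<^sup>2) powi (1 - i) * E) =
      (1 + \<mu>\<^sup>2) * D - (- \<mu>\<^sup>2) powi (1 - i) * ((1 + \<mu>\<^sup>2) * E)"
    by (simp add: algebra_simps)
  also have "\<dots> = \<mu>\<^sup>2 * h i + h (i - 1) - ((- \<mu>\<^sup>2) powi (1 - i) * (- \<mu>\<^sup>2) powi i) * (h (i - 1) - h i)"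
    unfolding IH by (simp add: mult.assoc)
  also have "\<dots> = (1 + \<mu>\<^sup>2) * h (i - 1)"
    unfolding \<theta> by (simp add: algebra_simps)
  finally have H: "D - (- \<mu>\<^sup>2) powi (1 - i) * E = h (i - 1)"
    using one_plus_mu_square by simp
  have sum_w: "(\<Sum>F\<in>Pow {i..m}. minor_weight (insert (i - 1) F)) = c * h (i - 1)"
    using w unfolding H[symmetric] D_def E_def
    by (simp add: sum_subtractf sum_distrib_left right_diff_distrib)
  then have D': "sum minor_weight (Pow {i - 1..m}) = D + c * h (i - 1)"
    unfolding split D_def by (rule arg_cong)
  have "(\<Sum>F\<in>Pow {i..m}. minor_weight (insert (i - 1) F) * min_power (insert (i - 1) F))
      = (- \<mu>\<^sup>2) powi (i - 1) * (c * h (i - 1))"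
    unfolding sum_w[symmetric] sum_distrib_left by (intro sum.cong) (auto simp: w(2))
  then have E': "(\<Sum>F\<in>Pow {i - 1..m}. minor_weight F * min_power F) = E + (- \<mu>\<^sup>2) powi (i - 1) * (c * h (i - 1))"
    unfolding split E_def by simp
  have rec: "h (i - 1 - 1) - h (i - 1) = - \<mu>\<^sup>2 * (h (i - 1) - h i) + (1 + \<mu>\<^sup>2) * c * h (i - 1)"
    using scaled_sol_step[OF cutoff_sol(1), of m "i - 1"] one_plus_mu_square
    by (simp add: h_def c_def)
  have "(- \<mu>\<^sup>2) powi i = (- \<mu>\<^sup>2) powi (i - 1) * (- \<mu>\<^sup>2)"
    using power_int_add[of "- \<mu>\<^sup>2" "i - 1" 1] mu_nonzero by simp
  then have "(1 + \<mu>\<^sup>2) * (E + (- \<mu>\<^sup>2) powi (i - 1) * (c * h (i - 1))) =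
      (- \<mu>\<^sup>2) powi (i - 1) * (- \<mu>\<^sup>2 * (h (i - 1) - h i) + (1 + \<mu>\<^sup>2) * c * h (i - 1))"
    unfolding distrib_left[of "1 + \<mu>\<^sup>2"] IH by (simp add: algebra_simps)
  moreover have "(1 + \<mu>\<^sup>2) * (D + c * h (i - 1)) = \<mu>\<^sup>2 * h (i - 1) + h (i - 1 - 1)"
    using rec unfolding distrib_left[of "1 + \<mu>\<^sup>2"] IH by (simp add: algebra_simps)
  ultimately show ?case
    unfolding D' E' rec[symmetric] h_def[symmetric] by blast
qed

text \<open>Formulated as a difference because the left end moves along with the cutoff. The error
  is controlled by \<open>tail N\<close> at both indices \<open>- N\<close> and
  \<open>- N - 1\<close>.\<close>

lemma sum_minor_weight_tendsto:
  "(\<lambda>N. (1 + \<mu>\<^sup>2) * sum minor_weight (Pow {- int N..int N})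
     - (\<mu>\<^sup>2 * jost_scaled (- int N) + jost_scaled (- int N - 1))) \<longlonglongrightarrow> 0"
proof (rule Lim_null_comparison)
  have "(\<lambda>N. (norm (\<mu>\<^sup>2) + 1) * tail N) \<longlonglongrightarrow> (norm (\<mu>\<^sup>2) + 1) * 0"
    by (intro tendsto_intros tail_tendsto_0)
  then show "(\<lambda>N. (norm (\<mu>\<^sup>2) + 1) * tail N) \<longlonglongrightarrow> 0" by simp
  have "norm ((1 + \<mu>\<^sup>2) * sum minor_weight (Pow {- int N..int N})
     - (\<mu>\<^sup>2 * jost_scaled (- int N) + jost_scaled (- int N - 1))) \<le> (norm (\<mu>\<^sup>2) + 1) * tail N" for N
  proof -
    let ?d = "\<lambda>n. jost_scaled n - cutoff_sol (int N) n"
    have "(1 + \<mu>\<^sup>2) * sum minor_weight (Pow {- int N..int N})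
       - (\<mu>\<^sup>2 * jost_scaled (- int N) + jost_scaled (- int N - 1))
      = - (\<mu>\<^sup>2 * ?d (- int N) + ?d (- int N - 1))"
      using sum_minor_weight[of "- int N" "int N"] by (simp add: algebra_simps)
    moreover have "norm (\<mu>\<^sup>2 * ?d (- int N) + ?d (- int N - 1)) \<le> norm (\<mu>\<^sup>2) * tail N + tail N"
      by (intro norm_triangle_mono) (auto simp: norm_mult intro!: mult_left_mono jost_scaled_approx)
    ultimately show ?thesis by (simp only: norm_minus_cancel) (simp add: algebra_simps)
  qed
  then show "\<forall>\<^sub>F N in sequentially. norm ((1 + \<mu>\<^sup>2) * sum minor_weight (Pow {- int N..int N})
     - (\<mu>\<^sup>2 * jost_scaled (- int N) + jost_scaled (- int N - 1))) \<le> (norm (\<mu>\<^sup>2) + 1) * tail N"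
    by simp
qed

end

section \<open>The determinants and the Wronskian\<close>

lemma l2_add:
  fixes v w :: "'i \<Rightarrow> 'a::real_normed_vector"
  assumes "v \<in> l2" "w \<in> l2"
  shows "(\<lambda>i. v i + w i) \<in> l2"
proof -
  have "(norm (v i + w i))\<^sup>2 \<le> 2 * (norm (v i))\<^sup>2 + 2 * (norm (w i))\<^sup>2" for i
  proof -
    have "(norm (v i + w i))\<^sup>2 \<le> (norm (v i) + norm (w i))\<^sup>2"
      by (intro power_mono norm_triangle_ineq) simp
    also have "\<dots> \<le> 2 * (norm (v i))\<^sup>2 + 2 * (norm (w i))\<^sup>2"
      using sum_squares_bound[of "norm (v i)" "norm (w i)"] by (simp add: power2_sum)
    finally show ?thesis .
  qed
  moreover have "(\<lambda>i. 2 * (norm (v i))\<^sup>2 + 2 * (norm (w i))\<^sup>2) summable_on UNIV"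
    using assms by (intro summable_on_add summable_on_cmult_right) (auto simp: l2_def)
  ultimately show ?thesis
    unfolding l2_def mem_Collect_eq
    by (simp add: summable_on_comparison_test[of "\<lambda>i. 2 * (norm (v i))\<^sup>2 + 2 * (norm (w i))\<^sup>2"])
qed

lemma l2_diff: "v \<in> l2 \<Longrightarrow> w \<in> l2 \<Longrightarrow> (\<lambda>i. v i - w i) \<in> l2"
  using l2_add[of v "\<lambda>i. - w i"] by (simp add: l2_def)

lemma l2_shift:
  fixes v :: "int \<Rightarrow> 'a::real_normed_vector"
  assumes "v \<in> l2" shows "(\<lambda>i. v (i + k)) \<in> l2"
proof -
  have "bij (\<lambda>i::int. i + k)"
    by (rule bij_betw_byWitness[of _ "\<lambda>i. i - k"]) auto
  from summable_on_reindex_bij_betw[OF this, of "\<lambda>i. (norm (v i))\<^sup>2"] assms show ?thesis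
    by (simp add: l2_def)
qed

lemma l2_vec2_iff:
  fixes v :: "'i \<Rightarrow> complex^2"
  shows "v \<in> l2 \<longleftrightarrow> (\<lambda>i. v i $ 1) \<in> l2 \<and> (\<lambda>i. v i $ 2) \<in> l2"
proof -
  have eq: "(norm (v i))\<^sup>2 = (norm (v i $ 1))\<^sup>2 + (norm (v i $ 2))\<^sup>2" for i
    by (simp add: norm_vec_def L2_set_def sum_2)
  show ?thesis
  proof
    assume v: "v \<in> l2"
    show "(\<lambda>i. v i $ 1) \<in> l2 \<and> (\<lambda>i. v i $ 2) \<in> l2"
      using v unfolding l2_def mem_Collect_eq eq
      by (auto elim!: summable_on_comparison_test)
  next
    assume "(\<lambda>i. v i $ 1) \<in> l2 \<and> (\<lambda>i. v i $ 2) \<in> l2"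
    then show "v \<in> l2"
      unfolding l2_def mem_Collect_eq eq by (auto intro: summable_on_add)
  qed
qed

lemma principal_minor_image:
  assumes "finite F" "inj_on f F"
  shows "principal_minor M (f ` F) = principal_minor (\<lambda>i j. M (f i) (f j)) F"
  unfolding principal_minor_def
proof (rule sum.reindex_bij_witness[symmetric])
  let ?g = "inv_into F f"
  have b: "bij_betw f F (f ` F)" "bij_betw ?g (f ` F) F"
    using assms by (auto simp: bij_betw_def inj_on_inv_into)
  show "map_permutation (f ` F) ?g (map_permutation F f \<pi>) = \<pi>" if "\<pi> \<in> {\<pi>. \<pi> permutes F}" for \<pi>
    using that b assms by (intro map_permutation_compose_inv) auto
  show "map_permutation F f \<pi> \<in> {\<pi>. \<pi> permutes f ` F}" if "\<pi> \<in> {\<pi>. \<pi> permutes F}" for \<pi>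
    using that b by (auto intro: map_permutation_permutes)
  show "map_permutation F f (map_permutation (f ` F) ?g \<pi>) = \<pi>" if "\<pi> \<in> {\<pi>. \<pi> permutes f ` F}" for \<pi>
    using that b assms by (intro map_permutation_compose_inv) (auto simp: f_inv_into_f)
  show "map_permutation (f ` F) ?g \<pi> \<in> {\<pi>. \<pi> permutes F}" if "\<pi> \<in> {\<pi>. \<pi> permutes f ` F}" for \<pi>
    using that b by (auto intro: map_permutation_permutes)
  show "of_int (sign (map_permutation F f \<pi>)) * (\<Prod>i\<in>f ` F. M i (map_permutation F f \<pi> i)) =
      of_int (sign \<pi>) * (\<Prod>i\<in>F. M (f i) (f (\<pi> i)))" if "\<pi> \<in> {\<pi>. \<pi> permutes F}" for \<pi>
    using that assms by (simp add: sign_map_permutation prod.reindex map_permutation_apply)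
qed

section \<open>Eigenvalues of \<open>A_mat\<close> and the free Green function\<close>

lemma mat_eigenvalue_A_mat: "mat_eigenvalue (A_mat lam) \<mu> \<longleftrightarrow> \<mu>\<^sup>2 + lam * \<mu> = 1"
proof
  assume "mat_eigenvalue (A_mat lam) \<mu>"
  then obtain v where v: "v \<noteq> 0" "A_mat lam *v v = \<mu> *s v"
    by (auto simp: mat_eigenvalue_def)
  then have 1: "- lam * v $ 1 + v $ 2 = \<mu> * v $ 1" and 2: "v $ 1 = \<mu> * v $ 2"
    by (auto simp: vec_eq_iff forall_2 matrix_vector_mult_def sum_2 A_mat_def)
  have "v $ 2 \<noteq> 0"
    using v(1) 2 by (auto simp: vec_eq_iff forall_2)
  moreover have "v $ 2 * (\<mu>\<^sup>2 + lam * \<mu>) = v $ 2 * 1"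
    using 1 unfolding 2 by (simp add: algebra_simps power2_eq_square)
  ultimately show "\<mu>\<^sup>2 + lam * \<mu> = 1" by (metis mult_left_cancel)
next
  assume *: "\<mu>\<^sup>2 + lam * \<mu> = 1"
  have "A_mat lam *v vector [\<mu>, 1] = \<mu> *s vector [\<mu>, 1]"
    using * by (simp add: vec_eq_iff forall_2 matrix_vector_mult_def sum_2 A_mat_def)
      (simp add: algebra_simps power2_eq_square)
  moreover have "vector [\<mu>, 1] \<noteq> (0 :: complex^2)"
    by (simp add: vec_eq_iff forall_2)
  ultimately show "mat_eigenvalue (A_mat lam) \<mu>"
    unfolding mat_eigenvalue_def by blast
qed

text \<open>The roots have product -1, so one lies inside the unit disc unless both lie on the
  circle. In that case inverse and conjugate agree and \<open>lam\<close> would be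
  imaginary.\<close>

lemma quadratic_root_inside_disc:
  assumes "Re lam > 0"
  obtains \<mu> where "\<mu> \<noteq> 0" "norm \<mu> < 1" "lam = inverse \<mu> - \<mu>"
proof -
  define s where "s = csqrt (lam\<^sup>2 + 4)"
  define x where "x = (s - lam) / 2"
  define y where "y = (- s - lam) / 2"
  have s: "s\<^sup>2 = lam\<^sup>2 + 4" by (simp add: s_def)
  have xy: "x * y = - 1"
    using s by (simp add: x_def y_def field_simps power2_eq_square)
  have sum: "x + y = - lam" by (simp add: x_def y_def field_simps)
  have nz: "x \<noteq> 0" "y \<noteq> 0" using xy by auto
  have "inverse x = - y" "inverse y = - x"
    using xy nz by (auto simp: field_simps)
  moreover have "lam = - (x + y)" using sum by simp
  ultimately have lam: "lam = inverse x - x" "lam = inverse y - y" by simp_all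
  have "norm x \<noteq> 1"
  proof
    assume "norm x = 1"
    then have "x * cnj x = 1"
      using complex_norm_square[of x] by simp
    then have "inverse x = cnj x"
      by (rule inverse_unique)
    then have "Re lam = 0" by (simp add: lam(1))
    then show False using assms by simp
  qed
  moreover have "norm y = inverse (norm x)"
    using \<open>inverse x = - y\<close> by (metis norm_inverse norm_minus_cancel)
  ultimately consider "norm x < 1" | "norm y < 1"
    by (auto simp: inverse_less_1_iff neq_iff)
  then show thesis
  proof cases
    case 1
    then show ?thesis using that[of x] nz lam by blast
  next
    case 2
    then show ?thesis using that[of y] nz lam by blast
  qed
qed

lemma mu_plus_minus_eqI:
  assumes "\<mu> \<noteq> 0" "norm \<mu> < 1" "lam = inverse \<mu> - \<mu>"
  shows "mu_plus lam = \<mu>" "mu_minus lam = - inverse \<mu>"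
proof -
  have ev: "mat_eigenvalue (A_mat lam) x \<longleftrightarrow> x = \<mu> \<or> x = - inverse \<mu>" for x
  proof -
    have "x\<^sup>2 + lam * x = 1 \<longleftrightarrow> (x - \<mu>) * (x + inverse \<mu>) = 0"
      using assms(1) by (subst assms(3)) (simp add: algebra_simps power2_eq_square)
    then show ?thesis
      unfolding mat_eigenvalue_A_mat by (simp add: eq_neg_iff_add_eq_0)
  qed
  have big: "norm (- inverse \<mu>) > 1"
    using assms by (simp add: norm_inverse one_less_inverse)
  show "mu_plus lam = \<mu>" "mu_minus lam = - inverse \<mu>"
    unfolding mu_plus_def mu_minus_def ev using assms(2) big by (auto intro!: the_equality)
qed

lemma green_eq:
  assumes "1 + \<mu>\<^sup>2 \<noteq> 0" "\<mu> \<noteq> 0" "lam = inverse \<mu> - \<mu>"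
  shows "green \<mu> (m - 1) - green \<mu> (m + 1) - lam * green \<mu> m = (if m = 0 then 1 else 0)"
proof -
  define g where "g = - (\<mu> / (1 + \<mu>\<^sup>2))"
  have pos: "green \<mu> (int k) = g * \<mu> ^ k" for k
    by (simp add: green_def g_def)
  have neg: "green \<mu> (- int k) = g * (- \<mu>) ^ k" for k
    by (cases k) (simp_all add: green_def g_def del: of_nat_Suc)
  have "lam * \<mu> = 1 - \<mu>\<^sup>2"
    using assms(2,3) by (simp add: left_diff_distrib power2_eq_square)
  moreover have "q - q * \<mu>\<^sup>2 - lam * (q * \<mu>) = q * (1 - \<mu>\<^sup>2 - lam * \<mu>)" for q
    by (simp add: algebra_simps)
  ultimately have cancel: "q - q * \<mu>\<^sup>2 - lam * (q * \<mu>) = 0" for q by simp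
  have "q * \<mu>\<^sup>2 - q - lam * - (q * \<mu>) = - (q - q * \<mu>\<^sup>2 - lam * (q * \<mu>))" for q
    by (simp add: algebra_simps)
  then have cancel': "q * \<mu>\<^sup>2 - q - lam * - (q * \<mu>) = 0" for q
    by (simp only: cancel) simp
  consider "m = 0" | k where "m = int (Suc k)" | k where "m = - int (Suc k)"
  proof -
    have "m = 0 \<or> m = int (Suc (nat (m - 1))) \<or> m = - int (Suc (nat (- m - 1)))" by linarith
    then show thesis using that by blast
  qed
  then show ?thesis
  proof cases
    case 1
    \<comment> \<open>The jump at 0 is what fixes the constant in \<open>green\<close>.\<close>
    have "2 * \<mu> + lam = (1 + \<mu>\<^sup>2) / \<mu>"
      using assms(2,3) by (simp add: field_simps power2_eq_square)
    then have "g * (2 * \<mu> + lam) = - 1" using assms(1,2) by (simp add: g_def)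
    moreover have "green \<mu> (- 1) = - g * \<mu>" "green \<mu> 1 = g * \<mu>" "green \<mu> 0 = g"
      using neg[of 1] pos[of 1] pos[of 0] by simp_all
    ultimately show ?thesis
      using 1 by (simp add: algebra_simps minus_equation_iff)
  next
    case 2
    then have "green \<mu> (m - 1) = g * \<mu> ^ k" "green \<mu> (m + 1) = g * \<mu> ^ k * \<mu>\<^sup>2" "green \<mu> m = g * \<mu> ^ k * \<mu>"
      using pos[of k] pos[of "Suc k"] pos[of "Suc (Suc k)"]
      by (simp_all add: add_ac power2_eq_square)
    then show ?thesis
      using 2 cancel[of "g * \<mu> ^ k"] by simp
  next
    case 3
    then have m: "m + 1 = - int k" "m - 1 = - int (Suc (Suc k))" by simp_all
    have v: "green \<mu> (m + 1) = g * (- \<mu>) ^ k" "green \<mu> (m - 1) = g * (- \<mu>) ^ k * \<mu>\<^sup>2" "green \<mu> m = - (g * (- \<mu>) ^ k * \<mu>)"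
      unfolding m unfolding 3 neg by (simp_all add: power2_eq_square)
    have "m \<noteq> 0" using 3 by simp
    then show ?thesis
      unfolding v by (simp only: cancel') simp
  qed
qed

lemma green_l2:
  assumes "norm \<mu> < 1"
  shows "green \<mu> \<in> l2"
proof (rule l2_exponential_decay)
  show "norm (green \<mu> (int n)) \<le> norm (\<mu> / (1 + \<mu>\<^sup>2)) * norm \<mu> ^ n" for n
    by (simp add: green_def norm_mult norm_power norm_divide)
  show "norm (green \<mu> (- int n)) \<le> norm (\<mu> / (1 + \<mu>\<^sup>2)) * norm \<mu> ^ n" for n
    by (cases n) (simp_all add: green_def norm_mult norm_power norm_divide del: of_nat_Suc)
qed (use assms in auto)

text \<open>The properties of \<open>rho p q\<close> on which the spectral analysis rests.
  Positivity excludes the index 0, where the lattice line enters the disc and the sign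
  changes.\<close>

locale euler_potential =
  fixes \<rho> :: "int \<Rightarrow> real" and lam :: complex
  assumes rho_nonzero: "\<rho> n \<noteq> 0" and rho_le_1: "\<rho> n \<le> 1"
    and rho_pos: "n \<noteq> 0 \<Longrightarrow> 0 < \<rho> n"
    and inverse_rho_summable: "(\<lambda>n. \<bar>1 / \<rho> n - 1\<bar>) summable_on UNIV"
    and Re_lam: "Re lam > 0"
begin

abbreviation \<mu> where "\<mu> \<equiv> mu_plus lam"
abbreviation coef where "coef \<equiv> (\<lambda>n. lam / of_real (\<rho> n))"

lemma mu_props: "\<mu> \<noteq> 0" "norm \<mu> < 1" "lam = inverse \<mu> - \<mu>" "mu_minus lam = - inverse \<mu>"
  using quadratic_root_inside_disc[OF Re_lam] mu_plus_minus_eqI by metis+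

sublocale right: jost coef lam \<mu>
proof
  have "norm (coef n - lam) = norm lam * \<bar>1 / \<rho> n - 1\<bar>" for n
  proof -
    have "coef n - lam = lam * of_real (1 / \<rho> n - 1)"
      by (simp add: field_simps)
    then show ?thesis by (simp only: norm_mult norm_of_real)
  qed
  then show "(\<lambda>n. norm (coef n - lam)) summable_on UNIV"
    using inverse_rho_summable by (simp add: summable_on_cmult_right)
qed (use mu_props in auto)

sublocale left: jost "\<lambda>n. coef (- n)" lam \<mu>
proof
  show "(\<lambda>n. norm (coef (- n) - lam)) summable_on UNIV"
    using right.perturbation_summable
    by (subst summable_on_reindex_bij_betw[of uminus UNIV UNIV "\<lambda>n. norm (coef n - lam)"])
      (auto intro: bij_uminus)
qed (use mu_props in auto)

text \<open>The unperturbed recurrence governs the injectivity of the operators inverted in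
  \<open>K_op\<close> and \<open>T_op\<close>.\<close>

sublocale free: jost "\<lambda>n. lam" lam \<mu>
  by unfold_locales (use mu_props in auto)

abbreviation "h \<equiv> right.jost_scaled"
abbreviation "k n \<equiv> left.jost_scaled (- n)"

lemma mu_minus_powi: "mu_minus lam powi n = (- 1) powi n * \<mu> powi (- n)"
proof -
  have "- inverse \<mu> = - 1 * inverse \<mu>" by simp
  then show ?thesis
    unfolding mu_props(4) by (simp only: power_int_mult_distrib power_int_minus power_int_inverse)
qed

lemma z_plus_eq: "z_plus \<rho> lam = (\<lambda>n. \<mu> powi n * h n)"
  unfolding z_plus_def solves_diff_eq_iff
proof (rule the_equality)
  fix z assume "rec_sol coef z \<and> ((\<lambda>n. \<mu> powi (- n) * z n) \<longlongrightarrow> 1) at_top"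
  then show "z = (\<lambda>n. \<mu> powi n * h n)"
    using right.jost_multiple[of z 1] by simp
qed (use right.jost_solution in blast)

text \<open>As \<open>mu_minus lam\<close> is \<open>- inverse \<mu>\<close>, its powers carry the
  sign built into \<open>reflect\<close>. Thus the normalization of \<open>z_minus\<close> at the
  left becomes the usual one for its reflection.\<close>

lemma rescaled_reflect: "mu_minus lam powi m * z (- m) = \<mu> powi (- m) * reflect z m"
  by (simp add: mu_minus_powi reflect_def)

lemma z_minus_eq: "z_minus \<rho> lam = reflect (\<lambda>n. \<mu> powi n * left.jost_scaled n)"
  unfolding z_minus_def solves_diff_eq_iff filterlim_int_at_bot_iff minus_minus rescaled_reflect
proof (rule the_equality)
  show "rec_sol coef (reflect (\<lambda>n. \<mu> powi n * left.jost_scaled n)) \<and>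
    ((\<lambda>n. \<mu> powi (- n) * reflect (reflect (\<lambda>n. \<mu> powi n * left.jost_scaled n)) n) \<longlongrightarrow> 1) at_top"
    using left.jost_solution rec_sol_reflect[of "\<lambda>n. coef (- n)" "\<lambda>n. \<mu> powi n * left.jost_scaled n"]
    by (simp only: reflect_reflect minus_minus)
next
  fix z assume z: "rec_sol coef z \<and> ((\<lambda>n. \<mu> powi (- n) * reflect z n) \<longlongrightarrow> 1) at_top"
  then have "reflect z = (\<lambda>n. \<mu> powi n * left.jost_scaled n)"
    using left.jost_multiple[of "reflect z" 1] rec_sol_reflect[of coef z] by simp
  then show "z = reflect (\<lambda>n. \<mu> powi n * left.jost_scaled n)"
    by (metis reflect_reflect)
qed

lemma z_plus_sol: "rec_sol coef (z_plus \<rho> lam)"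
  and z_minus_sol: "rec_sol coef (z_minus \<rho> lam)"
  using right.jost_solution(1) rec_sol_reflect[OF left.jost_solution(1)]
  by (simp_all only: z_plus_eq z_minus_eq minus_minus)

text \<open>The index is free by constancy of the Wronskian, and the powers of \<open>\<mu>\<close>
  in the two Jost solutions cancel. The factor on the left clears the difference of the
  characteristic roots, which is \<open>- (1 + \<mu>\<^sup>2) / \<mu>\<close>.\<close>

lemma F_fun_eq:
  "(1 + \<mu>\<^sup>2) * F_fun \<rho> lam = h (n - 1) * k n + \<mu>\<^sup>2 * (h n * k (n - 1))"
proof -
  have "(1 + \<mu>\<^sup>2) * inverse (mu_minus lam - \<mu>) = - \<mu>"
  proof -
    have "mu_minus lam - \<mu> = - ((1 + \<mu>\<^sup>2) / \<mu>)"
      using mu_props(1) by (simp add: mu_props(4) field_simps power2_eq_square)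
    then show ?thesis
      using mu_props(1) right.one_plus_mu_square by simp
  qed
  then have 1: "(1 + \<mu>\<^sup>2) * F_fun \<rho> lam = - \<mu> * wronskian (z_plus \<rho> lam) (z_minus \<rho> lam) n"
    unfolding F_fun_def wronskian_constant[OF z_plus_sol z_minus_sol, of 0 n]
    by (simp flip: mult.assoc)
  define p where "p = \<mu> powi (n - 1)"
  have pz: "p \<noteq> 0" using mu_props(1) by (simp add: p_def)
  have sgn: "(- 1 :: complex) powi n = - ((- 1) powi (n - 1))"
    using powi_minus_one_step[of "n - 1"] by simp
  have "\<mu> powi n = p * \<mu>"
    using mu_props(1) power_int_add[of \<mu> "n - 1" 1] by (simp add: p_def)
  moreover from this have "z_plus \<rho> lam n = p * \<mu> * h n" "z_plus \<rho> lam (n - 1) = p * h (n - 1)"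
    by (simp_all add: z_plus_eq p_def)
  moreover have "z_minus \<rho> lam n = (- 1) powi n * inverse (p * \<mu>) * k n"
    "z_minus \<rho> lam (n - 1) = (- 1) powi (n - 1) * inverse p * k (n - 1)"
    using \<open>\<mu> powi n = p * \<mu>\<close> by (simp_all add: z_minus_eq reflect_def power_int_minus p_def[symmetric] power_int_minus[of \<mu> "n - 1", simplified])
  ultimately have "wronskian (z_plus \<rho> lam) (z_minus \<rho> lam) n = (- 1) powi (n - 1) *
      (p * h (n - 1) * (- ((- 1) powi (n - 1)) * inverse (p * \<mu>) * k n)
        - p * \<mu> * h n * ((- 1) powi (n - 1) * inverse p * k (n - 1)))"
    by (simp only: wronskian_def sgn)
  moreover have "- \<mu> * (s * (p * h (n - 1) * (- s * inverse (p * \<mu>) * k n)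
        - p * \<mu> * h n * (s * inverse p * k (n - 1)))) =
      (s * s) * (h (n - 1) * k n + \<mu>\<^sup>2 * (h n * k (n - 1)))" for s
    using pz mu_props(1) by (simp add: field_simps power2_eq_square)
  ultimately have "- \<mu> * wronskian (z_plus \<rho> lam) (z_minus \<rho> lam) n =
      ((- 1) powi (n - 1) * (- 1) powi (n - 1)) * (h (n - 1) * k n + \<mu>\<^sup>2 * (h n * k (n - 1)))"
    by simp
  then show ?thesis
    unfolding 1 by (simp add: powi_minus_one_square)
qed

text \<open>As \<open>k\<close> tends to \<open>1\<close> at \<open>- \<infinity>\<close>, evaluating the constant Wronskian at \<open>- N\<close> produces in the limit
  exactly the expression of \<open>sum_minor_weight_tendsto\<close>.\<close>

lemma sum_minor_weight_tendsto_F: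
  "(\<lambda>N. sum right.minor_weight (Pow {- int N..int N})) \<longlonglongrightarrow> F_fun \<rho> lam"
proof -
  let ?D = "\<lambda>N. sum right.minor_weight (Pow {- int N..int N})"
  have k1: "(\<lambda>N. k (- int N)) \<longlonglongrightarrow> 1" "(\<lambda>N. k (- int N - 1)) \<longlonglongrightarrow> 1"
  proof -
    show "(\<lambda>N. k (- int N)) \<longlonglongrightarrow> 1"
      using left.jost_scaled_tendsto_1 by (simp add: filterlim_int_at_top_iff)
    from LIMSEQ_Suc[OF this] show "(\<lambda>N. k (- int N - 1)) \<longlonglongrightarrow> 1"
      by (simp add: add.commute)
  qed
  have bd: "norm (h (- int N)) \<le> right.growth_bound + right.tail 0"
    "norm (h (- int N - 1)) \<le> right.growth_bound + right.tail 0" for N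
    by (auto intro: right.jost_scaled_bounded)
  have zero: "(\<lambda>N. x N * (y N - 1)) \<longlonglongrightarrow> 0"
    if "\<And>N. norm (x N) \<le> B" "y \<longlonglongrightarrow> 1" for x y :: "nat \<Rightarrow> complex" and B
    using that by (intro lim_null_mult_left_bounded[of _ B]) (auto simp: LIM_zero_iff)
  have "(\<lambda>N. ((1 + \<mu>\<^sup>2) * ?D N - (\<mu>\<^sup>2 * h (- int N) + h (- int N - 1)))
      - (h (- int N - 1) * (k (- int N) - 1) + \<mu>\<^sup>2 * (h (- int N) * (k (- int N - 1) - 1))))
      \<longlonglongrightarrow> 0 - (0 + \<mu>\<^sup>2 * 0)"
    by (intro tendsto_intros right.sum_minor_weight_tendsto zero[OF bd(2) k1(1)] zero[OF bd(1) k1(2)])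
  moreover have "((1 + \<mu>\<^sup>2) * ?D N - (\<mu>\<^sup>2 * h (- int N) + h (- int N - 1)))
      - (h (- int N - 1) * (k (- int N) - 1) + \<mu>\<^sup>2 * (h (- int N) * (k (- int N - 1) - 1)))
      = (1 + \<mu>\<^sup>2) * ?D N - (1 + \<mu>\<^sup>2) * F_fun \<rho> lam" for N
    unfolding F_fun_eq[of "- int N"] by (simp add: algebra_simps)
  ultimately have "(\<lambda>N. (1 + \<mu>\<^sup>2) * ?D N - (1 + \<mu>\<^sup>2) * F_fun \<rho> lam) \<longlonglongrightarrow> 0"
    by (simp only: mult_zero_right add_0 diff_0_right)
  then have "(\<lambda>N. (1 + \<mu>\<^sup>2) * ?D N) \<longlonglongrightarrow> (1 + \<mu>\<^sup>2) * F_fun \<rho> lam"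
    by (simp add: LIM_zero_iff)
  then show ?thesis
    using right.one_plus_mu_square by (simp add: tendsto_mult_left_iff)
qed

lemma minor_weight_has_sum: "(right.minor_weight has_sum F_fun \<rho> lam) {F. finite F}"
proof -
  have "(right.minor_weight has_sum (infsum right.minor_weight {F. finite F})) {F. finite F}"
    by (rule has_sum_infsum) (rule right.minor_weight_summable)
  moreover from has_sum_finite_sets_tendsto[OF this] sum_minor_weight_tendsto_F
  have "infsum right.minor_weight {F. finite F} = F_fun \<rho> lam"
    by (rule LIMSEQ_unique)
  ultimately show ?thesis by simp
qed

text \<open>Decay at the right leaves only multiples of the powers of \<open>\<mu>\<close>, and
  these blow up at the left.\<close>

lemma free_l2_zero:
  assumes "rec_sol (\<lambda>_. lam) w" "w \<in> l2"
  shows "w = (\<lambda>_. 0)"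
proof -
  have "rec_sol (\<lambda>_. lam) (\<lambda>n. \<mu> powi n)"
    using free.scaled_sol_iff[of "\<lambda>_. 1"] by (simp add: free.scaled_sol_def)
  then have pow: "(\<lambda>n. \<mu> powi n) = (\<lambda>n. 1 * (\<mu> powi n * free.jost_scaled n))"
    using mu_props(1) by (intro free.jost_multiple) (simp_all add: power_int_minus)
  obtain c where c: "w = (\<lambda>n. c * (\<mu> powi n * free.jost_scaled n))"
    using free.decaying_multiple_of_jost[OF assms(1) l2_tendsto_at_top[OF assms(2)]] by blast
  have w: "w n = c * \<mu> powi n" for n
    using c fun_cong[OF pow, of n] by simp
  have "(\<lambda>n. w (- int n)) \<longlonglongrightarrow> 0"
    using l2_tendsto_at_top[OF l2_uminus_arg[OF assms(2)]] by (simp add: filterlim_int_at_top_iff)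
  then have "(\<lambda>n. w (- int n) * \<mu> ^ n) \<longlonglongrightarrow> 0 * 0"
    by (intro tendsto_mult LIMSEQ_power_zero mu_props)
  then have "(\<lambda>n::nat. c) \<longlonglongrightarrow> 0"
    using mu_props(1) by (simp add: w power_int_minus mult.assoc)
  then have "c = 0" by (simp add: LIMSEQ_const_iff)
  then show ?thesis using w by auto
qed

text \<open>Injectivity on \<open>l2\<close> comes from \<open>free_l2_zero\<close>, so exhibiting a
  square summable preimage evaluates the inverse.\<close>

lemma the_inv_shift_eq:
  assumes "v \<in> l2" "\<And>m. v (m - 1) - v (m + 1) - lam * v m = f m"
  shows "the_inv_into l2 (\<lambda>v m. shift v m - shift_adj v m - lam * v m) f = v"
proof (rule the_inv_into_f_eq)
  show "inj_on (\<lambda>v m. shift v m - shift_adj v m - lam * v m) l2"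
  proof (rule inj_onI)
    fix x y :: "int \<Rightarrow> complex" assume *: "x \<in> l2" "y \<in> l2"
      "(\<lambda>m. shift x m - shift_adj x m - lam * x m) = (\<lambda>m. shift y m - shift_adj y m - lam * y m)"
    then have eq: "x (m - 1) - x (m + 1) - lam * x m = y (m - 1) - y (m + 1) - lam * y m" for m
      using fun_cong[OF *(3), of m] by (simp only: shift_def shift_adj_def)
    have "rec_sol (\<lambda>_. lam) (\<lambda>m. x m - y m)"
      unfolding rec_sol_def
    proof
      fix m
      have "x (m - 1) - y (m - 1) - (x (m + 1) - y (m + 1)) =
          (x (m - 1) - x (m + 1) - lam * x m) - (y (m - 1) - y (m + 1) - lam * y m) + lam * (x m - y m)"
        by (simp add: algebra_simps)
      then show "x (m - 1) - y (m - 1) - (x (m + 1) - y (m + 1)) = lam * (x m - y m)"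
        unfolding eq[of m] by simp
    qed
    from free_l2_zero[OF this l2_diff[OF *(1,2)]] show "x = y" by (metis eq_iff_diff_eq_0 ext)
  qed
qed (use assms in \<open>auto simp: shift_def shift_adj_def\<close>)

lemma entries_K: "entries (K_op \<rho> lam) i j = - c_seq \<rho> i * green \<mu> (i - j) * b_seq \<rho> lam j"
proof -
  have "the_inv_into l2 (\<lambda>v m. shift v m - shift_adj v m - lam * v m)
      (\<lambda>m. b_seq \<rho> lam m * (if m = j then 1 else 0)) = (\<lambda>m. b_seq \<rho> lam j * green \<mu> (m - j))"
  proof (rule the_inv_shift_eq)
    show "(\<lambda>m. b_seq \<rho> lam j * green \<mu> (m - j)) \<in> l2"
      using l2_shift[OF green_l2[OF mu_props(2)], of "- j"]
      by (rule l2_comparison[where C = "norm (b_seq \<rho> lam j)"]) (simp add: norm_mult)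
  next
    fix m
    have "green \<mu> (m - j - 1) - green \<mu> (m - j + 1) - lam * green \<mu> (m - j) = (if m = j then 1 else 0)"
      using green_eq[OF right.one_plus_mu_square mu_props(1,3), of "m - j"] by simp
    then have "b_seq \<rho> lam j * (green \<mu> (m - j - 1) - green \<mu> (m - j + 1) - lam * green \<mu> (m - j)) =
        b_seq \<rho> lam m * (if m = j then 1 else 0)" by simp
    then show "b_seq \<rho> lam j * green \<mu> (m - 1 - j) - b_seq \<rho> lam j * green \<mu> (m + 1 - j) -
        lam * (b_seq \<rho> lam j * green \<mu> (m - j)) = b_seq \<rho> lam m * (if m = j then 1 else 0)"
      by (simp add: algebra_simps)
  qed
  then show ?thesis by (simp add: entries_def K_op_def)
qed

lemma minor_entries_K:
  assumes "finite F"
  shows "(- 1) ^ card F * principal_minor (entries (K_op \<rho> lam)) F = right.minor_weight F"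
proof -
  have cb: "c_seq \<rho> i * b_seq \<rho> lam i = - (coef i - lam)" for i
  proof -
    have "of_real (sqrt (1 - \<rho> i)) * of_real (sqrt (1 - \<rho> i)) = (of_real (1 - \<rho> i) :: complex)"
      using rho_le_1[of i] by (simp flip: of_real_mult)
    then have "c_seq \<rho> i * b_seq \<rho> lam i = - lam * of_real (1 - \<rho> i) / of_real (\<rho> i)"
      by (simp add: c_seq_def b_seq_def)
    then show ?thesis
      using rho_nonzero[of i] by (simp add: field_simps)
  qed
  have "principal_minor (entries (K_op \<rho> lam)) F =
      principal_minor (\<lambda>i j. (- c_seq \<rho> i) * green \<mu> (i - j) * b_seq \<rho> lam j) F"
    by (simp add: entries_K[abs_def])
  also have "\<dots> = (\<Prod>i\<in>F. - c_seq \<rho> i * b_seq \<rho> lam i) * principal_minor (\<lambda>i j. green \<mu> (i - j)) F"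
    by (rule principal_minor_scale)
  also have "(\<Prod>i\<in>F. - c_seq \<rho> i * b_seq \<rho> lam i) = (- 1) ^ card F * (\<Prod>i\<in>F. - (coef i - lam))"
  proof -
    have "(\<Prod>i\<in>F. - c_seq \<rho> i * b_seq \<rho> lam i) = (\<Prod>i\<in>F. - 1 * - (coef i - lam))"
      by (intro prod.cong) (auto simp: cb)
    then show ?thesis unfolding prod.distrib by simp
  qed
  finally show ?thesis
    by (simp add: right.minor_weight_def flip: mult.assoc power_mult_distrib)
qed

theorem det_I_minus_K_eq: "det_I_minus_K \<rho> lam = F_fun \<rho> lam"
  unfolding det_I_minus_K_def
proof (rule fredholm_det_I_minus_has_sum)
  show "((\<lambda>F. (- 1) ^ card F * principal_minor (entries (K_op \<rho> lam)) F) has_sum F_fun \<rho> lam) {F. finite F}"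
    using minor_weight_has_sum by (rule has_sum_cong[THEN iffD1, rotated]) (simp add: minor_entries_K)
qed

text \<open>First-order form of the scalar equation: the second row of \<open>A_mat\<close> makes
  the second component the delayed first one. Compared with \<open>the_inv_shift_eq\<close> the
  right-hand side changes sign, which accounts for the minus sign in \<open>K_op\<close> and its
  absence in \<open>T_op\<close>.\<close>

lemma the_inv_vec_shift_eq:
  assumes "x \<in> l2" "\<And>m. x (m + 1) + lam * x m - x (m - 1) = f m"
  shows "the_inv_into l2 (\<lambda>v m. shift_adj v m - A_mat lam *v v m) (\<lambda>m. vector [f m, 0] :: complex^2)
    = (\<lambda>m. vector [x m, x (m - 1)])"
proof (rule the_inv_into_f_eq)
  have A: "A_mat lam *v v = vector [- lam * v $ 1 + v $ 2, v $ 1]" for v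
    by (simp add: vec_eq_iff forall_2 matrix_vector_mult_def sum_2 A_mat_def)
  show "inj_on (\<lambda>v m. shift_adj v m - A_mat lam *v v m) (l2 :: (int \<Rightarrow> complex^2) set)"
  proof (rule inj_onI)
    fix v w :: "int \<Rightarrow> complex^2" assume *: "v \<in> l2" "w \<in> l2"
      "(\<lambda>m. shift_adj v m - A_mat lam *v v m) = (\<lambda>m. shift_adj w m - A_mat lam *v w m)"
    define d where "d m = v m - w m" for m
    have "d (m + 1) = A_mat lam *v d m" for m
      using fun_cong[OF *(3), of m] by (simp add: d_def shift_adj_def matrix_vector_mult_diff_distrib algebra_simps)
    then have d: "d (m + 1) $ 1 = - lam * d m $ 1 + d m $ 2" "d (m + 1) $ 2 = d m $ 1" for m
      by (simp_all add: A)
    have d2: "d m $ 2 = d (m - 1) $ 1" for m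
      using d(2)[of "m - 1"] by simp
    have "rec_sol (\<lambda>_. lam) (\<lambda>m. d m $ 1)"
      unfolding rec_sol_def d(1) d2 by simp
    moreover have "(\<lambda>m. d m $ 1) \<in> l2"
      using l2_diff[OF *(1,2)] unfolding d_def[symmetric] l2_vec2_iff by simp
    ultimately have "(\<lambda>m. d m $ 1) = (\<lambda>_. 0)" by (rule free_l2_zero)
    then have "d m $ 1 = 0" for m by meson
    then have "d m = 0" for m by (simp add: vec_eq_iff forall_2 d2)
    then show "v = w" by (auto simp: d_def)
  qed
  show "(\<lambda>m. shift_adj (\<lambda>m. vector [x m, x (m - 1)]) m - A_mat lam *v vector [x m, x (m - 1)]) =
      (\<lambda>m. vector [f m, 0])"
    by (rule ext) (simp add: A vec_eq_iff forall_2 shift_adj_def flip: assms(2))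
  show "(\<lambda>m. vector [x m, x (m - 1)] :: complex^2) \<in> l2"
    using assms(1) l2_shift[OF assms(1), of "- 1"] by (simp add: l2_vec2_iff)
qed

lemma entries2_T:
  "entries2 (T_op \<rho> lam) i j =
     (if snd i = 1 \<and> snd j = 1 then entries (K_op \<rho> lam) (fst i) (fst j) else 0)"
proof -
  define b where "b = (if snd j = 1 then b_seq \<rho> lam (fst j) else 0)"
  have B: "B_mat \<rho> lam m *v (if m = fst j then axis (snd j) 1 else 0) = vector [if m = fst j then b else 0, 0]" for m
    using exhaust_2[of "snd j"]
    by (auto simp: B_mat_def b_def Q_plus_def vec_eq_iff forall_2 matrix_vector_mult_def matrix_matrix_mult_def
        sum_2 axis_def mat_def)
  have "the_inv_into l2 (\<lambda>v m. shift_adj v m - A_mat lam *v v m) (\<lambda>m. vector [if m = fst j then b else 0, 0] :: complex^2)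
      = (\<lambda>m. vector [- b * green \<mu> (m - fst j), - b * green \<mu> (m - 1 - fst j)])"
  proof (rule the_inv_vec_shift_eq)
    show "(\<lambda>m. - b * green \<mu> (m - fst j)) \<in> l2"
      using l2_shift[OF green_l2[OF mu_props(2)], of "- fst j"]
      by (rule l2_comparison[where C = "norm b"]) (simp add: norm_mult)
  next
    fix m
    have "green \<mu> (m - fst j - 1) - green \<mu> (m - fst j + 1) - lam * green \<mu> (m - fst j) = (if m = fst j then 1 else 0)"
      using green_eq[OF right.one_plus_mu_square mu_props(1,3), of "m - fst j"] by simp
    then have "b * (green \<mu> (m - fst j - 1) - green \<mu> (m - fst j + 1) - lam * green \<mu> (m - fst j)) =
        (if m = fst j then b else 0)" by simp
    then show "- b * green \<mu> (m + 1 - fst j) + lam * (- b * green \<mu> (m - fst j)) - - b * green \<mu> (m - 1 - fst j)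
        = (if m = fst j then b else 0)"
      by (simp add: algebra_simps)
  qed
  moreover have "(C_mat \<rho> n *v v) $ r = (if r = 1 then c_seq \<rho> n * v $ 1 else 0)" for n v r
    using exhaust_2[of r]
    by (auto simp: C_mat_def Q_plus_def matrix_vector_mult_def matrix_matrix_mult_def sum_2 mat_def)
  ultimately show ?thesis
    unfolding entries2_def T_op_def B by (simp add: entries_K b_def)
qed

theorem det_I_minus_T_eq: "det_I_minus_T \<rho> lam = F_fun \<rho> lam"
  unfolding det_I_minus_T_def
proof (rule fredholm_det_I_minus_has_sum)
  let ?e = "\<lambda>i::int. (i, 1::2)"
  let ?f = "\<lambda>F. (- 1) ^ card F * principal_minor (entries2 (T_op \<rho> lam)) F"
  have inj: "inj ?e" by (simp add: inj_def)
  have "(?f has_sum F_fun \<rho> lam) ((\<lambda>F. ?e ` F) ` {F. finite F})"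
  proof (subst has_sum_reindex)
    show "inj_on ((`) ?e) {F. finite F}"
      using inj by (simp add: inj_on_def inj_image_eq_iff)
    have "?f (?e ` F) = right.minor_weight F" if "finite F" for F
    proof -
      have "card (?e ` F) = card F" using inj by (intro card_image) (auto intro: inj_on_subset)
      moreover have "principal_minor (entries2 (T_op \<rho> lam)) (?e ` F) = principal_minor (entries (K_op \<rho> lam)) F"
        using inj that by (subst principal_minor_image) (auto intro: inj_on_subset simp: entries2_T)
      ultimately show ?thesis using minor_entries_K[OF that] by simp
    qed
    then show "(?f \<circ> (`) ?e has_sum F_fun \<rho> lam) {F. finite F}"
      by (intro has_sum_cong[THEN iffD2, OF _ minor_weight_has_sum]) simp
  qed
  then show "(?f has_sum F_fun \<rho> lam) {F. finite F}"
  proof (rule has_sum_cong_neutral[THEN iffD1, rotated 3])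
    \<comment> \<open>An index set containing a second component has a zero row; all others are
      copies of sets of integers.\<close>
    fix F :: "(int \<times> 2) set" assume F: "F \<in> {F. finite F} - (`) ?e ` {F. finite F}"
    have "\<exists>i\<in>F. snd i \<noteq> 1"
    proof (rule ccontr)
      assume *: "\<not> (\<exists>i\<in>F. snd i \<noteq> 1)"
      then have "F = ?e ` (fst ` F)" by force
      then show False using F by blast
    qed
    then obtain i where "i \<in> F" "snd i \<noteq> 1" by blast
    then have "principal_minor (entries2 (T_op \<rho> lam)) F = 0"
      using F by (subst principal_minor_row_zero[of _ i]) (auto simp: entries2_T)
    then show "?f F = 0" by simp
  qed auto
qed

end

section \<open>Matrix solutions and Riesz projections\<close>

lemma matrix_inv_eqI:
  fixes A B :: "complex^2^2"
  assumes "A ** B = mat 1"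
  shows "matrix_inv A = B"
proof -
  have BA: "B ** A = mat 1" using assms by (simp add: matrix_left_right_inverse)
  show ?thesis
    unfolding matrix_inv_def
  proof (rule some_equality)
    show "A ** B = mat 1 \<and> B ** A = mat 1" using assms BA by simp
  next
    fix C assume C: "A ** C = mat 1 \<and> C ** A = mat 1"
    have "C = (B ** A) ** C" by (simp add: BA)
    also have "\<dots> = B" using C by (simp flip: matrix_mul_assoc)
    finally show "C = B" .
  qed
qed

lemma matrix_mult_2:
  fixes A B :: "complex^2^2"
  shows "(A ** B) $ i $ j = A $ i $ 1 * B $ 1 $ j + A $ i $ 2 * B $ 2 $ j"
  by (simp add: matrix_matrix_mult_def sum_2)

lemma mat_mult_entry:
  fixes B :: "complex^2^2"
  shows "(mat c ** B) $ i $ j = c * B $ i $ j"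
  using exhaust_2[of i] by (auto simp: matrix_mult_2 mat_def)

lemma matrix_eq_2:
  fixes A B :: "complex^2^2"
  shows "A = B \<longleftrightarrow> A $ 1 $ 1 = B $ 1 $ 1 \<and> A $ 1 $ 2 = B $ 1 $ 2 \<and> A $ 2 $ 1 = B $ 2 $ 1 \<and> A $ 2 $ 2 = B $ 2 $ 2"
  by (auto simp: vec_eq_iff forall_2)

text \<open>This is \<open>(A_mat lam - w) / (z - w)\<close> when \<open>z\<close> and
  \<open>w\<close> are the two eigenvalues, with \<open>- lam - w\<close> simplified to
  \<open>z\<close>.\<close>

definition spectral_proj :: "complex \<Rightarrow> complex \<Rightarrow> complex^2^2" where
  "spectral_proj z w = vector [vector [z / (z - w), 1 / (z - w)], vector [1 / (z - w), - w / (z - w)]]"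

text \<open>The resolvent is the adjugate divided by \<open>(\<zeta> - w) * (\<zeta> - z)\<close>.
  The circle excludes \<open>w\<close>, so Cauchy's formula evaluates the holomorphic factor
  \<open>f\<close> at \<open>z\<close>.\<close>

lemma riesz_proj_A_mat:
  assumes "z \<noteq> w" "z + w = - lam" "z * w = - 1"
  shows "riesz_proj (A_mat lam) z (dist z w / 2) = spectral_proj z w"
proof -
  define r where "r = dist z w / 2"
  have lam: "lam = - (z + w)" using assms(2) by simp
  have r: "r > 0" using assms(1) by (simp add: r_def)
  define f :: "complex \<Rightarrow> complex^2^2" where
    "f \<zeta> = vector [vector [\<zeta> / (\<zeta> - w), 1 / (\<zeta> - w)], vector [1 / (\<zeta> - w), (\<zeta> + lam) / (\<zeta> - w)]]" for \<zeta>
  have w: "\<zeta> \<noteq> w" if "\<zeta> \<in> cball z r" for \<zeta>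
    using that r by (auto simp: r_def)
  have inv: "matrix_inv (mat \<zeta> - A_mat lam) $ i $ j = f \<zeta> $ i $ j / (\<zeta> - z)"
    if "\<zeta> \<in> path_image (circlepath z r)" for \<zeta> i j
  proof -
    have ne: "\<zeta> - z \<noteq> 0" "\<zeta> - w \<noteq> 0"
      using that r w[of \<zeta>] by (auto simp: sphere_def)
    define d where "d = inverse ((\<zeta> - w) * (\<zeta> - z))"
    have "\<zeta> * (\<zeta> + lam) - 1 = (\<zeta> - w) * (\<zeta> - z)"
    proof -
      have "\<zeta> * (\<zeta> + lam) - 1 = (\<zeta> - w) * (\<zeta> - z) - (z * w + 1)"
        unfolding lam by (simp add: algebra_simps)
      then show ?thesis using assms(3) by simp
    qed
    moreover have "(\<zeta> - w) * (\<zeta> - z) * d = 1"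
      unfolding d_def using ne by (intro right_inverse) simp
    ultimately have d: "(\<zeta> * (\<zeta> + lam) - 1) * d = 1"
      by (simp only:)
    have "(mat \<zeta> - A_mat lam) ** vector [vector [\<zeta> * d, d], vector [d, (\<zeta> + lam) * d]] = mat 1"
      using d by (simp add: matrix_eq_2 matrix_mult_2 mat_def A_mat_def algebra_simps)
    then have "matrix_inv (mat \<zeta> - A_mat lam) = vector [vector [\<zeta> * d, d], vector [d, (\<zeta> + lam) * d]]"
      by (rule matrix_inv_eqI)
    moreover have "vector [vector [\<zeta> * d, d], vector [d, (\<zeta> + lam) * d]] $ i $ j = f \<zeta> $ i $ j / (\<zeta> - z)"
      using exhaust_2[of i] exhaust_2[of j] by (auto simp: f_def d_def divide_inverse mult_ac)
    ultimately show ?thesis by simp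
  qed
  have "riesz_proj (A_mat lam) z r $ i $ j = f z $ i $ j" for i j
  proof -
    have "(\<lambda>\<zeta>. f \<zeta> $ i $ j) holomorphic_on cball z r"
      using exhaust_2[of i] exhaust_2[of j] w
      by (auto simp: f_def intro!: holomorphic_intros)
    then have "contour_integral (circlepath z r) (\<lambda>\<zeta>. f \<zeta> $ i $ j / (\<zeta> - z)) = 2 * pi * \<i> * f z $ i $ j"
      using contour_integral_unique[OF Cauchy_integral_circlepath_simple[OF _, of _ z r z]] r by simp
    moreover have "contour_integral (circlepath z r) (\<lambda>\<zeta>. matrix_inv (mat \<zeta> - A_mat lam) $ i $ j) =
        contour_integral (circlepath z r) (\<lambda>\<zeta>. f \<zeta> $ i $ j / (\<zeta> - z))"
      by (rule contour_integral_eq) (rule inv)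
    ultimately show ?thesis by (simp add: riesz_proj_def)
  qed
  moreover have "f z = spectral_proj z w"
  proof -
    have "z + lam = - w" by (simp add: lam)
    then show ?thesis by (simp add: f_def spectral_proj_def matrix_eq_2)
  qed
  ultimately show ?thesis by (simp add: vec_eq_iff r_def)
qed

lemma matrix_inv_A_mat: "matrix_inv (A_mat lam) = vector [vector [0, 1], vector [1, lam]]"
  by (rule matrix_inv_eqI) (simp add: matrix_eq_2 matrix_mult_2 mat_def A_mat_def)

text \<open>The columns of the projection are eigenvectors for \<open>z\<close>, on which the
  inverse matrix acts as \<open>inverse z\<close>.\<close>

lemma mat_powi_spectral_proj:
  assumes "z + w = - lam" "z * w = - 1"
  shows "mat_powi (A_mat lam) n ** spectral_proj z w = mat (z powi n) ** spectral_proj z w"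
proof -
  let ?P = "spectral_proj z w"
  have z0: "z \<noteq> 0" using assms(2) by auto
  have "lam = - (z + w)" using assms(1) by simp
  then have lam: "lam = - z - w" by simp
  have A: "A_mat lam ** ?P = mat z ** ?P"
  proof -
    define d where "d = inverse (z - w)"
    have "1 - lam * z = z * z" using assms(2) by (simp add: lam algebra_simps)
    moreover have "- lam * (z * d) + 1 * d = (1 - lam * z) * d" by (simp add: algebra_simps)
    ultimately have 1: "- lam * (z * d) + 1 * d = z * (z * d)" by simp
    have "- lam * d + 1 * (- w * d) = (- lam - w) * d" by (simp add: algebra_simps)
    also have "- lam - w = z" by (simp add: lam)
    finally have 2: "- lam * (1 * d) + 1 * (- w * d) = z * (1 * d)" by simp
    have 3: "1 * (1 * d) + 0 * (- w * d) = z * (- w * d)"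
      using assms(2) by (simp flip: mult.assoc)
    show ?thesis
      unfolding matrix_eq_2 mat_mult_entry matrix_mult_2[of "A_mat lam"]
      using 1 2 3 by (simp only: spectral_proj_def A_mat_def vector_2 divide_inverse d_def[symmetric]) simp
  qed
  have comm: "B ** (mat c ** C) = mat c ** (B ** C)" for B C :: "complex^2^2" and c
    by (simp add: matrix_eq_2 matrix_mult_2[of B] mat_mult_entry algebra_simps)
  have mm: "mat c ** (mat d ** C) = mat (c * d) ** C" for C :: "complex^2^2" and c d
    by (simp add: matrix_eq_2 mat_mult_entry)
  have A': "matrix_inv (A_mat lam) ** ?P = mat (inverse z) ** ?P"
  proof -
    have "A_mat lam ** matrix_inv (A_mat lam) = mat 1"
      unfolding matrix_inv_A_mat by (simp add: matrix_eq_2 matrix_mult_2 mat_def A_mat_def)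
    then have inv: "matrix_inv (A_mat lam) ** A_mat lam = mat 1"
      by (simp add: matrix_left_right_inverse)
    have "?P = matrix_inv (A_mat lam) ** (A_mat lam ** ?P)"
      by (simp add: matrix_mul_assoc inv)
    also have "\<dots> = mat z ** (matrix_inv (A_mat lam) ** ?P)"
      unfolding A comm ..
    finally have "mat (inverse z) ** ?P = mat (inverse z) ** (mat z ** (matrix_inv (A_mat lam) ** ?P))"
      by (rule arg_cong)
    then show ?thesis unfolding mm using z0 by simp
  qed
  have iter: "(((**) B) ^^ k) (mat 1) ** ?P = mat (c ^ k) ** ?P" if "B ** ?P = mat c ** ?P" for B c k
  proof (induction k)
    case (Suc k)
    have "(((**) B) ^^ Suc k) (mat 1) ** ?P = B ** ((((**) B) ^^ k) (mat 1) ** ?P)"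
      by (simp add: matrix_mul_assoc)
    then show ?case unfolding Suc comm[of B] that mm by (simp add: mult.commute)
  qed simp
  show ?thesis
    using iter[OF A, of "nat n"] iter[OF A', of "nat (- n)"]
    by (simp add: mat_powi_def power_int_def)
qed

lemma matrix_tendsto_0_iff:
  fixes M :: "'x \<Rightarrow> complex^2^2"
  shows "((\<lambda>n. norm (M n)) \<longlongrightarrow> 0) G \<longleftrightarrow> (\<forall>i j. ((\<lambda>n. M n $ i $ j) \<longlongrightarrow> 0) G)"
proof
  assume "((\<lambda>n. norm (M n)) \<longlongrightarrow> 0) G"
  then have "(M \<longlongrightarrow> 0) G" by (simp add: tendsto_norm_zero_iff)
  then show "\<forall>i j. ((\<lambda>n. M n $ i $ j) \<longlongrightarrow> 0) G"
    using tendsto_vec_nth[OF tendsto_vec_nth[of M 0 G]] by simp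
next
  assume "\<forall>i j. ((\<lambda>n. M n $ i $ j) \<longlongrightarrow> 0) G"
  then have "(M \<longlongrightarrow> 0) G" by (intro vec_tendstoI) simp
  then show "((\<lambda>n. norm (M n)) \<longlongrightarrow> 0) G" by (simp add: tendsto_norm_zero_iff)
qed

text \<open>The columns of a matrix solution are \<open>(z\<^sub>n, z\<^sub>n\<^sub>-\<^sub>1)\<close> for solutions \<open>z\<close> of the scalar recurrence,
  and the prescribed asymptotics make both of them multiples of the Jost solution \<open>Z\<close>.\<close>

lemma the_matrix_solution:
  assumes zw: "z \<noteq> w" "z + w = - lam" "z * w = - 1"
    and Z: "rec_sol (\<lambda>n. lam / of_real (\<rho> n)) Z" "((\<lambda>n. z powi (- n) * Z n) \<longlongrightarrow> 1) G"
    and unique: "\<And>u l. rec_sol (\<lambda>n. lam / of_real (\<rho> n)) u \<Longrightarrow> ((\<lambda>n. z powi (- n) * u n) \<longlongrightarrow> l) G \<Longrightarrow> u = (\<lambda>n. l * Z n)"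
    and shift: "filterlim (\<lambda>n. n - 1) G G"
  defines "P \<equiv> spectral_proj z w"
  shows "(THE Y. (\<forall>n. Y (n + 1) = Ax_mat \<rho> lam n ** Y n) \<and>
     ((\<lambda>n. norm (mat (z powi (- n)) ** (Y n - mat_powi (A_mat lam) n ** P))) \<longlongrightarrow> 0) G \<and>
     Y 0 = Y 0 ** P) = (\<lambda>n. vector [Z n *s (P $ 1), Z (n - 1) *s (P $ 1)])"
    (is "(THE Y. ?sol Y \<and> ?asymp Y \<and> ?row Y) = ?Y")
proof -
  have z0: "z \<noteq> 0" using zw(3) by auto
  have asymp: "?asymp Y \<longleftrightarrow> (\<forall>i j. ((\<lambda>n. z powi (- n) * Y n $ i $ j) \<longlongrightarrow> P $ i $ j) G)" for Y
  proof -
    have "(mat (z powi (- n)) ** (Y n - mat_powi (A_mat lam) n ** P)) $ i $ j = z powi (- n) * Y n $ i $ j - P $ i $ j"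
      for n i j
      using z0 unfolding P_def mat_powi_spectral_proj[OF zw(2,3)] mat_mult_entry
      by (simp add: mat_mult_entry right_diff_distrib power_int_minus)
    then show ?thesis unfolding matrix_tendsto_0_iff by (simp add: LIM_zero_iff)
  qed
  have sol: "?sol Y \<longleftrightarrow> (\<forall>n j. Y (n + 1) $ 1 $ j = - (lam / of_real (\<rho> n)) * Y n $ 1 $ j + Y n $ 2 $ j
      \<and> Y (n + 1) $ 2 $ j = Y n $ 1 $ j)" for Y
    by (auto simp: matrix_eq_2 matrix_mult_2 Ax_mat_def forall_2)
  \<comment> \<open>\<open>P\<close> has rank one. The factor \<open>1 / z\<close> between its rows
    matches the delay of the second component of \<open>?Y\<close>.\<close>
  have P2: "P $ 2 $ j = P $ 1 $ j / z" for j
    using exhaust_2[of j] z0 zw by (auto simp: P_def spectral_proj_def field_simps)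
  show ?thesis
  proof (rule the_equality)
    have "((\<lambda>n. z powi (- (n - 1)) * Z (n - 1)) \<longlongrightarrow> 1) G"
      by (rule filterlim_compose[OF Z(2) shift])
    then have "((\<lambda>n. P $ 2 $ j * (z powi (- (n - 1)) * Z (n - 1))) \<longlongrightarrow> P $ 2 $ j * 1) G" for j
      by (intro tendsto_intros)
    moreover have prev: "P $ 2 $ j * (z powi (- (n - 1)) * u) = z powi (- n) * (u * P $ 1 $ j)" for n u j
      using z0 power_int_add[of z "- n" 1] by (simp add: P2)
    ultimately have "((\<lambda>n. z powi (- n) * (Z (n - 1) * P $ 1 $ j)) \<longlongrightarrow> P $ 2 $ j) G" for j
      unfolding prev by (simp only: mult_1_right)
    moreover have "((\<lambda>n. z powi (- n) * (Z n * P $ 1 $ j)) \<longlongrightarrow> P $ 1 $ j) G" for j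
      using tendsto_mult_right[OF Z(2), of "P $ 1 $ j"] by (simp add: mult_ac)
    ultimately have "?asymp ?Y"
      unfolding asymp by (simp add: forall_2)
    moreover have "?sol ?Y"
      by (rule iffD2[OF sol]) (simp add: rec_sol_forward[OF Z(1)] algebra_simps)
    moreover have "?row ?Y"
    proof -
      \<comment> \<open>Rank one and trace 1 make the first row of \<open>P\<close> invariant under
        \<open>P\<close>.\<close>
      have "P $ 1 $ 1 + P $ 2 $ 2 = 1"
        using zw(1) by (simp add: P_def spectral_proj_def flip: diff_divide_distrib)
      moreover have "P $ 1 $ 1 * P $ 1 $ j + P $ 1 $ 2 * P $ 2 $ j = (P $ 1 $ 1 + P $ 2 $ 2) * P $ 1 $ j" for j
        by (simp add: P2 algebra_simps)
      ultimately have "P $ 1 $ 1 * P $ 1 $ j + P $ 1 $ 2 * P $ 2 $ j = P $ 1 $ j" for j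
        by simp
      then have "x * P $ 1 $ 1 * P $ 1 $ j + x * P $ 1 $ 2 * P $ 2 $ j = x * P $ 1 $ j" for x j
        unfolding mult.assoc distrib_left[symmetric] by (rule arg_cong)
      then show ?thesis
        unfolding matrix_eq_2 matrix_mult_2 vector_2 vector_smult_component by metis
    qed
    ultimately show "?sol ?Y \<and> ?asymp ?Y \<and> ?row ?Y" by blast
  next
    fix Y assume Y: "?sol Y \<and> ?asymp Y \<and> ?row Y"
    have prev: "Y n $ 2 $ j = Y (n - 1) $ 1 $ j" for n j
      using Y[unfolded sol, THEN conjunct1, rule_format, of "n - 1" j] by simp
    have "Y (n + 1) $ 1 $ j = - (lam / of_real (\<rho> n)) * Y n $ 1 $ j + Y (n - 1) $ 1 $ j" for n j
      using Y[unfolded sol] prev by simp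
    then have "rec_sol (\<lambda>n. lam / of_real (\<rho> n)) (\<lambda>n. Y n $ 1 $ j)" for j
      by (simp add: rec_sol_def)
    then have "(\<lambda>n. Y n $ 1 $ j) = (\<lambda>n. P $ 1 $ j * Z n)" for j
      using Y unfolding asymp by (intro unique) auto
    then have "Y n $ 1 $ j = P $ 1 $ j * Z n" for n j
      by meson
    then show "Y = ?Y"
      by (intro ext) (simp add: matrix_eq_2 prev mult.commute)
  qed
qed

context euler_potential
begin

lemma mu_minus_props: "\<mu> \<noteq> mu_minus lam" "\<mu> + mu_minus lam = - lam" "\<mu> * mu_minus lam = - 1"
proof -
  show "\<mu> * mu_minus lam = - 1" using mu_props(1) by (simp add: mu_props(4))
  show "\<mu> + mu_minus lam = - lam"
    using arg_cong[OF mu_props(3), of uminus] by (simp add: mu_props(4))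
  show "\<mu> \<noteq> mu_minus lam"
  proof
    assume "\<mu> = mu_minus lam"
    then have "1 + \<mu>\<^sup>2 = 0" using \<open>\<mu> * mu_minus lam = - 1\<close> by (simp add: power2_eq_square)
    then show False using right.one_plus_mu_square by simp
  qed
qed

lemma Y_plus_eq: "Y_plus \<rho> lam =
    (\<lambda>n. vector [z_plus \<rho> lam n *s (spectral_proj \<mu> (mu_minus lam) $ 1),
                 z_plus \<rho> lam (n - 1) *s (spectral_proj \<mu> (mu_minus lam) $ 1)])"
  unfolding Y_plus_def P_plus_def riesz_proj_A_mat[OF mu_minus_props]
proof (rule the_matrix_solution[OF mu_minus_props])
  show "((\<lambda>n. \<mu> powi (- n) * z_plus \<rho> lam n) \<longlongrightarrow> 1) at_top"
    unfolding z_plus_eq by (rule right.jost_solution)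
  show "u = (\<lambda>n. l * z_plus \<rho> lam n)"
    if "rec_sol coef u" "((\<lambda>n. \<mu> powi (- n) * u n) \<longlongrightarrow> l) at_top" for u l
    unfolding z_plus_eq using that by (rule right.jost_multiple)
qed (rule z_plus_sol filterlim_pred_at_top)+

lemma Y_minus_eq: "Y_minus \<rho> lam =
    (\<lambda>n. vector [z_minus \<rho> lam n *s (spectral_proj (mu_minus lam) \<mu> $ 1),
                 z_minus \<rho> lam (n - 1) *s (spectral_proj (mu_minus lam) \<mu> $ 1)])"
proof -
  have mm: "mu_minus lam \<noteq> \<mu>" "mu_minus lam + \<mu> = - lam" "mu_minus lam * \<mu> = - 1"
    using mu_minus_props by (simp_all add: add.commute mult.commute)
  have P: "P_minus lam = spectral_proj (mu_minus lam) \<mu>"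
    unfolding P_minus_def dist_commute[of \<mu>] by (rule riesz_proj_A_mat[OF mm])
  show ?thesis
    unfolding Y_minus_def P
  proof (rule the_matrix_solution[OF mm])
    show "((\<lambda>n. mu_minus lam powi (- n) * z_minus \<rho> lam n) \<longlongrightarrow> 1) at_bot"
      unfolding filterlim_int_at_bot_iff minus_minus rescaled_reflect z_minus_eq reflect_reflect
      by (rule left.jost_solution)
    show "u = (\<lambda>n. l * z_minus \<rho> lam n)"
      if u: "rec_sol coef u" "((\<lambda>n. mu_minus lam powi (- n) * u n) \<longlongrightarrow> l) at_bot" for u l
    proof -
      have "reflect u = (\<lambda>n. l * (\<mu> powi n * left.jost_scaled n))"
        using rec_sol_reflect[OF u(1)] u(2)
        unfolding filterlim_int_at_bot_iff minus_minus rescaled_reflect by (rule left.jost_multiple)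
      then show ?thesis
        unfolding z_minus_eq by (metis reflect_cmult reflect_reflect)
    qed
  qed (rule z_minus_sol filterlim_pred_at_bot)+
qed

text \<open>\<open>Y_plus\<close> plus \<open>Y_minus\<close> at 0 is the matrix of values of the
  Jost solutions at 0 and -1 times the matrix of the first rows of the projections. The second
  factor has determinant \<open>1 / (w - z)\<close>, the prefactor of \<open>F_fun\<close>.\<close>

theorem E_fun_eq: "E_fun \<rho> lam = F_fun \<rho> lam"
proof -
  define z w where "z = \<mu>" and "w = mu_minus lam"
  define u v u' v' where "u = z_plus \<rho> lam 0" and "v = z_minus \<rho> lam 0"
    and "u' = z_plus \<rho> lam (- 1)" and "v' = z_minus \<rho> lam (- 1)"
  have zw: "z - w \<noteq> 0" "w - z \<noteq> 0" using mu_minus_props(1) by (auto simp: z_def w_def)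
  have "E_fun \<rho> lam = (u * z / (z - w) + v * w / (w - z)) * (u' / (z - w) + v' / (w - z))
      - (u / (z - w) + v / (w - z)) * (u' * z / (z - w) + v' * w / (w - z))"
    by (simp add: E_fun_def Y_plus_eq Y_minus_eq det_2 spectral_proj_def
        flip: z_def w_def u_def v_def u'_def v'_def)
  also have "\<dots> = (u * v' - u' * v) / (w - z)"
  proof -
    define d where "d = inverse (w - z)"
    have 1: "x / (w - z) = x * d" "x / (z - w) = - (x * d)" for x
      using minus_divide_right[of x "w - z"] by (simp_all add: d_def divide_inverse)
    have "(u * z / (z - w) + v * w / (w - z)) * (u' / (z - w) + v' / (w - z))
        - (u / (z - w) + v / (w - z)) * (u' * z / (z - w) + v' * w / (w - z))
      = (u * v' - u' * v) * d * ((w - z) * d)"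
      unfolding 1 by (simp add: algebra_simps)
    also have "(w - z) * d = 1" using zw by (simp add: d_def)
    finally show ?thesis by (simp add: 1)
  qed
  also have "\<dots> = F_fun \<rho> lam"
    by (simp add: F_fun_def wronskian_def divide_inverse mult_ac flip: z_def w_def u_def v_def u'_def v'_def)
  finally show ?thesis .
qed

end

section \<open>Continued fractions\<close>

definition flux :: "(int \<Rightarrow> complex) \<Rightarrow> int \<Rightarrow> real" where
  "flux z n = Re (cnj (z n) * z (n - 1))"

text \<open>Multiply the recurrence by \<open>cnj (z n)\<close> and take real parts; the term with
  \<open>z (n + 1)\<close> becomes the next flux because conjugation preserves real parts.\<close>

lemma flux_step:
  assumes "rec_sol a z"
  shows "flux z n - flux z (n + 1) = Re (a n) * (norm (z n))\<^sup>2"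
proof -
  have "cnj (z n) * z (n - 1) - cnj (z n) * z (n + 1) = a n * (z n * cnj (z n))"
    using assms by (simp add: rec_sol_backward algebra_simps)
  from arg_cong[OF this, of Re]
  have "Re (cnj (z n) * z (n - 1)) - Re (cnj (z n) * z (n + 1)) = Re (a n * of_real ((norm (z n))\<^sup>2))"
    by (simp only: minus_complex.sel complex_norm_square)
  moreover have "Re (cnj (z n) * z (n + 1)) = flux z (n + 1)"
    by (simp add: flux_def)
  moreover have "Re (a n * of_real r) = Re (a n) * r" for r by simp
  ultimately show ?thesis by (simp only: flux_def[of z n])
qed

lemma flux_le: "flux z n \<le> norm (z n) * norm (z (n - 1))"
  unfolding flux_def using complex_Re_le_cmod[of "cnj (z n) * z (n - 1)"] by (simp add: norm_mult)

text \<open>The lower bound starts at index 1 because the coefficient at 0 has the opposite sign in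
  the application.\<close>

locale dissipative_recurrence =
  fixes a :: "int \<Rightarrow> complex" and c :: real
  assumes c_pos: "c > 0" and Re_ge: "\<And>n. n \<ge> 1 \<Longrightarrow> Re (a n) \<ge> c"
begin

lemma flux_decreases:
  assumes "rec_sol a z" "n \<ge> 1"
  shows "c * (norm (z n))\<^sup>2 \<le> flux z n - flux z (n + 1)"
  unfolding flux_step[OF assms(1)] using Re_ge[OF assms(2)] by (intro mult_right_mono) auto

lemma flux_sum:
  assumes "rec_sol a z"
  shows "c * (\<Sum>k<M. (norm (z (int k + 1)))\<^sup>2) \<le> flux z 1 - flux z (int M + 1)"
proof (induction M)
  case (Suc M)
  then show ?case
    using flux_decreases[OF assms, of "int M + 1"] by (simp add: algebra_simps)
qed simp

lemma flux_antimono: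
  assumes "rec_sol a z" "1 \<le> m" "m \<le> n"
  shows "flux z n \<le> flux z m"
  using assms(3)
proof (induction n rule: int_ge_induct)
  case (step i)
  have "0 \<le> c * (norm (z i))\<^sup>2" using c_pos by simp
  then show ?case
    using step flux_decreases[OF assms(1), of i] assms(2) by linarith
qed simp

text \<open>Both a decaying solution and a solution vanishing at some point to the right have nonnegative
  flux on the way; all that follows uses only this.\<close>

lemma nonzero_if_flux_nonneg:
  assumes z: "rec_sol a z" "z m \<noteq> 0 \<or> z (m + 1) \<noteq> 0"
    and flux: "\<And>k. k \<in> {1..m + 1} \<Longrightarrow> flux z k \<ge> 0"
    and end_case: "z m = 0 \<Longrightarrow> flux z (m + 2) \<ge> 0"
    and n: "0 \<le> n" "n \<le> m"
  shows "z n \<noteq> 0"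
proof
  assume zn: "z n = 0"
  \<comment> \<open>A zero makes the next flux vanish; as the one after it is nonnegative, no
    dissipation is left and a second zero follows.\<close>
  then have "flux z (n + 1) = 0" by (simp add: flux_def)
  moreover have "flux z (n + 1 + 1) \<ge> 0"
    using flux[of "n + 2"] end_case zn n by (cases "n = m") (auto simp: add.assoc)
  ultimately have "c * (norm (z (n + 1)))\<^sup>2 \<le> 0"
    using flux_decreases[OF z(1), of "n + 1"] n by simp
  then have "z (n + 1) = 0" using c_pos by (simp add: mult_le_0_iff)
  then show False using rec_sol_zeroI[OF z(1) zn] z(2) by blast
qed

text \<open>Total dissipation is at most the initial flux, hence at most
  \<open>norm (z 1) * norm (z 0)\<close>. Since \<open>z 1\<close> itself occurs in the sum, this
  also gives \<open>c * norm (z 1) \<le> norm (z 0)\<close>, which removes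
  \<open>z 1\<close>.\<close>

lemma initial_bound:
  assumes z: "rec_sol a z" and flux: "flux z (int M + 2) \<ge> 0"
  shows "c\<^sup>2 * (\<Sum>k<Suc M. (norm (z (int k + 1)))\<^sup>2) \<le> (norm (z 0))\<^sup>2"
proof -
  let ?S = "\<Sum>k<Suc M. (norm (z (int k + 1)))\<^sup>2"
  have "c * ?S \<le> flux z 1"
    using flux_sum[OF z, of "Suc M"] flux by (simp add: add_ac)
  also have fl: "\<dots> \<le> norm (z 1) * norm (z 0)"
    using flux_le[of z 1] by simp
  finally have 1: "c * ?S \<le> norm (z 1) * norm (z 0)" .
  have "(norm (z 1))\<^sup>2 \<le> ?S"
    unfolding sum.lessThan_Suc_shift by (simp add: sum_nonneg)
  then have "c * (norm (z 1))\<^sup>2 \<le> c * ?S"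
    using c_pos by (intro mult_left_mono) auto
  with 1 have "norm (z 1) * (c * norm (z 1)) \<le> norm (z 1) * norm (z 0)"
    by (simp add: power2_eq_square mult_ac)
  then have 2: "c * norm (z 1) \<le> norm (z 0)"
    by (cases "z 1 = 0") auto
  have "c\<^sup>2 * ?S \<le> c * (norm (z 1) * norm (z 0))"
    using mult_left_mono[OF 1, of c] c_pos by (simp add: power2_eq_square mult.assoc)
  also have "\<dots> \<le> (norm (z 0))\<^sup>2"
    using mult_right_mono[OF 2, of "norm (z 0)"] by (simp add: power2_eq_square mult_ac)
  finally show ?thesis .
qed

text \<open>The flux decreases and its limit is 0.\<close>

lemma decaying_flux_nonneg:
  assumes z: "rec_sol a z" "(z \<longlongrightarrow> 0) at_top" and "n \<ge> 1"
  shows "flux z n \<ge> 0"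
proof -
  have lim: "(\<lambda>k. z (int k)) \<longlonglongrightarrow> 0" using z(2) by (simp add: filterlim_int_at_top_iff)
  have "(\<lambda>k. flux z (int (Suc k))) \<longlonglongrightarrow> Re (cnj 0 * 0)"
    unfolding flux_def by (intro tendsto_intros LIMSEQ_Suc[OF lim]) (simp add: lim)
  moreover have "\<forall>\<^sub>F k in sequentially. flux z (int (Suc k)) \<le> flux z n"
    using assms(3) by (intro eventually_sequentiallyI[of "nat n"] flux_antimono[OF z(1)]) auto
  ultimately show ?thesis
    by (intro tendsto_upperbound[of "\<lambda>k. flux z (int (Suc k))" 0 sequentially]) auto
qed

lemma decaying_nonzero:
  assumes "rec_sol a z" "(z \<longlongrightarrow> 0) at_top" "z \<noteq> (\<lambda>_. 0)" "n \<ge> 0"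
  shows "z n \<noteq> 0"
  using assms
  by (intro nonzero_if_flux_nonneg[of z n] decaying_flux_nonneg) (auto dest: rec_sol_zeroI)

end

text \<open>Dividing the recurrence by \<open>x (s + 1)\<close> exhibits the ratio as one level of
  the fraction; the zero at \<open>s + N + 1\<close> stops the expansion after exactly
  \<open>N\<close> levels.\<close>

lemma cf_approx_eq_ratio:
  assumes "rec_sol a x" "x (s + int N + 1) = 0" "\<And>k. s < k \<Longrightarrow> k \<le> s + int N \<Longrightarrow> x k \<noteq> 0"
  shows "cf_approx (\<lambda>k. a (s + int k + 1)) N = x (s + 1) / x s"
  using assms(2,3)
proof (induction N arbitrary: s)
  case (Suc N)
  have "cf_approx (\<lambda>k. a (s + 1 + int k + 1)) N = x (s + 1 + 1) / x (s + 1)"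
    using Suc.prems by (intro Suc.IH) (auto simp: add_ac)
  moreover have "(\<lambda>k. a (s + int (Suc k) + 1)) = (\<lambda>k. a (s + 1 + int k + 1))"
    by (simp add: add_ac)
  ultimately have "cf_approx (\<lambda>k. a (s + int k + 1)) (Suc N) = 1 / (a (s + 1) + x (s + 1 + 1) / x (s + 1))"
    by (simp only: cf_approx.simps) simp
  also have "\<dots> = x (s + 1) / (a (s + 1) * x (s + 1) + x (s + 1 + 1))"
    using Suc.prems(2)[of "s + 1"] by (simp add: add_divide_eq_iff)
  also have "\<dots> = x (s + 1) / x s"
    using rec_sol_backward[OF assms(1), of "s + 1"] by simp
  finally show ?case .
qed simp

context dissipative_recurrence
begin

text \<open>The approximant of order \<open>N\<close> is the ratio for the solution \<open>x\<close> vanishing at \<open>N + 1\<close>;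
  by constancy of the Wronskian its distance from \<open>z 1 / z 0\<close> is \<open>|x N z (N + 1)| / |x 0 z 0|\<close>.\<close>

lemma cf_approx_tendsto:
  assumes z: "rec_sol a z" "(z \<longlongrightarrow> 0) at_top" "z \<noteq> (\<lambda>_. 0)"
  shows "cf_approx (\<lambda>k. a (int k + 1)) \<longlonglongrightarrow> z 1 / z 0"
proof -
  have z0: "z 0 \<noteq> 0" using decaying_nonzero[OF z] by simp
  have bound: "norm (cf_approx (\<lambda>k. a (int k + 1)) (Suc M) - z 1 / z 0) \<le> norm (z (int M + 2)) * (1 / (c * norm (z 0)))"
    for M
  proof -
    \<comment> \<open>With order \<open>N = M + 1\<close>, these values reduce the Wronskian at
      \<open>M + 2\<close> to the single term \<open>z (M + 2)\<close>, up to sign.\<close>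
    obtain x where x: "rec_sol a x" "x (int M + 1) = 1" "x (int M + 1 + 1) = 0"
      using rec_sol_exists by blast
    have f0: "flux x (int M + 2) = 0" using x(3) by (simp add: flux_def add_ac)
    have fl: "flux x k \<ge> 0" if "k \<in> {1..int M + 1 + 1}" for k
      using flux_antimono[OF x(1), of k "int M + 2"] f0 that by simp
    have nz: "x k \<noteq> 0" if "0 \<le> k" "k \<le> int M + 1" for k
      by (rule nonzero_if_flux_nonneg[of x "int M + 1"]) (use x fl that in auto)
    have "cf_approx (\<lambda>k. a (0 + int k + 1)) (Suc M) = x (0 + 1) / x 0"
      using x nz by (intro cf_approx_eq_ratio) (auto simp: add_ac)
    then have cf: "cf_approx (\<lambda>k. a (int k + 1)) (Suc M) = x 1 / x 0" by simp
    have "x 0 * z 1 - x 1 * z 0 = wronskian x z 1"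
      by (simp add: wronskian_def)
    also have "\<dots> = wronskian x z (int M + 2)" by (rule wronskian_constant[OF x(1) z(1)])
    also have "\<dots> = (- 1) powi (int M + 1) * z (int M + 2)"
      using x(2,3) by (simp add: wronskian_def add_ac)
    finally have W: "norm (x 0 * z 1 - x 1 * z 0) = norm (z (int M + 2))"
      by (simp add: norm_mult)
    have "c\<^sup>2 * (\<Sum>k<Suc M. (norm (x (int k + 1)))\<^sup>2) \<le> (norm (x 0))\<^sup>2"
      using f0 by (intro initial_bound x) simp
    \<comment> \<open>The normalized value at \<open>M + 1\<close> is one of the summands, so
      \<open>norm (x 0)\<close> is bounded below by \<open>c\<close> for every
      \<open>M\<close>.\<close>
    moreover have "1 \<le> (\<Sum>k<Suc M. (norm (x (int k + 1)))\<^sup>2)"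
      using x(2) by (simp add: sum_nonneg)
    then have "c\<^sup>2 * 1 \<le> c\<^sup>2 * (\<Sum>k<Suc M. (norm (x (int k + 1)))\<^sup>2)"
      by (intro mult_left_mono) auto
    ultimately have "c\<^sup>2 \<le> (norm (x 0))\<^sup>2" by simp
    then have cx: "c \<le> norm (x 0)" by (rule power2_le_imp_le) simp
    have x0: "x 0 \<noteq> 0" using nz[of 0] by simp
    have "x 1 / x 0 - z 1 / z 0 = - ((x 0 * z 1 - x 1 * z 0) / (x 0 * z 0))"
      using x0 z0 by (simp add: field_simps)
    then have "norm (x 1 / x 0 - z 1 / z 0) = norm (z (int M + 2)) / (norm (x 0) * norm (z 0))"
      by (simp add: norm_divide norm_mult W)
    also have "\<dots> \<le> norm (z (int M + 2)) / (c * norm (z 0))"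
      using cx c_pos z0 by (intro divide_left_mono mult_right_mono mult_pos_pos) auto
    finally show ?thesis unfolding cf by simp
  qed
  have "(\<lambda>k. z (int k)) \<longlonglongrightarrow> 0" using z(2) by (simp add: filterlim_int_at_top_iff)
  from LIMSEQ_ignore_initial_segment[OF this, of 2]
  have "(\<lambda>M. norm (z (int M + 2)) * (1 / (c * norm (z 0)))) \<longlonglongrightarrow> 0 * (1 / (c * norm (z 0)))"
    by (intro tendsto_mult tendsto_const) (simp add: tendsto_norm_zero_iff add_ac)
  then have "(\<lambda>M. cf_approx (\<lambda>k. a (int k + 1)) (Suc M) - z 1 / z 0) \<longlonglongrightarrow> 0"
    by (intro Lim_null_comparison[OF always_eventually[OF allI[OF bound]]]) simp
  then have "(\<lambda>M. cf_approx (\<lambda>k. a (int k + 1)) (Suc M)) \<longlonglongrightarrow> z 1 / z 0"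
    by (simp add: LIM_zero_iff)
  then show ?thesis by (rule LIMSEQ_imp_Suc)
qed

end

context euler_potential
begin

lemma Re_coef_ge: "n \<noteq> 0 \<Longrightarrow> Re (coef n) \<ge> Re lam"
proof -
  assume "n \<noteq> 0"
  then have "1 \<le> 1 / \<rho> n" using rho_pos[of n] rho_le_1[of n] by simp
  then have "Re lam * 1 \<le> Re lam * (1 / \<rho> n)" using Re_lam by (intro mult_left_mono) auto
  then show ?thesis by (simp add: Re_divide_of_real)
qed

sublocale right_diss: dissipative_recurrence coef "Re lam"
  by unfold_locales (use Re_lam Re_coef_ge in auto)

sublocale left_diss: dissipative_recurrence "\<lambda>n. coef (- n)" "Re lam"
  by unfold_locales (use Re_lam Re_coef_ge in auto)

lemma z_plus_decays: "(z_plus \<rho> lam \<longlongrightarrow> 0) at_top"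
  unfolding z_plus_eq by (rule right.tendsto_rescaled_imp_tendsto_0[OF right.jost_solution(2)])

lemma reflect_z_minus: "reflect (z_minus \<rho> lam) = (\<lambda>n. \<mu> powi n * left.jost_scaled n)"
  by (simp add: z_minus_eq)

lemma z_minus_decays: "(reflect (z_minus \<rho> lam) \<longlongrightarrow> 0) at_top"
  unfolding reflect_z_minus by (rule left.tendsto_rescaled_imp_tendsto_0[OF left.jost_solution(2)])

lemma z_plus_nonzero: "z_plus \<rho> lam \<noteq> (\<lambda>_. 0)"
proof
  assume 0: "z_plus \<rho> lam = (\<lambda>_. 0)"
  have "((\<lambda>n. \<mu> powi (- n) * z_plus \<rho> lam n) \<longlongrightarrow> 1) at_top"
    unfolding z_plus_eq by (rule right.jost_solution)
  then show False unfolding 0 by (simp add: tendsto_const_iff)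
qed

lemma z_minus_nonzero: "reflect (z_minus \<rho> lam) \<noteq> (\<lambda>_. 0)"
proof
  assume 0: "reflect (z_minus \<rho> lam) = (\<lambda>_. 0)"
  have "((\<lambda>n. \<mu> powi (- n) * reflect (z_minus \<rho> lam) n) \<longlongrightarrow> 1) at_top"
    unfolding reflect_z_minus by (rule left.jost_solution)
  then show False unfolding 0 by (simp add: tendsto_const_iff)
qed

lemmas reflect_z_minus_sol = rec_sol_reflect[OF z_minus_sol]

lemma z_0_nonzero: "z_plus \<rho> lam 0 \<noteq> 0" "z_minus \<rho> lam 0 \<noteq> 0"
  using right_diss.decaying_nonzero[OF z_plus_sol z_plus_decays z_plus_nonzero, of 0]
    left_diss.decaying_nonzero[OF reflect_z_minus_sol z_minus_decays z_minus_nonzero, of 0]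
  by (simp_all add: reflect_def)

lemma g_plus_eq: "g_plus \<rho> lam = z_plus \<rho> lam 1 / z_plus \<rho> lam 0"
  unfolding g_plus_def cont_frac_def
  by (intro limI right_diss.cf_approx_tendsto z_plus_sol z_plus_decays z_plus_nonzero)

lemma g_minus_ratio: "g_minus \<rho> lam = reflect (z_minus \<rho> lam) 1 / reflect (z_minus \<rho> lam) 0"
  unfolding g_minus_def cont_frac_def
  by (intro limI left_diss.cf_approx_tendsto reflect_z_minus_sol z_minus_decays z_minus_nonzero)

lemma g_minus_eq: "g_minus \<rho> lam = - (z_minus \<rho> lam (- 1) / z_minus \<rho> lam 0)"
  by (simp add: g_minus_ratio reflect_def)

text \<open>The recurrence at 0 replaces \<open>z_plus 1\<close> by the value at -1; clearing the
  nonzero denominators turns the bracket into the Wronskian.\<close>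

theorem G_fun_eq: "G_fun \<rho> lam = F_fun \<rho> lam"
proof -
  define u v u' v' u1 where "u = z_plus \<rho> lam 0" and "v = z_minus \<rho> lam 0"
    and "u' = z_plus \<rho> lam (- 1)" and "v' = z_minus \<rho> lam (- 1)" and "u1 = z_plus \<rho> lam 1"
  have nz: "u \<noteq> 0" "v \<noteq> 0" using z_0_nonzero by (simp_all add: u_def v_def)
  have "u' - u1 = coef 0 * u"
    using z_plus_sol[unfolded rec_sol_def, rule_format, of 0] by (simp add: u_def u'_def u1_def)
  then have "u' = coef 0 * u + u1" by (simp add: algebra_simps)
  then have "u * v * (coef 0 + u1 / u - v' / v) = u' * v - v' * u"
    using nz by (simp add: field_simps)
  moreover have "G_fun \<rho> lam = inverse (\<mu> - mu_minus lam) * (u * v * (coef 0 + u1 / u - v' / v))"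
    by (simp add: G_fun_def g_plus_eq g_minus_eq flip: u_def v_def u'_def v'_def u1_def)
  moreover have "F_fun \<rho> lam = inverse (mu_minus lam - \<mu>) * (u * v' - u' * v)"
    by (simp add: F_fun_def wronskian_def flip: u_def v_def u'_def v'_def)
  moreover have "inverse (mu_minus lam - \<mu>) = - inverse (\<mu> - mu_minus lam)"
    by (metis inverse_minus_eq minus_diff_eq)
  ultimately show ?thesis by (simp only:) (simp add: algebra_simps)
qed

end

section \<open>Eigenvalues\<close>

context jost
begin

lemma jost_scaled_bounded_nat: "\<exists>K. \<forall>n. norm (jost_scaled (int n)) \<le> K"
proof -
  have "(\<lambda>n. jost_scaled (int n)) \<longlonglongrightarrow> 1"
    using jost_scaled_tendsto_1 by (simp add: filterlim_int_at_top_iff)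
  then have "Bseq (\<lambda>n. jost_scaled (int n))" by (intro convergent_imp_Bseq convergentI)
  then show ?thesis by (auto simp: Bseq_def)
qed

text \<open>The conjugate solves the same recurrence with the same normalization.\<close>

lemma jost_scaled_real:
  assumes "\<And>n. cnj (a n) = a n" "cnj \<mu> = \<mu>"
  shows "cnj (jost_scaled n) = jost_scaled n"
proof -
  let ?z = "\<lambda>n. \<mu> powi n * cnj (jost_scaled n)"
  have "rec_sol a (\<lambda>n. cnj (\<mu> powi n * jost_scaled n))"
    using jost_solution(1) assms(1) unfolding rec_sol_def
    by (metis complex_cnj_diff complex_cnj_mult)
  then have "rec_sol a ?z" by (simp add: assms(2))
  moreover have "((\<lambda>n. \<mu> powi (- n) * ?z n) \<longlongrightarrow> 1) at_top"
    using tendsto_cnj[OF jost_scaled_tendsto_1] by simp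
  ultimately have "?z = (\<lambda>n. 1 * (\<mu> powi n * jost_scaled n))" by (rule jost_multiple)
  from fun_cong[OF this, of n] show ?thesis using mu_nonzero by simp
qed

end

context euler_potential
begin

lemma l2_solution_imp_F_zero:
  assumes z: "rec_sol coef z" "z \<in> l2" "z \<noteq> (\<lambda>_. 0)"
  shows "F_fun \<rho> lam = 0"
proof -
  obtain c where c: "z = (\<lambda>n. c * z_plus \<rho> lam n)"
    using right.decaying_multiple_of_jost[OF z(1) l2_tendsto_at_top[OF z(2)]]
    unfolding z_plus_eq by blast
  have "(reflect z \<longlongrightarrow> 0) at_top"
    using z(2) by (intro l2_tendsto_at_top) (simp add: l2_reflect_iff)
  then obtain d where "reflect z = (\<lambda>n. d * reflect (z_minus \<rho> lam) n)"
    using left.decaying_multiple_of_jost[OF rec_sol_reflect[OF z(1)]]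
    unfolding reflect_z_minus by blast
  then have "reflect (reflect z) = reflect (\<lambda>n. d * reflect (z_minus \<rho> lam) n)" by simp
  also have "\<dots> = (\<lambda>n. d * reflect (reflect (z_minus \<rho> lam)) n)"
    by (rule reflect_cmult)
  finally have d: "z n = d * z_minus \<rho> lam n" for n by simp
  have "c \<noteq> 0" "d \<noteq> 0" using z(3) c d by auto
  moreover have "c * z_plus \<rho> lam n = d * z_minus \<rho> lam n" for n
    using c d by metis
  ultimately have "z_minus \<rho> lam n = c / d * z_plus \<rho> lam n" for n
    by (simp add: field_simps)
  then have "wronskian (z_plus \<rho> lam) (z_minus \<rho> lam) 0 = 0"
    by (simp add: wronskian_def)
  then show ?thesis by (simp add: F_fun_def)
qed

text \<open>Proportional Jost solutions inherit exponential decay at both ends.\<close>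

lemma F_zero_imp_l2_solution:
  assumes "F_fun \<rho> lam = 0"
  shows "z_plus \<rho> lam \<in> l2"
proof -
  have "wronskian (z_plus \<rho> lam) (z_minus \<rho> lam) 0 = 0"
    using assms mu_minus_props(1) by (simp add: F_fun_def)
  then obtain c where c: "z_minus \<rho> lam = (\<lambda>n. c * z_plus \<rho> lam n)"
    using wronskian_eq_0_imp_multiple[OF z_plus_sol z_minus_sol _ z_plus_nonzero] by blast
  have c0: "c \<noteq> 0" using c z_0_nonzero by auto
  obtain K where K: "norm (h (int n)) \<le> K" for n using right.jost_scaled_bounded_nat by blast
  obtain K' where K': "norm (left.jost_scaled (int n)) \<le> K'" for n using left.jost_scaled_bounded_nat by blast
  have "norm (z_plus \<rho> lam (int n)) \<le> K * norm \<mu> ^ n" for n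
    using mult_right_mono[OF K[of n], of "norm \<mu> ^ n"]
    by (simp add: z_plus_eq norm_mult norm_power mult.commute)
  moreover have "norm (z_plus \<rho> lam (- int n)) \<le> K' / norm c * norm \<mu> ^ n" for n
  proof -
    have "c * z_plus \<rho> lam (- int n) = reflect (\<lambda>n. \<mu> powi n * left.jost_scaled n) (- int n)"
      using c z_minus_eq by metis
    then have "norm c * norm (z_plus \<rho> lam (- int n)) = norm \<mu> ^ n * norm (left.jost_scaled (int n))"
      by (simp add: reflect_def norm_mult norm_power flip: norm_mult[of c])
    also have "\<dots> \<le> norm \<mu> ^ n * K'" by (intro mult_left_mono K') simp
    finally show ?thesis using c0 by (simp add: field_simps)
  qed
  moreover have "K * norm \<mu> ^ n \<le> max K (K' / norm c) * norm \<mu> ^ n"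
    "K' / norm c * norm \<mu> ^ n \<le> max K (K' / norm c) * norm \<mu> ^ n" for n
    by (intro mult_right_mono; simp)+
  ultimately have "norm (z_plus \<rho> lam (int n)) \<le> max K (K' / norm c) * norm \<mu> ^ n"
    "norm (z_plus \<rho> lam (- int n)) \<le> max K (K' / norm c) * norm \<mu> ^ n" for n
    by (meson order_trans)+
  then show ?thesis
    using mu_props(2) by (intro l2_exponential_decay[of "norm \<mu>" _ "max K (K' / norm c)"]) auto
qed

text \<open>Allows division by \<open>\<rho>\<close> inside \<open>l2\<close>. The bound does not
  involve \<open>lam\<close>, which later makes it a uniform constant.\<close>

lemma inverse_rho_bound: "\<bar>1 / \<rho> n\<bar> \<le> 1 + (\<Sum>\<^sub>\<infinity>n. \<bar>1 / \<rho> n - 1\<bar>)"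
proof -
  have "\<bar>1 / \<rho> n - 1\<bar> \<le> (\<Sum>\<^sub>\<infinity>n. \<bar>1 / \<rho> n - 1\<bar>)"
    using finite_sum_le_infsum[OF inverse_rho_summable, of "{n}"] by simp
  then show ?thesis by linarith
qed

lemma eigenvalue_iff_F_zero:
  "l2_eigenvalue (\<lambda>w n. of_real (\<rho> (n - 1)) * w (n - 1) - of_real (\<rho> (n + 1)) * w (n + 1)) lam
    \<longleftrightarrow> F_fun \<rho> lam = 0"
    (is "l2_eigenvalue ?L lam \<longleftrightarrow> _")
proof
  assume "l2_eigenvalue ?L lam"
  then obtain w where w: "w \<in> l2" "w \<noteq> (\<lambda>_. 0)" "?L w = (\<lambda>n. lam * w n)"
    by (auto simp: l2_eigenvalue_def l2_dom_def)
  define z where "z n = of_real (\<rho> n) * w n" for n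
  have "rec_sol coef z"
    using fun_cong[OF w(3)] rho_nonzero by (simp add: rec_sol_def z_def)
  moreover have "z \<in> l2"
    using w(1)
  proof (rule l2_comparison)
    show "norm (z n) \<le> (1 + \<bar>\<rho> 0\<bar>) * norm (w n)" for n
      using rho_le_1[of n] rho_pos[of n]
      by (cases "n = 0") (auto simp: z_def norm_mult intro!: mult_right_mono)
  qed
  moreover have "z \<noteq> (\<lambda>_. 0)"
    using w(2) rho_nonzero by (auto simp: z_def fun_eq_iff)
  ultimately show "F_fun \<rho> lam = 0" by (rule l2_solution_imp_F_zero)
next
  assume F: "F_fun \<rho> lam = 0"
  define w where "w n = z_plus \<rho> lam n / of_real (\<rho> n)" for n
  have eig: "?L w = (\<lambda>n. lam * w n)"
    using z_plus_sol rho_nonzero by (auto simp: rec_sol_def w_def)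
  have w: "w \<in> l2"
    using F_zero_imp_l2_solution[OF F]
  proof (rule l2_comparison)
    fix n
    have "norm (w n) = \<bar>1 / \<rho> n\<bar> * norm (z_plus \<rho> lam n)" by (simp add: w_def norm_divide)
    also have "\<dots> \<le> (1 + (\<Sum>\<^sub>\<infinity>n. \<bar>1 / \<rho> n - 1\<bar>)) * norm (z_plus \<rho> lam n)"
      by (intro mult_right_mono inverse_rho_bound) simp
    finally show "norm (w n) \<le> (1 + (\<Sum>\<^sub>\<infinity>n. \<bar>1 / \<rho> n - 1\<bar>)) * norm (z_plus \<rho> lam n)" .
  qed
  moreover have "(\<lambda>n. lam * w n) \<in> l2"
    using w by (rule l2_comparison[where C = "norm lam"]) (simp add: norm_mult)
  moreover have "w \<noteq> (\<lambda>_. 0)"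
    using z_0_nonzero(1) rho_nonzero[of 0] by (auto simp: w_def fun_eq_iff)
  ultimately show "l2_eigenvalue ?L lam"
    using eig unfolding l2_eigenvalue_def l2_dom_def by (intro bexI[of _ w]) auto
qed

lemma real_solutions:
  assumes "lam = of_real t"
  shows "cnj (z_plus \<rho> lam n) = z_plus \<rho> lam n"
    "cnj (reflect (z_minus \<rho> lam) n) = reflect (z_minus \<rho> lam) n"
proof -
  \<comment> \<open>The conjugate of \<open>\<mu>\<close> meets the conditions that determine
    \<open>\<mu>\<close>.\<close>
  have "lam = inverse (cnj \<mu>) - cnj \<mu>"
    using arg_cong[OF mu_props(3), of cnj] assms by simp
  then have mu: "cnj \<mu> = \<mu>"
    using mu_plus_minus_eqI[of "cnj \<mu>" lam] mu_props(1,2) by simp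
  have a: "cnj (coef n) = coef n" for n by (simp add: assms)
  show "cnj (z_plus \<rho> lam n) = z_plus \<rho> lam n"
    unfolding z_plus_eq by (simp add: mu right.jost_scaled_real[OF a mu])
  show "cnj (reflect (z_minus \<rho> lam) n) = reflect (z_minus \<rho> lam) n"
    unfolding reflect_z_minus by (simp add: mu left.jost_scaled_real[OF a mu])
qed

end

section \<open>Quantitative bounds on the continued fractions\<close>

context dissipative_recurrence
begin

text \<open>For a real solution the flux is the product of neighbouring values, so strict positivity
  of the flux means positive ratios. The relation between \<open>r k\<close> and
  \<open>r (Suc k)\<close> unrolls the continued fraction.\<close>

lemma real_ratios:
  assumes z: "rec_sol a z" "(z \<longlongrightarrow> 0) at_top" "z \<noteq> (\<lambda>_. 0)"
    and real: "\<And>n. cnj (z n) = z n" "\<And>n. a n = of_real (s n)"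
  obtains r :: "nat \<Rightarrow> real" where "\<And>k. r k > 0" "\<And>k. r k * (s (int k + 1) + r (Suc k)) = 1"
    "z 1 / z 0 = of_real (r 0)"
proof -
  have nz: "z n \<noteq> 0" if "n \<ge> 0" for n using decaying_nonzero[OF z that] .
  define y where "y n = Re (z n)" for n
  have zy: "z n = of_real (y n)" for n
    using real(1)[of n] by (simp add: y_def complex_eq_iff)
  define r where "r k = y (int k + 1) / y (int k)" for k
  have ynz: "y (int k) \<noteq> 0" for k using nz[of "int k"] by (simp add: zy)
  show thesis
  proof
    show "r k > 0" for k
    proof -
      have "0 < c * (norm (z (int k + 1)))\<^sup>2"
        using c_pos nz[of "int k + 1"] by simp
      also have "\<dots> \<le> flux z (int k + 1)"
        using flux_decreases[OF z(1), of "int k + 1"] decaying_flux_nonneg[OF z(1,2), of "int k + 1 + 1"] by simp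
      also have "\<dots> = y (int k + 1) * y (int k)" by (simp add: flux_def zy)
      finally show ?thesis by (simp add: r_def zero_less_mult_iff zero_less_divide_iff)
    qed
    show "r k * (s (int k + 1) + r (Suc k)) = 1" for k
    proof -
      have "complex_of_real (y (int k)) = of_real (s (int k + 1) * y (int k + 1) + y (int k + 2))"
        using rec_sol_backward[OF z(1), of "int k + 1"] by (simp add: zy real(2) add_ac)
      then have "y (int k) = s (int k + 1) * y (int k + 1) + y (int k + 2)"
        by (simp only: of_real_eq_iff)
      moreover have "y (int k) \<noteq> 0" "y (int k + 1) \<noteq> 0"
        using ynz[of k] ynz[of "Suc k"] by (simp_all add: add_ac)
      moreover have "u / v * (x + w / u) = (x * u + w) / v" if "u \<noteq> 0" for u v w x :: real
        using that by (simp add: distrib_left add_divide_distrib)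
      moreover have "r k * (s (int k + 1) + r (Suc k)) =
          y (int k + 1) / y (int k) * (s (int k + 1) + y (int k + 2) / y (int k + 1))"
        by (simp add: r_def add_ac)
      ultimately show ?thesis by (metis divide_self)
    qed
    show "z 1 / z 0 = of_real (r 0)" by (simp add: r_def zy)
  qed
qed

end

text \<open>The infimum \<open>m\<close> of the ratios satisfies \<open>m B (t + m) \<ge> 1\<close>, which keeps it away from \<open>0\<close>
  uniformly as \<open>t\<close> tends to \<open>0\<close>.\<close>

lemma ratio_lower_bound:
  fixes r b :: "nat \<Rightarrow> real"
  assumes pos: "\<And>k. r k > 0" and rec: "\<And>k. r k * (t * b k + r (Suc k)) = 1"
    and b: "\<And>k. 1 \<le> b k" "\<And>k. b k \<le> B" and t: "0 < t" "t \<le> 1"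
  shows "r 0 \<ge> 1 / (2 * B)"
proof -
  define m where "m = Inf (range r)"
  have bdd: "bdd_below (range r)" using pos by (intro bdd_belowI2[of _ 0]) (simp add: less_imp_le)
  have m_le: "m \<le> r k" for k unfolding m_def by (intro cInf_lower bdd) simp
  have m_ge: "m \<ge> 0" unfolding m_def using pos by (intro cInf_greatest) (auto simp: less_imp_le)
  have B: "B \<ge> 1" using b[of 0] by simp
  have "r k * (t * B * (t + m) + 1) \<ge> t + m" for k
  proof -
    \<comment> \<open>An upper bound on the next ratio, put into the relation for
      \<open>r k\<close>, becomes a lower bound on \<open>r k\<close>; the infimum over
      \<open>k\<close> then gives an inequality in \<open>m\<close> alone.\<close>
    have "r (Suc k) * (t + m) \<le> r (Suc k) * (t * b (Suc k) + r (Suc (Suc k)))"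
      using pos b(1)[of "Suc k"] m_le t by (intro mult_left_mono add_mono) (auto simp: less_imp_le)
    then have 1: "r (Suc k) * (t + m) \<le> 1" by (simp add: rec)
    have "1 \<le> r k * (t * B + r (Suc k))"
      unfolding rec[of k, symmetric] using pos b(2)[of k] t
      by (intro mult_left_mono add_mono) (auto simp: less_imp_le)
    then have "t + m \<le> (t + m) * (r k * (t * B + r (Suc k)))"
      using t m_ge by simp
    also have "\<dots> = r k * (t * B * (t + m) + r (Suc k) * (t + m))"
      by (simp add: algebra_simps)
    also have "\<dots> \<le> r k * (t * B * (t + m) + 1)"
      using pos[of k] 1 by (intro mult_left_mono) (auto simp: less_imp_le)
    finally show ?thesis .
  qed
  moreover have D: "t * B * (t + m) + 1 > 0" using t B m_ge by (simp add: add_pos_nonneg add_nonneg_pos)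
  ultimately have "(t + m) / (t * B * (t + m) + 1) \<le> r k" for k
    by (simp add: pos_divide_le_eq)
  then have "(t + m) / (t * B * (t + m) + 1) \<le> m"
    unfolding m_def by (intro cInf_greatest) auto
  then have "t + m \<le> m * (t * B * (t + m) + 1)"
    using D by (simp add: pos_divide_le_eq)
  then have "t * 1 \<le> t * (m * B * (t + m))" by (simp add: algebra_simps)
  then have key: "1 \<le> m * B * (t + m)" using t by simp
  have "m \<ge> 1 / (2 * B)"
  proof (rule ccontr)
    assume "\<not> ?thesis"
    \<comment> \<open>Then \<open>m < 1 / 2\<close> as well, and with \<open>t \<le> 1\<close> the
      product in \<open>key\<close> is at most 3/4.\<close>
    then have "m * B < 1 / 2" using B by (simp add: field_simps)
    moreover have "m * 1 \<le> m * B" using B m_ge by (intro mult_left_mono) auto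
    ultimately have "m * B * (t + m) \<le> 1 / 2 * (1 + 1 / 2)"
      using t m_ge B by (intro mult_mono) auto
    then show False using key by simp
  qed
  then show ?thesis using m_le[of 0] by simp
qed

text \<open>Green's identity: the Wronskian of the two decaying solutions is the alternating sum of
  \<open>(a n - a' n) z n z' n\<close>, which \<open>initial_bound\<close> and Cauchy--Schwarz control.\<close>

lemma ratio_difference_bound:
  assumes d: "dissipative_recurrence a c" "dissipative_recurrence a' c'"
    and z: "rec_sol a z" "(z \<longlongrightarrow> 0) at_top" "z \<noteq> (\<lambda>_. 0)"
    and z': "rec_sol a' z'" "(z' \<longlongrightarrow> 0) at_top" "z' \<noteq> (\<lambda>_. 0)"
    and le: "\<And>n. n \<ge> 1 \<Longrightarrow> norm (a n - a' n) \<le> D"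
  shows "norm (z 1 / z 0 - z' 1 / z' 0) \<le> D / (c * c')"
proof -
  interpret A: dissipative_recurrence a c by fact
  interpret A': dissipative_recurrence a' c' by fact
  have nz: "z 0 \<noteq> 0" "z' 0 \<noteq> 0"
    using A.decaying_nonzero[OF z] A'.decaying_nonzero[OF z'] by auto
  have D: "D \<ge> 0" using le[of 1] norm_ge_zero order_trans by blast
  define P where "P = norm (z 0) * norm (z' 0) / (c * c')"
  have sum: "(\<Sum>k<M. norm (z (int k + 1)) * norm (z' (int k + 1))) \<le> P" for M
  proof (cases M)
    case 0
    then show ?thesis using A.c_pos A'.c_pos by (simp add: P_def)
  next
    case (Suc N)
    let ?S = "\<Sum>k<M. norm (z (int k + 1)) * norm (z' (int k + 1))"
    have "?S\<^sup>2 \<le> (\<Sum>k<M. (norm (z (int k + 1)))\<^sup>2) * (\<Sum>k<M. (norm (z' (int k + 1)))\<^sup>2)"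
      by (rule Cauchy_Schwarz_ineq_sum)
    moreover have "c\<^sup>2 * (\<Sum>k<M. (norm (z (int k + 1)))\<^sup>2) \<le> (norm (z 0))\<^sup>2"
      unfolding Suc using A.decaying_flux_nonneg[OF z(1,2)] by (intro A.initial_bound z) simp
    moreover have "c'\<^sup>2 * (\<Sum>k<M. (norm (z' (int k + 1)))\<^sup>2) \<le> (norm (z' 0))\<^sup>2"
      unfolding Suc using A'.decaying_flux_nonneg[OF z'(1,2)] by (intro A'.initial_bound z') simp
    ultimately have "(c\<^sup>2 * c'\<^sup>2) * ?S\<^sup>2 \<le> (norm (z 0))\<^sup>2 * (norm (z' 0))\<^sup>2"
    proof -
      assume 1: "?S\<^sup>2 \<le> (\<Sum>k<M. (norm (z (int k + 1)))\<^sup>2) * (\<Sum>k<M. (norm (z' (int k + 1)))\<^sup>2)"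
        and 2: "c\<^sup>2 * (\<Sum>k<M. (norm (z (int k + 1)))\<^sup>2) \<le> (norm (z 0))\<^sup>2"
        and 3: "c'\<^sup>2 * (\<Sum>k<M. (norm (z' (int k + 1)))\<^sup>2) \<le> (norm (z' 0))\<^sup>2"
      have "(c\<^sup>2 * c'\<^sup>2) * ?S\<^sup>2 \<le> (c\<^sup>2 * (\<Sum>k<M. (norm (z (int k + 1)))\<^sup>2)) * (c'\<^sup>2 * (\<Sum>k<M. (norm (z' (int k + 1)))\<^sup>2))"
        using mult_left_mono[OF 1, of "c\<^sup>2 * c'\<^sup>2"] by (simp add: mult_ac)
      also have "\<dots> \<le> (norm (z 0))\<^sup>2 * (norm (z' 0))\<^sup>2"
        using 2 3 by (intro mult_mono) (auto simp: sum_nonneg)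
      finally show ?thesis .
    qed
    then have "(c * c' * ?S)\<^sup>2 \<le> (norm (z 0) * norm (z' 0))\<^sup>2"
      by (simp add: power_mult_distrib)
    then have "c * c' * ?S \<le> norm (z 0) * norm (z' 0)"
      by (rule power2_le_imp_le) simp
    then show ?thesis
      using A.c_pos A'.c_pos by (simp add: P_def field_simps)
  qed
  have "norm (wronskian z z' 1) \<le> norm (wronskian z z' (int M + 1)) + D * P" for M
  proof -
    have "norm (wronskian z z' 1) \<le> norm (wronskian z z' (int M + 1)) +
        D * (\<Sum>k<M. norm (z (int k + 1)) * norm (z' (int k + 1)))"
    proof (induction M)
      case (Suc M)
      have "norm (wronskian z z' (int M + 1)) \<le> norm (wronskian z z' (int M + 1 + 1)) +
          norm ((- 1) powi (int M + 1) * (a (int M + 1) - a' (int M + 1)) * z (int M + 1) * z' (int M + 1))"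
        unfolding wronskian_step[OF z(1) z'(1), of "int M + 1"] by (metis norm_triangle_ineq4 add_diff_cancel_right')
      also have "\<dots> \<le> norm (wronskian z z' (int M + 1 + 1)) + D * (norm (z (int M + 1)) * norm (z' (int M + 1)))"
        using le[of "int M + 1"] by (simp add: norm_mult mult.assoc mult_right_mono)
      finally show ?case using Suc by (simp add: distrib_left add_ac)
    qed simp
    then show ?thesis using mult_left_mono[OF sum[of M] D] by linarith
  qed
  \<comment> \<open>The two recurrences differ, so this Wronskian varies; it still tends to 0
    because both solutions decay.\<close>
  moreover have "(\<lambda>M. norm (wronskian z z' (int M + 1)) + D * P) \<longlonglongrightarrow> 0 + D * P"
  proof (intro tendsto_intros)
    have lim: "(\<lambda>k. z (int k)) \<longlonglongrightarrow> 0" "(\<lambda>k. z' (int k)) \<longlonglongrightarrow> 0"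
      using z(2) z'(2) by (simp_all add: filterlim_int_at_top_iff)
    note lim' = LIMSEQ_Suc[OF lim(1)] LIMSEQ_Suc[OF lim(2)]
    have "(\<lambda>M. norm (z (int M) * z' (int (Suc M)) - z (int (Suc M)) * z' (int M))) \<longlonglongrightarrow> norm (0 * 0 - 0 * 0 :: complex)"
      by (intro tendsto_norm tendsto_diff tendsto_mult lim lim')
    then show "(\<lambda>M. norm (wronskian z z' (int M + 1))) \<longlonglongrightarrow> 0"
      by (simp add: wronskian_def norm_mult norm_power add_ac)
  qed
  ultimately have "norm (wronskian z z' 1) \<le> D * P"
    by (intro LIMSEQ_le_const[of "\<lambda>M. norm (wronskian z z' (int M + 1)) + D * P"]) auto
  moreover have "z 1 / z 0 - z' 1 / z' 0 = - (wronskian z z' 1 / (z 0 * z' 0))"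
    using nz by (simp add: wronskian_def field_simps)
  then have "norm (z 1 / z 0 - z' 1 / z' 0) = norm (wronskian z z' 1) / (norm (z 0) * norm (z' 0))"
    by (simp add: norm_divide norm_mult)
  ultimately have "norm (z 1 / z 0 - z' 1 / z' 0) \<le> D * P / (norm (z 0) * norm (z' 0))"
    by (simp add: divide_right_mono)
  also have "\<dots> = D / (c * c')" using nz by (simp add: P_def)
  finally show ?thesis .
qed

section \<open>Existence of a positive zero\<close>

text \<open>\<open>B\<close> is the same for all \<open>t\<close>: the lower bound persists as
  \<open>t\<close> tends to 0, and the upper bound forces decay for large \<open>t\<close>.\<close>

lemma (in dissipative_recurrence) real_ratio_bounds:
  assumes z: "rec_sol a z" "(z \<longlongrightarrow> 0) at_top" "z \<noteq> (\<lambda>_. 0)" "\<And>n. cnj (z n) = z n"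
    and a: "\<And>n. a n = of_real (t * b n)" and t: "0 < t"
    and b: "\<And>n. n \<ge> 1 \<Longrightarrow> 1 \<le> b n" "\<And>n. n \<ge> 1 \<Longrightarrow> b n \<le> B"
  obtains x where "z 1 / z 0 = of_real x" "0 < x" "t * x \<le> 1" "t \<le> 1 \<Longrightarrow> 1 / (2 * B) \<le> x"
proof -
  obtain r :: "nat \<Rightarrow> real" where r: "\<And>k. r k > 0" "\<And>k. r k * (t * b (int k + 1) + r (Suc k)) = 1"
    "z 1 / z 0 = of_real (r 0)"
    using real_ratios[OF z a] by blast
  have "t * r 0 \<le> r 0 * (t * b (int 0 + 1) + r (Suc 0))"
  proof -
    have "t * 1 \<le> t * b 1" using t b(1)[of 1] by (intro mult_left_mono) auto
    then have "t \<le> t * b (int 0 + 1) + r (Suc 0)" using r(1)[of "Suc 0"] by simp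
    from mult_left_mono[OF this, of "r 0"] r(1)[of 0] show ?thesis by (simp add: mult.commute)
  qed
  then have "t * r 0 \<le> 1" unfolding r(2) .
  moreover have "1 / (2 * B) \<le> r 0" if "t \<le> 1"
    using ratio_lower_bound[of r t "\<lambda>k. b (int k + 1)" B] r b t that by simp
  ultimately show thesis using that[of "r 0"] r by blast
qed

lemma positive_zero_exists:
  assumes pot: "\<And>lam. Re lam > 0 \<Longrightarrow> euler_potential \<rho> lam" and neg: "\<rho> 0 < 0"
  obtains t where "t > 0" "F_fun \<rho> (of_real t) = 0"
proof -
  define B where "B = 1 + (\<Sum>\<^sub>\<infinity>n. \<bar>1 / \<rho> n - 1\<bar>)"
  have pot': "euler_potential \<rho> (of_real t)" if "t > 0" for t
    using pot[of "of_real t"] that by simp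
  \<comment> \<open>Facts about \<open>\<rho>\<close> alone are read off at an arbitrary admissible
    parameter.\<close>
  interpret one: euler_potential \<rho> "of_real 1" by (rule pot') simp
  have b: "1 \<le> 1 / \<rho> n" "1 / \<rho> n \<le> B" if "n \<noteq> 0" for n
    using one.rho_pos[OF that] one.rho_le_1[of n] one.inverse_rho_bound[of n] by (auto simp: B_def)
  have B: "B \<ge> 1" using b[of 1] by simp
  define gp where "gp t = Re (g_plus \<rho> (of_real t))" for t
  define gm where "gm t = Re (g_minus \<rho> (of_real t))" for t
  have gp: "g_plus \<rho> (of_real t) = of_real (gp t)" "0 < gp t" "t * gp t \<le> 1" "t \<le> 1 \<Longrightarrow> 1 / (2 * B) \<le> gp t"
    if "t > 0" for t
  proof -
    interpret euler_potential \<rho> "of_real t" by (rule pot') fact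
    obtain x where x: "g_plus \<rho> (of_real t) = of_real x" "0 < x" "t * x \<le> 1" "t \<le> 1 \<Longrightarrow> 1 / (2 * B) \<le> x"
      unfolding g_plus_eq
      by (rule right_diss.real_ratio_bounds[OF z_plus_sol z_plus_decays z_plus_nonzero real_solutions(1)[OF refl],
            of t "\<lambda>n. 1 / \<rho> n" B]) (use b \<open>t > 0\<close> in auto)
    then have "x = gp t" by (simp add: gp_def)
    with x show "g_plus \<rho> (of_real t) = of_real (gp t)" "0 < gp t" "t * gp t \<le> 1" "t \<le> 1 \<Longrightarrow> 1 / (2 * B) \<le> gp t"
      by auto
  qed
  have gm: "g_minus \<rho> (of_real t) = of_real (gm t)" "0 < gm t" "t * gm t \<le> 1" "t \<le> 1 \<Longrightarrow> 1 / (2 * B) \<le> gm t"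
    if "t > 0" for t
  proof -
    interpret euler_potential \<rho> "of_real t" by (rule pot') fact
    obtain x where x: "g_minus \<rho> (of_real t) = of_real x" "0 < x" "t * x \<le> 1" "t \<le> 1 \<Longrightarrow> 1 / (2 * B) \<le> x"
      unfolding g_minus_ratio
      by (rule left_diss.real_ratio_bounds[OF reflect_z_minus_sol z_minus_decays z_minus_nonzero real_solutions(2)[OF refl],
            of t "\<lambda>n. 1 / \<rho> (- n)" B]) (use b \<open>t > 0\<close> in auto)
    then have "x = gm t" by (simp add: gm_def)
    with x show "g_minus \<rho> (of_real t) = of_real (gm t)" "0 < gm t" "t * gm t \<le> 1" "t \<le> 1 \<Longrightarrow> 1 / (2 * B) \<le> gm t"
      by auto
  qed
  have diff: "\<bar>gp s - gp t\<bar> \<le> \<bar>s - t\<bar> * B / (s * t)" "\<bar>gm s - gm t\<bar> \<le> \<bar>s - t\<bar> * B / (s * t)"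
    if "s > 0" "t > 0" for s t
  proof -
    interpret S: euler_potential \<rho> "of_real s" by (rule pot') fact
    interpret T: euler_potential \<rho> "of_real t" by (rule pot') fact
    \<comment> \<open>The coefficients at \<open>s\<close> and \<open>t\<close> differ by
      \<open>(s - t) / \<rho> n\<close>, and their dissipation constants are \<open>s\<close> and
      \<open>t\<close>.\<close>
    have le: "norm (complex_of_real s / of_real (\<rho> n) - of_real t / of_real (\<rho> n)) \<le> \<bar>s - t\<bar> * B" if "n \<noteq> 0" for n
    proof -
      have "complex_of_real s / of_real (\<rho> n) - of_real t / of_real (\<rho> n) = of_real ((s - t) * (1 / \<rho> n))"
        by (simp add: diff_divide_distrib)
      also have "norm \<dots> = \<bar>s - t\<bar> * (1 / \<rho> n)"
        using b(1)[OF that] by (simp only: norm_of_real abs_mult)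
      also have "\<dots> \<le> \<bar>s - t\<bar> * B" using b(2)[OF that] by (intro mult_left_mono) auto
      finally show ?thesis .
    qed
    have "norm (g_plus \<rho> (of_real s) - g_plus \<rho> (of_real t)) \<le> \<bar>s - t\<bar> * B / (Re (of_real s) * Re (of_real t))"
      unfolding S.g_plus_eq T.g_plus_eq
      by (rule ratio_difference_bound[OF S.right_diss.dissipative_recurrence_axioms T.right_diss.dissipative_recurrence_axioms
            S.z_plus_sol S.z_plus_decays S.z_plus_nonzero T.z_plus_sol T.z_plus_decays T.z_plus_nonzero]) (simp add: le)
    then show "\<bar>gp s - gp t\<bar> \<le> \<bar>s - t\<bar> * B / (s * t)"
      using gp(1)[OF \<open>s > 0\<close>] gp(1)[OF \<open>t > 0\<close>] by (simp flip: of_real_diff)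
    have "norm (g_minus \<rho> (of_real s) - g_minus \<rho> (of_real t)) \<le> \<bar>s - t\<bar> * B / (Re (of_real s) * Re (of_real t))"
      unfolding S.g_minus_ratio T.g_minus_ratio
      by (rule ratio_difference_bound[OF S.left_diss.dissipative_recurrence_axioms T.left_diss.dissipative_recurrence_axioms
            S.reflect_z_minus_sol S.z_minus_decays S.z_minus_nonzero T.reflect_z_minus_sol T.z_minus_decays T.z_minus_nonzero])
         (simp add: le)
    then show "\<bar>gm s - gm t\<bar> \<le> \<bar>s - t\<bar> * B / (s * t)"
      using gm(1)[OF \<open>s > 0\<close>] gm(1)[OF \<open>t > 0\<close>] by (simp flip: of_real_diff)
  qed
  define R where "R = - \<rho> 0"
  have R: "R > 0" using neg by (simp add: R_def)
  \<comment> \<open>At \<open>t0\<close> the negative term has modulus at most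
    \<open>1 / (2 * B)\<close>, the lower bound of either fraction. At \<open>t1\<close> one has
    \<open>2 * R \<le> t1 * t1\<close>, so \<open>2 / t1\<close>, which bounds both fractions
    together, is at most \<open>t1 / R\<close>.\<close>
  define t0 where "t0 = min 1 (R / (2 * B))"
  define t1 where "t1 = 1 + 2 * R"
  have t0: "0 < t0" "t0 \<le> 1" "t0 \<le> R / (2 * B)" using R B by (auto simp: t0_def)
  have t01: "t0 \<le> t1" using t0 R by (simp add: t1_def)
  have lip: "continuous_on {t0..t1} g"
    if g: "\<And>s t. s > 0 \<Longrightarrow> t > 0 \<Longrightarrow> \<bar>g s - g t\<bar> \<le> \<bar>s - t\<bar> * B / (s * t)" for g :: "real \<Rightarrow> real"
  proof (rule lipschitz_on_continuous_on[OF lipschitz_onI])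
    fix s t assume st: "s \<in> {t0..t1}" "t \<in> {t0..t1}"
    then have "\<bar>g s - g t\<bar> \<le> \<bar>s - t\<bar> * B / (s * t)" using t0 by (intro g) auto
    also have "\<dots> \<le> \<bar>s - t\<bar> * B / (t0 * t0)"
      using st t0 B by (intro divide_left_mono mult_mono) auto
    finally show "dist (g s) (g t) \<le> B / (t0 * t0) * dist s t"
      by (simp add: dist_real_def mult.commute)
  qed (use B in auto)
  define f where "f t = t / \<rho> 0 + gp t + gm t" for t
  have "continuous_on {t0..t1} f"
    unfolding f_def using neg by (intro continuous_intros lip diff) auto
  moreover have "0 \<le> f t0"
  proof -
    have "t0 / R \<le> 1 / (2 * B)" using t0(3) R B by (simp add: field_simps)
    moreover have "0 \<le> 1 / (2 * B)" using B by simp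
    moreover have "t0 / \<rho> 0 = - (t0 / R)" by (simp add: R_def)
    ultimately show ?thesis
      using gp(4)[OF t0(1,2)] gm(4)[OF t0(1,2)] unfolding f_def by linarith
  qed
  moreover have "f t1 \<le> 0"
  proof -
    have t1: "t1 > 0" using R by (simp add: t1_def)
    have "2 * R \<le> t1 * t1" using R by (simp add: t1_def algebra_simps)
    then have "1 / t1 + 1 / t1 \<le> t1 / R" using t1 R by (simp add: field_simps)
    moreover have "gp t1 \<le> 1 / t1" "gm t1 \<le> 1 / t1"
      using gp(3)[OF t1] gm(3)[OF t1] t1 by (simp_all add: field_simps)
    moreover have "t1 / \<rho> 0 = - (t1 / R)" by (simp add: R_def)
    ultimately show ?thesis by (simp add: f_def)
  qed
  ultimately obtain t where t: "t0 \<le> t" "f t = 0"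
    using IVT2'[of f t1 0 t0] t01 by blast
  have tpos: "t > 0" using t(1) t0(1) by simp
  interpret T: euler_potential \<rho> "of_real t" by (rule pot') fact
  have "complex_of_real t / of_real (\<rho> 0) + g_plus \<rho> (of_real t) + g_minus \<rho> (of_real t) = of_real (f t)"
    by (simp add: gp(1)[OF tpos] gm(1)[OF tpos] f_def)
  then have "G_fun \<rho> (of_real t) = 0"
    by (simp add: G_fun_def t(2))
  then show thesis using that[OF tpos] T.G_fun_eq by simp
qed

section \<open>Geometry of the lattice line through \<open>q\<close>\<close>

lemma vec2_eq_0_iff: "vec2 p = 0 \<longleftrightarrow> p = 0"
  by (cases p) (auto simp: vec2_def zero_prod_def)

lemma norm_vec2_square: "(norm (vec2 p))\<^sup>2 = of_int (fst p * fst p + snd p * snd p)"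
  by (simp add: vec2_def norm_Pair power2_eq_square)

lemma vec2_add_iscale: "vec2 (q + iscale n p) = vec2 q + of_int n *\<^sub>R vec2 p"
  by (simp add: vec2_def iscale_def)

context
  fixes p q :: "int \<times> int"
  assumes p: "p \<noteq> 0" and q_small: "norm (vec2 q) < norm (vec2 p)"
    and large: "\<And>n::int. n \<noteq> 0 \<Longrightarrow> norm (vec2 (q + iscale n p)) > norm (vec2 p)"
begin

lemma norm_p_pos: "norm (vec2 p) > 0"
  using p by (simp add: vec2_eq_0_iff)

text \<open>The zero vector could occur only at \<open>n = 0\<close>, but \<open>q = 0\<close> would
  give \<open>q + p\<close> the same norm as \<open>p\<close>. Hence neither the exceptional branch
  of \<open>\<beta>\<close> nor division by 0 in \<open>rho\<close> arises on this line.\<close>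

lemma lattice_line_nonzero: "q + iscale n p \<noteq> 0"
proof
  assume 0: "q + iscale n p = 0"
  then have "n = 0" using large[of n] norm_p_pos by (metis norm_zero not_less_iff_gr_or_eq vec2_eq_0_iff)
  then have "q = 0" using 0 by (simp add: iscale_def zero_prod_def[symmetric])
  then show False using large[of 1] by (simp add: iscale_def)
qed

text \<open>Comparing \<open>q + p\<close> and \<open>q - p\<close> with \<open>p\<close> makes the
  inner product smaller in modulus than the squared norm of \<open>q\<close>. Parallel vectors would
  have equality in Cauchy-Schwarz, which is impossible as \<open>q\<close> is shorter than
  \<open>p\<close>.\<close>

lemma wedge_nonzero: "wedge q p \<noteq> 0"
proof
  assume "wedge q p = 0"
  obtain a b c d where pq: "p = (a, b)" "q = (c, d)" by (cases p, cases q)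
  define x where "x = a * c + b * d"
  define P where "P = a * a + b * b"
  define Q where "Q = c * c + d * d"
  have sq: "(norm (vec2 p))\<^sup>2 = of_int P" "(norm (vec2 q))\<^sup>2 = of_int Q"
    unfolding norm_vec2_square by (simp_all add: pq P_def Q_def)
  have plus: "(norm (vec2 (q + iscale 1 p)))\<^sup>2 = of_int (Q + 2 * x + P)"
    and minus: "(norm (vec2 (q + iscale (- 1) p)))\<^sup>2 = of_int (Q - 2 * x + P)"
    unfolding norm_vec2_square by (simp_all add: pq iscale_def P_def Q_def x_def algebra_simps)
  have "P < Q + 2 * x + P" "P < Q - 2 * x + P"
    using power_strict_mono[OF large[of 1], of 2] power_strict_mono[OF large[of "- 1"], of 2]
    unfolding plus minus sq by (simp_all only: of_int_less_iff) auto
  then have x: "\<bar>x\<bar> < Q" by linarith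
  have "Q < P"
    using power_strict_mono[OF q_small, of 2] unfolding sq by simp
  have "x * x + wedge q p * wedge q p = P * Q"
    by (simp add: x_def P_def Q_def wedge_def pq algebra_simps)
  then have "x * x = P * Q" using \<open>wedge q p = 0\<close> by simp
  moreover have "x * x < Q * Q"
    using x by (metis abs_ge_zero abs_mult_self_eq mult_strict_mono' )
  moreover have "Q * Q \<le> P * Q"
    using \<open>Q < P\<close> x by (intro mult_right_mono) auto
  ultimately show False by simp
qed

lemma norm_line_lower_bound: "(\<bar>real_of_int n\<bar> - 1) * norm (vec2 p) \<le> norm (vec2 (q + iscale n p))"
proof -
  have "\<bar>real_of_int n\<bar> * norm (vec2 p) = norm (of_int n *\<^sub>R vec2 p)" by simp
  also have "\<dots> \<le> norm (vec2 (q + iscale n p)) + norm (vec2 q)"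
    unfolding vec2_add_iscale by (metis add.commute add_diff_cancel_left' norm_triangle_ineq4)
  finally show ?thesis using q_small by (simp add: algebra_simps)
qed

lemma inverse_rho_decay:
  assumes "\<bar>n\<bar> \<ge> 3"
  shows "\<bar>1 / rho p q n - 1\<bar> \<le> 3 * inverse ((real_of_int \<bar>n\<bar>)\<^sup>2)"
proof -
  define m where "m = real_of_int \<bar>n\<bar>"
  define P where "P = (norm (vec2 p))\<^sup>2"
  define N where "N = (norm (vec2 (q + iscale n p)))\<^sup>2"
  have m: "m \<ge> 3" using assms by (simp add: m_def)
  have P: "P > 0" using norm_p_pos by (simp add: P_def)
  have "((m - 1) * norm (vec2 p))\<^sup>2 \<le> N"
    unfolding N_def m_def using norm_line_lower_bound[of n] m norm_p_pos
    by (intro power_mono) (auto simp: m_def)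
  then have N: "(m - 1)\<^sup>2 * P \<le> N" by (simp add: P_def power_mult_distrib)
  have "m\<^sup>2 / 3 * P \<le> ((m - 1)\<^sup>2 - 1) * P"
  proof (intro mult_right_mono)
    \<comment> \<open>The difference of the two sides is \<open>2 / 3 * m * (m - 3)\<close>, whence
      the threshold 3 in the assumption.\<close>
    have "0 \<le> m * (m - 3)" using m by simp
    then show "m\<^sup>2 / 3 \<le> (m - 1)\<^sup>2 - 1" by (simp add: power2_eq_square algebra_simps)
  qed (use P in auto)
  also have "\<dots> \<le> N - P" using N by (simp add: algebra_simps)
  finally have NP: "m\<^sup>2 / 3 * P \<le> N - P" .
  moreover have pos: "m\<^sup>2 / 3 * P > 0" using m P by simp
  ultimately have lt: "N - P > 0" by linarith
  then have N0: "N > 0" using P by linarith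
  have "1 / rho p q n - 1 = P / (N - P)"
    using lt N0 by (simp add: rho_def P_def[symmetric] N_def[symmetric] field_simps)
  then have "\<bar>1 / rho p q n - 1\<bar> = P / (N - P)" using P lt by simp
  also have "\<dots> \<le> P / (m\<^sup>2 / 3 * P)"
    using NP pos P lt by (intro divide_left_mono mult_pos_pos) auto
  also have "\<dots> = 3 * inverse (m\<^sup>2)" using P m by (simp add: field_simps)
  finally show ?thesis by (simp add: m_def)
qed

lemma rho_less_1: "rho p q n < 1"
  using norm_p_pos lattice_line_nonzero[of n] by (simp add: rho_def vec2_eq_0_iff)

lemma rho_positive: "n \<noteq> 0 \<Longrightarrow> rho p q n > 0"
proof -
  assume "n \<noteq> 0"
  then have lt: "(norm (vec2 p))\<^sup>2 < (norm (vec2 (q + iscale n p)))\<^sup>2"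
    using large by (intro power_strict_mono) auto
  moreover have "0 < (norm (vec2 (q + iscale n p)))\<^sup>2"
    using lt by (meson le_less_trans zero_le_power2)
  ultimately show ?thesis by (simp add: rho_def)
qed

lemma rho_0_negative: "rho p q 0 < 0"
proof -
  have "q + iscale 0 p = q" by (simp add: iscale_def zero_prod_def[symmetric])
  then have "vec2 q \<noteq> 0" using lattice_line_nonzero[of 0] by (simp add: vec2_eq_0_iff)
  then show ?thesis
    using power_strict_mono[OF q_small, of 2] \<open>q + iscale 0 p = q\<close> by (simp add: rho_def)
qed

lemma euler_potential_rho:
  assumes "Re lam > 0"
  shows "euler_potential (rho p q) lam"
proof
  show "rho p q n \<noteq> 0" for n
    using rho_positive[of n] rho_0_negative by (cases "n = 0") auto
  show "rho p q n \<le> 1" for n using rho_less_1[of n] by simp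
  show "(\<lambda>n. \<bar>1 / rho p q n - 1\<bar>) summable_on UNIV"
  proof (rule summable_on_intI)
    have s: "summable (\<lambda>n. 3 * inverse ((real n)\<^sup>2))"
      by (intro summable_mult inverse_power_summable) simp
    show "summable (\<lambda>n. \<bar>1 / rho p q (int n) - 1\<bar>)"
      by (rule summable_comparison_test'[OF s, of 3]) (use inverse_rho_decay[of "int n" for n] in simp)
    show "summable (\<lambda>n. \<bar>1 / rho p q (- int n) - 1\<bar>)"
      by (rule summable_comparison_test'[OF s, of 3]) (use inverse_rho_decay[of "- int n" for n] in simp)
  qed simp
qed (use assms rho_positive in auto)

text \<open>The wedge with \<open>p\<close> is constant along the line, and the bracket in
  \<open>\<beta>\<close> is \<open>- rho p q m\<close> over the squared norm of
  \<open>p\<close>.\<close>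

lemma Lq_op_eq:
  "Lq_op \<alpha> p q w n = of_real (1 / 2 * \<alpha> * of_int (wedge q p) / (norm (vec2 p))\<^sup>2) *
     (of_real (rho p q (n - 1)) * w (n - 1) - of_real (rho p q (n + 1)) * w (n + 1))"
proof -
  have "\<alpha> * \<beta> p (q + iscale m p) = 1 / 2 * \<alpha> * of_int (wedge q p) / (norm (vec2 p))\<^sup>2 * rho p q m" for m
  proof -
    have "wedge p (q + iscale m p) = - wedge q p"
      by (simp add: wedge_def iscale_def algebra_simps)
    moreover have "norm (vec2 p) \<noteq> 0" "norm (vec2 (q + iscale m p)) \<noteq> 0"
      using p lattice_line_nonzero by (simp_all add: vec2_eq_0_iff)
    ultimately show ?thesis
      using p lattice_line_nonzero[of m] by (simp add: \<beta>_def rho_def field_simps)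
  qed
  then show ?thesis
    unfolding Lq_op_def by (simp add: algebra_simps del: of_real_mult) (simp add: algebra_simps)
qed

text \<open>Without normalization the operator carries a nonzero factor \<open>\<kappa>\<close>,
  which rescales the eigenvalue. For \<open>\<kappa> < 0\<close>, conjugation by alternating signs
  reverses the sign of the normalized operator, so the eigenvalue obtained is
  \<open>\<bar>\<kappa>\<bar> * t\<close> in both cases.\<close>

lemma Lq_positive_eigenvalue:
  assumes "\<alpha> \<noteq> 0"
  obtains t where "t > 0" "l2_eigenvalue (Lq_op \<alpha> p q) (of_real t)"
proof -
  obtain t where t: "t > 0" "F_fun (rho p q) (of_real t) = 0"
    using positive_zero_exists[OF euler_potential_rho rho_0_negative] .
  interpret euler_potential "rho p q" "of_real t" by (rule euler_potential_rho) (simp add: t)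
  define \<kappa> where "\<kappa> = 1 / 2 * \<alpha> * of_int (wedge q p) / (norm (vec2 p))\<^sup>2"
  have \<kappa>: "\<kappa> \<noteq> 0" using assms wedge_nonzero norm_p_pos by (simp add: \<kappa>_def)
  let ?L = "\<lambda>w n. of_real (rho p q (n - 1)) * w (n - 1) - of_real (rho p q (n + 1)) * w (n + 1) :: complex"
  obtain w where w: "w \<in> l2" "w \<noteq> (\<lambda>_. 0)" "?L w = (\<lambda>n. of_real t * w n)"
    using eigenvalue_iff_F_zero t(2) by (auto simp: l2_eigenvalue_def l2_dom_def)
  define v where "v n = (if \<kappa> > 0 then w n else (- 1) powi n * w n)" for n
  have "norm (v n) = norm (w n)" for n by (simp add: v_def norm_mult)
  then have v: "v \<in> l2" using w(1) by (simp add: l2_def)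
  have v0: "v \<noteq> (\<lambda>_. 0)" using w(2) by (auto simp: v_def fun_eq_iff)
  have Lv: "Lq_op \<alpha> p q v = (\<lambda>n. of_real (\<bar>\<kappa>\<bar> * t) * v n)"
  proof
    fix n
    have wn: "?L w n = of_real t * w n" using fun_cong[OF w(3), of n] .
    show "Lq_op \<alpha> p q v n = of_real (\<bar>\<kappa>\<bar> * t) * v n"
    proof (cases "\<kappa> > 0")
      case True
      then show ?thesis
        using wn unfolding Lq_op_eq \<kappa>_def[symmetric] by (simp add: v_def)
    next
      case False
      have "(- 1 :: complex) powi (n - 1) = - ((- 1) powi n)"
        using powi_minus_one_step[of "n - 1"] by simp
      then have "?L v n = of_real (rho p q (n - 1)) * (- ((- 1) powi n) * w (n - 1))
          - of_real (rho p q (n + 1)) * (- ((- 1) powi n) * w (n + 1))"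
        using False by (simp only: v_def powi_minus_one_step if_False)
      also have "\<dots> = - ((- 1) powi n * ?L w n)"
        by (simp add: algebra_simps)
      finally have "?L v n = - ((- 1) powi n * ?L w n)" .
      then show ?thesis
        using False unfolding Lq_op_eq \<kappa>_def[symmetric] by (simp add: v_def wn)
    qed
  qed
  have "(\<lambda>n. of_real (\<bar>\<kappa>\<bar> * t) * v n) \<in> l2"
    using v by (rule l2_comparison[where C = "\<bar>\<bar>\<kappa>\<bar> * t\<bar>"]) (simp only: norm_mult norm_of_real order_refl)
  then have "l2_eigenvalue (Lq_op \<alpha> p q) (of_real (\<bar>\<kappa>\<bar> * t))"
    using v v0 Lv unfolding l2_eigenvalue_def l2_dom_def by (intro bexI[of _ v]) auto
  then show thesis using that[of "\<bar>\<kappa>\<bar> * t"] \<kappa> t(1) by simp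
qed

text \<open>Translation by \<open>p\<close> preserves the line and its complement, so extension by 0
  intertwines the two operators.\<close>

lemma L_op_eigenvalue:
  assumes "l2_eigenvalue (Lq_op \<alpha> p q) lam"
  shows "l2_eigenvalue (L_op \<alpha> p) lam"
proof -
  obtain w where w: "w \<in> l2" "w \<noteq> (\<lambda>_. 0)" "Lq_op \<alpha> p q w = (\<lambda>n. lam * w n)"
    using assms by (auto simp: l2_eigenvalue_def l2_dom_def)
  define e where "e n = q + iscale n p" for n
  have inj: "inj e"
  proof (rule injI)
    fix m n assume "e m = e n"
    then have "m * fst p = n * fst p" "m * snd p = n * snd p" by (simp_all add: e_def iscale_def prod_eq_iff)
    then show "m = n" using p by (auto simp: prod_eq_iff)
  qed
  have e_shift: "e n - p = e (n - 1)" "e n + p = e (n + 1)" for n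
    by (simp_all add: e_def iscale_def prod_eq_iff algebra_simps)
  define W where "W k = (if k \<in> range e then w (inv e k) else 0)" for k
  have We: "W (e n) = w n" for n using inj by (simp add: W_def)
  have eig: "L_op \<alpha> p W k = lam * W k" for k
  proof (cases "k \<in> range e")
    case True
    then obtain n where "k = e n" by auto
    then show ?thesis
      using fun_cong[OF w(3), of n] by (simp add: L_op_def Lq_op_def e_shift We e_def[symmetric])
  next
    case False
    have "k \<in> range e" if "k - p = e n \<or> k + p = e n" for n
    proof -
      have "k = e n + p \<or> k = e n - p" using that by (auto simp: algebra_simps)
      then show ?thesis unfolding e_shift by blast
    qed
    then have "k - p \<notin> range e" "k + p \<notin> range e" using False by blast+
    then show ?thesis using False by (simp add: L_op_def W_def)
  qed
  have "(\<lambda>k. (norm (W k))\<^sup>2) summable_on range e"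
    using w(1) by (simp add: summable_on_reindex[OF inj] o_def We l2_def)
  moreover have "(\<lambda>k. (norm (W k))\<^sup>2) summable_on range e \<longleftrightarrow> (\<lambda>k. (norm (W k))\<^sup>2) summable_on UNIV"
    by (intro summable_on_cong_neutral) (auto simp: W_def)
  ultimately have "(\<lambda>k. (norm (W k))\<^sup>2) summable_on UNIV" by simp
  then have W: "W \<in> l2" by (simp add: l2_def)
  have "(\<lambda>k. lam * W k) \<in> l2"
    using W by (rule l2_comparison[where C = "norm lam"]) (simp add: norm_mult)
  moreover have "W \<noteq> (\<lambda>_. 0)"
  proof
    assume "W = (\<lambda>_. 0)"
    then have "w n = 0" for n using We[of n] by simp
    then show False using w(2) by blast
  qed
  moreover have "L_op \<alpha> p W = (\<lambda>k. lam * W k)" using eig by blast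
  ultimately show ?thesis
    using W unfolding l2_eigenvalue_def l2_dom_def by (intro bexI[of _ W]) auto
qed

end

text \<open>An eigenvector and 0 have the same image, so injectivity on the maximal domain
  fails.\<close>

lemma eigenvalue_L_op_in_spectrum:
  assumes "l2_eigenvalue (L_op \<alpha> p) lam"
  shows "lam \<in> l2_spectrum (L_op \<alpha> p)"
proof -
  obtain w where w: "w \<in> l2_dom (L_op \<alpha> p)" "w \<noteq> (\<lambda>_. 0)" "L_op \<alpha> p w = (\<lambda>i. lam * w i)"
    using assms by (auto simp: l2_eigenvalue_def)
  have "(\<lambda>_. 0) \<in> l2_dom (L_op \<alpha> p)" by (simp add: l2_dom_def l2_def L_op_def)
  moreover have "(\<lambda>i. L_op \<alpha> p w i - lam * w i) = (\<lambda>i. L_op \<alpha> p (\<lambda>_. 0) i - lam * 0)"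
    using w(3) by (simp add: L_op_def)
  ultimately have "\<not> inj_on (\<lambda>w i. L_op \<alpha> p w i - lam * w i) (l2_dom (L_op \<alpha> p))"
    using w(1,2) unfolding inj_on_def by blast
  then show ?thesis by (simp add: l2_spectrum_def l2_resolvent_set_def bij_betw_def)
qed

theorem corollary1p3:
  fixes p q :: "int \<times> int" and \<alpha> :: real
  assumes "p \<noteq> 0"
    and "norm (vec2 q) < norm (vec2 p)"
    and "\<And>n::int. n \<noteq> 0 \<Longrightarrow> norm (vec2 (q + iscale n p)) > norm (vec2 p)"
    and "\<alpha> \<noteq> 0"
  shows "(1 / 2 * \<alpha> * of_int (wedge q p) / (norm (vec2 p))\<^sup>2 = 1 \<longrightarrow>
            (\<forall>lam::complex. Re lam > 0 \<longrightarrow>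
               (l2_eigenvalue (Lq_op \<alpha> p q) lam \<longleftrightarrow> det_I_minus_K (rho p q) lam = 0) \<and>
               (l2_eigenvalue (Lq_op \<alpha> p q) lam \<longleftrightarrow> det_I_minus_T (rho p q) lam = 0) \<and>
               (l2_eigenvalue (Lq_op \<alpha> p q) lam \<longleftrightarrow> E_fun (rho p q) lam = 0) \<and>
               (l2_eigenvalue (Lq_op \<alpha> p q) lam \<longleftrightarrow> F_fun (rho p q) lam = 0) \<and>
               (l2_eigenvalue (Lq_op \<alpha> p q) lam \<longleftrightarrow> G_fun (rho p q) lam = 0))) \<and>
         (\<exists>lam::real. lam > 0 \<and> l2_eigenvalue (Lq_op \<alpha> p q) (of_real lam)) \<and>
         (\<exists>lam::real. lam > 0 \<and> l2_eigenvalue (L_op \<alpha> p) (of_real lam)) \<and>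
         euler_steady_state (kolmogorov_flow \<alpha> p) \<and>
         linearly_unstable (kolmogorov_flow \<alpha> p)"
proof (intro conjI impI allI)
  obtain t where t: "t > 0" "l2_eigenvalue (Lq_op \<alpha> p q) (of_real t)"
    using Lq_positive_eigenvalue[OF assms(1,2) _ assms(4)] assms(3) by blast
  then have L: "l2_eigenvalue (L_op \<alpha> p) (of_real t)"
    using L_op_eigenvalue[OF assms(1,2)] assms(3) by blast
  show "\<exists>lam::real. lam > 0 \<and> l2_eigenvalue (Lq_op \<alpha> p q) (of_real lam)"
    "\<exists>lam::real. lam > 0 \<and> l2_eigenvalue (L_op \<alpha> p) (of_real lam)"
    using t L by blast+
  show "linearly_unstable (kolmogorov_flow \<alpha> p)"
    unfolding linearly_unstable_def euler_linearization_kolmogorov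
    using eigenvalue_L_op_in_spectrum[OF L] t(1) by (intro bexI[of _ "of_real t"]) auto
  show "euler_steady_state (kolmogorov_flow \<alpha> p)" by (rule kolmogorov_steady_state)
next
  fix lam :: complex
  assume norm: "1 / 2 * \<alpha> * of_int (wedge q p) / (norm (vec2 p))\<^sup>2 = 1" and lam: "Re lam > 0"
  interpret euler_potential "rho p q" lam
    by (rule euler_potential_rho) (use assms lam in auto)
  have "Lq_op \<alpha> p q w n =
      of_real (1 / 2 * \<alpha> * of_int (wedge q p) / (norm (vec2 p))\<^sup>2) *
        (of_real (rho p q (n - 1)) * w (n - 1) - of_real (rho p q (n + 1)) * w (n + 1))" for w n
    by (rule Lq_op_eq) (use assms in auto)
  then have "Lq_op \<alpha> p q = (\<lambda>w n. of_real (rho p q (n - 1)) * w (n - 1) - of_real (rho p q (n + 1)) * w (n + 1))"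
    unfolding norm by (intro ext) simp
  then have *: "l2_eigenvalue (Lq_op \<alpha> p q) lam \<longleftrightarrow> F_fun (rho p q) lam = 0"
    using eigenvalue_iff_F_zero by simp
  show "l2_eigenvalue (Lq_op \<alpha> p q) lam \<longleftrightarrow> det_I_minus_K (rho p q) lam = 0"
    "l2_eigenvalue (Lq_op \<alpha> p q) lam \<longleftrightarrow> det_I_minus_T (rho p q) lam = 0"
    "l2_eigenvalue (Lq_op \<alpha> p q) lam \<longleftrightarrow> E_fun (rho p q) lam = 0"
    "l2_eigenvalue (Lq_op \<alpha> p q) lam \<longleftrightarrow> F_fun (rho p q) lam = 0"
    "l2_eigenvalue (Lq_op \<alpha> p q) lam \<longleftrightarrow> G_fun (rho p q) lam = 0"
    using * det_I_minus_K_eq det_I_minus_T_eq E_fun_eq G_fun_eq by simp_all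
qed

end
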